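(* Let $f$ be an LLD meromorphic function. If $m(f)\neq g_W(f)+1$, then $f$ is of Hadamard type, i.e. $g_W(f)\le g_H(f)=g(f)$. Moreover, every Dirichlet series $f$ is of Hadamard type, i.e. $g_W(f)\le g_H(f)=g(f)$, unconditionally (with no hypothesis on $m(f)$).
   Context: All meromorphic functions are on $\mathbb{C}$, not identically zero, and of finite order (for entire $f$ the order is $o(f)=\limsup_{R\to\infty}\frac{\log\log\|f\|_{C^0(B(0,R))}}{\log R}$; for meromorphic $f$ it is the usual Nevanlinna order). LLD (left located divisor) meromorphic function: a meromorphic function $f$ of finite order with $\sigma_1=\sup_{\rho\in f^{-1}(\{0,\infty\})}\Re\rho<+\infty$. Divisor: $(\rho)$ is the set of zeros and poles of $f$, with multiplicity $n_\rho\in\mathbb{Z}$ (positive for zeros, negative for poles; $n_0=0$ if $0$ is neither a zero nor a pole). Convergence exponent: $d=d(f)$ is the minimal integer $d\ge 0$ with $\sum_{\rho\ne0}|n_\rho|\,|\rho|^{-d}<+\infty$. Genus: $f$ has the Hadamard factorization $f(s)=s^{n_0}e^{Q_f(s)}\prod_{\rho\neq0}\left(E_{d-1}(s/\rho)\right)^{n_\rho}$, where $E_n(z)=(1-z)e^{z+\frac12z^2+\cdots+\frac1nz^n}$ (empty exponent, i.e. $1-z$, for $n\le 0$) and $Q_f$ is a polynomial, unique up to adding an integer multiple of $2\pi i$. Put $g_W(f)=\deg Q_f$ (Weierstrass genus), $g_H(f)=d(f)-1$ (Hadamard genus), $g(f)=\max(g_W(f),g_H(f))$ (genus). Hadamard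 type: $f$ is of Hadamard type when $g(f)=g_H(f)=d(f)-1\ge g_W(f)$. Inverse Laplace transform: if $F$ is holomorphic with polynomial growth on $\{\Re s>\sigma_2\}$, where $\sigma_2>\max(0,\sigma_1)$, then for $c>\sigma_2$ and $n$ large enough that the integral converges absolutely, $\mathcal{L}^{-1}(F)(t)=\frac1{2\pi}\frac{D^n}{Dt^n}\int_{\mathbb{R}}\frac{F(c+iu)}{(c+iu)^n}e^{(c+iu)t}\,du$, the derivative being taken in the distributional sense on $\mathbb{R}$; it is independent of $c$ and $n$. For LLD $f$, $f'/f$ has polynomial growth on such a half-plane, so $\mathcal{L}^{-1}(f'/f)$ is defined. Order of a distribution: a distribution on $\mathbb{R}$ has order $n$ if $n$ is the minimal integer such that it is the $n$-th derivative of a continuous function. Distributional vertical order: $m(f)$ is the minimal integer $m\ge0$ such that $\mathcal{L}^{-1}(f'/f)$ is the $m$-th distributional derivative of a continuous function on $\mathbb{R}$. Dirichlet series: a function $f(s)=1+\sum_{n\ge1}a_ne^{-\lambda_ns}$ with $a_n\in\mathbb{C}$, $0<\lambda_1<\lambda_2<\cdots$, where $(\lambda_n)$ is either finite or $\lambda_n\to+\infty$, with $\sum_{n\ge1}|a_n|e^{-\lambda_n\bar\sigma}<+\infty$ for some $\bar\sigma\in\mathbb{R}$, and which extends to a meromorphic function of finite order on $\mathbb{C}$.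
   Formalization: The first part excludes rational functions with numerator and denominator of equal degree (there d=0, g_H=-1, g_W=0, m(f)=0, so the claim fails), and the Dirichlet series part excludes the constant f=1, for which g_H=-1 and g_W=0. *)

theory Defs
  imports "HOL-Complex_Analysis.Complex_Analysis"
begin

section \<open>Meromorphic functions of finite order\<close>

text \<open>
  A meromorphic function on the complex plane is represented by its canonical representative
  (\<open>nicely_meromorphic_on\<close>): removable singularities are removed and the value at a pole is 0.
  The multiplicity of a zero or pole \<open>\<rho>\<close> is \<open>zorder f \<rho>\<close>, positive at zeros and negative
  at poles.
\<close>

definition divisor_supp :: "(complex \<Rightarrow> complex) \<Rightarrow> complex set" where
  "divisor_supp f = {\<rho>. is_pole f \<rho> \<or> f \<rho> = 0}"

definition entire_order :: "(complex \<Rightarrow> complex) \<Rightarrow> ereal" where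
  "entire_order f =
     Limsup at_top (\<lambda>R::real. ereal (ln (ln (SUP z\<in>ball 0 R. norm (f z))) / ln R))"

definition pole_count :: "(complex \<Rightarrow> complex) \<Rightarrow> real \<Rightarrow> real" where
  "pole_count f r = (\<Sum>\<rho> | is_pole f \<rho> \<and> norm \<rho> \<le> r. real_of_int (- zorder f \<rho>))"

definition nevanlinna_N :: "(complex \<Rightarrow> complex) \<Rightarrow> real \<Rightarrow> real" where
  "nevanlinna_N f r =
     integral {0..r} (\<lambda>t. (pole_count f t - pole_count f 0) / t) + pole_count f 0 * ln r"

definition nevanlinna_m :: "(complex \<Rightarrow> complex) \<Rightarrow> real \<Rightarrow> real" where
  "nevanlinna_m f r =
     1 / (2 * pi) * integral {0..2 * pi} (\<lambda>\<theta>. ln (max 1 (norm (f (of_real r * cis \<theta>)))))"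

definition nevanlinna_T :: "(complex \<Rightarrow> complex) \<Rightarrow> real \<Rightarrow> real" where
  "nevanlinna_T f r = nevanlinna_m f r + nevanlinna_N f r"

definition nevanlinna_order :: "(complex \<Rightarrow> complex) \<Rightarrow> ereal" where
  "nevanlinna_order f = Limsup at_top (\<lambda>r::real. ereal (ln (nevanlinna_T f r) / ln r))"

definition growth_order :: "(complex \<Rightarrow> complex) \<Rightarrow> ereal" where
  "growth_order f = (if f holomorphic_on UNIV then entire_order f else nevanlinna_order f)"

definition meromorphic_finite_order :: "(complex \<Rightarrow> complex) \<Rightarrow> bool" where
  "meromorphic_finite_order f \<longleftrightarrow>
     f nicely_meromorphic_on UNIV \<and> f \<noteq> (\<lambda>_. 0) \<and> growth_order f < \<infinity>"

definition LLD :: "(complex \<Rightarrow> complex) \<Rightarrow> bool" where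
  "LLD f \<longleftrightarrow> meromorphic_finite_order f \<and> bdd_above (Re ` divisor_supp f)"


section \<open>Convergence exponent and genus\<close>

definition conv_exponent :: "(complex \<Rightarrow> complex) \<Rightarrow> nat" where
  "conv_exponent f =
     (LEAST d. (\<lambda>\<rho>. real_of_int \<bar>zorder f \<rho>\<bar> / norm \<rho> ^ d) summable_on (divisor_supp f - {0}))"

text \<open>
  The product over the divisor is the limit along the net of finite subsets.  For
  \<open>conv_exponent f = 0\<close> the natural number \<open>conv_exponent f - 1\<close> is 0, as it should be: elementary
  factors of nonpositive index are all \<open>1 - z\<close>.  At zeros and poles both sides are 0.
\<close>

definition hadamard_factorization :: "(complex \<Rightarrow> complex) \<Rightarrow> complex poly \<Rightarrow> bool" where
  "hadamard_factorization f Q \<longleftrightarrow>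
     (\<forall>s. ((\<lambda>X. s powi zorder f 0 * exp (poly Q s) *
               (\<Prod>\<rho>\<in>X. weierstrass_factor (conv_exponent f - 1) (s / \<rho>) powi zorder f \<rho>))
           \<longlongrightarrow> f s) (finite_subsets_at_top (divisor_supp f - {0})))"

text \<open>
  The polynomial \<open>Q\<close> is unique up to an additive constant in \<open>2\<pi>i\<int>\<close>, so its degree is
  determined by \<open>f\<close>; constant polynomials, including 0, have degree 0.
\<close>

definition weierstrass_genus :: "(complex \<Rightarrow> complex) \<Rightarrow> int" where
  "weierstrass_genus f = (THE g. \<exists>Q. hadamard_factorization f Q \<and> g = int (degree Q))"

definition hadamard_genus :: "(complex \<Rightarrow> complex) \<Rightarrow> int" where
  "hadamard_genus f = int (conv_exponent f) - 1"

definition genus :: "(complex \<Rightarrow> complex) \<Rightarrow> int" where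
  "genus f = max (weierstrass_genus f) (hadamard_genus f)"

definition hadamard_type :: "(complex \<Rightarrow> complex) \<Rightarrow> bool" where
  "hadamard_type f \<longleftrightarrow> weierstrass_genus f \<le> hadamard_genus f \<and> hadamard_genus f = genus f"


section \<open>Distributions on the real line\<close>

text \<open>
  Distributions are represented by their action on test functions; their values at other
  arguments are irrelevant, and equality of distributions means equality on all test functions.
\<close>

type_synonym distr = "(real \<Rightarrow> complex) \<Rightarrow> complex"

definition vderiv :: "(real \<Rightarrow> complex) \<Rightarrow> real \<Rightarrow> complex" where
  "vderiv \<phi> = (\<lambda>t. vector_derivative \<phi> (at t))"

definition test_function :: "(real \<Rightarrow> complex) \<Rightarrow> bool" where
  "test_function \<phi> \<longleftrightarrow>
     (\<forall>n t. (vderiv ^^ n) \<phi> differentiable (at t)) \<and>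
     (\<exists>K. compact K \<and> (\<forall>t. t \<notin> K \<longrightarrow> \<phi> t = 0))"

definition distr_eq :: "distr \<Rightarrow> distr \<Rightarrow> bool" where
  "distr_eq S T \<longleftrightarrow> (\<forall>\<phi>. test_function \<phi> \<longrightarrow> S \<phi> = T \<phi>)"

definition distr_of_fun :: "(real \<Rightarrow> complex) \<Rightarrow> distr" where
  "distr_of_fun g = (\<lambda>\<phi>. LINT t|lborel. g t * \<phi> t)"

definition distr_deriv :: "distr \<Rightarrow> distr" where
  "distr_deriv T = (\<lambda>\<phi>. - T (vderiv \<phi>))"

definition distr_order :: "distr \<Rightarrow> nat" where
  "distr_order T =
     (LEAST n. \<exists>g. continuous_on UNIV g \<and> distr_eq T ((distr_deriv ^^ n) (distr_of_fun g)))"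


section \<open>Inverse Laplace transform\<close>

definition polynomial_growth_on :: "complex set \<Rightarrow> (complex \<Rightarrow> complex) \<Rightarrow> bool" where
  "polynomial_growth_on A F \<longleftrightarrow> (\<exists>C N. \<forall>s\<in>A. norm (F s) \<le> C * (1 + norm s) ^ N)"

definition laplace_integrand ::
    "(complex \<Rightarrow> complex) \<Rightarrow> real \<Rightarrow> nat \<Rightarrow> real \<Rightarrow> real \<Rightarrow> complex" where
  "laplace_integrand F c n t u = F (Complex c u) / Complex c u ^ n * exp (Complex c u * of_real t)"

definition laplace_admissible :: "(complex \<Rightarrow> complex) \<Rightarrow> real \<Rightarrow> nat \<Rightarrow> bool" where
  "laplace_admissible F c n \<longleftrightarrow>
     (\<exists>\<sigma>. 0 < \<sigma> \<and> \<sigma> < c \<and> F holomorphic_on {s. \<sigma> < Re s} \<and>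
          polynomial_growth_on {s. \<sigma> < Re s} F) \<and>
     (\<forall>t. integrable lborel (laplace_integrand F c n t))"

text \<open>
  The resulting distribution does not depend on the choice of the admissible pair \<open>(c, n)\<close>.
\<close>

definition inverse_laplace :: "(complex \<Rightarrow> complex) \<Rightarrow> distr" where
  "inverse_laplace F = (case (SOME (c, n). laplace_admissible F c n) of (c, n) \<Rightarrow>
     (\<lambda>\<phi>. 1 / (2 * of_real pi) *
           (distr_deriv ^^ n) (distr_of_fun (\<lambda>t. LINT u|lborel. laplace_integrand F c n t u)) \<phi>))"

text \<open>
  For \<open>F = f' / f\<close> with \<open>f\<close> LLD, holomorphy of \<open>F\<close> on \<open>{s. \<sigma> < Re s}\<close> already forces all
  zeros and poles of \<open>f\<close> into \<open>{s. Re s \<le> \<sigma>}\<close>.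
\<close>

definition vertical_order :: "(complex \<Rightarrow> complex) \<Rightarrow> nat" where
  "vertical_order f = distr_order (inverse_laplace (\<lambda>s. deriv f s / f s))"


section \<open>Dirichlet series\<close>

definition dirichlet_series :: "(complex \<Rightarrow> complex) \<Rightarrow> bool" where
  "dirichlet_series f \<longleftrightarrow> meromorphic_finite_order f \<and>
     (\<exists>(I :: nat set) (a :: nat \<Rightarrow> complex) (l :: nat \<Rightarrow> real) (\<sigma> :: real).
        ((\<exists>N. I = {1..N}) \<or> (I = {1..} \<and> filterlim l at_top sequentially)) \<and>
        strict_mono_on I l \<and> (\<forall>n\<in>I. 0 < l n) \<and>
        (\<lambda>n. norm (a n) * exp (- l n * \<sigma>)) summable_on I \<and>
        (\<forall>s. \<sigma> < Re s \<longrightarrow> f s = 1 + (\<Sum>\<^sub>\<infinity>n\<in>I. a n * exp (- of_real (l n) * s))))"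


section \<open>Degenerate functions\<close>

text \<open>
  For a rational function with a finite nonzero value at infinity, such as a nonzero constant or
  \<open>(s - 1) / (s - 2)\<close>, the convergence exponent is 0, so its Hadamard genus is -1, while its
  Weierstrass genus and its vertical order are 0.  These functions are not of Hadamard type
  although their vertical order differs from the Weierstrass genus plus 1.
\<close>

definition rational_finite_at_infinity :: "(complex \<Rightarrow> complex) \<Rightarrow> bool" where
  "rational_finite_at_infinity f \<longleftrightarrow>
     (\<exists>p q :: complex poly. p \<noteq> 0 \<and> q \<noteq> 0 \<and> degree p = degree q \<and>
        f = (\<lambda>s. poly p s / poly q s))"

end

theory Submission
  imports Defs "HOL-Probability.Probability" "HOL-Computational_Algebra.Fundamental_Theorem_Algebra"
begin

text \<open>
  Everything is read off from one partial fraction expansion.  Let \<open>Q\<close> be the polynomial of the Hadamard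
  factorization of \<open>f\<close>, let \<open>G\<close> be its degree, \<open>d\<close> the convergence exponent, \<open>D = max d 1\<close>, and let
  \<open>n \<rho>\<close> be the multiplicity of the divisor at \<open>\<rho>\<close>.  Logarithmic differentiation of the factorization gives
  \<open>f' / f = Q' + n 0 / s + (\<Sum>\<rho>. n \<rho> * (s / \<rho>) ^ (D - 1) / (s - \<rho>))\<close>, the sum running over \<open>\<rho> \<noteq> 0\<close>
  (\<open>hadamard_factorization_exists\<close>).  The inverse Laplace transform acts on this term by term:
  \<open>s ^ k\<close> becomes the \<open>k\<close>-th derivative of the Dirac mass at 0, \<open>1 / s\<close> becomes the Heaviside function,
  and since the general term is \<open>s ^ D * (n \<rho> / \<rho> ^ D) * (1 / (s - \<rho>) - 1 / s)\<close>, it becomes the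
  \<open>D\<close>-th derivative of the continuous function which is \<open>(n \<rho> / \<rho> ^ D) * (exp (\<rho> t) - 1)\<close> for \<open>t \<ge> 0\<close>
  and 0 for \<open>t \<le> 0\<close>.  The real parts of the \<open>\<rho>\<close> are bounded above and
  \<open>\<Sum>\<rho>. \<bar>n \<rho>\<bar> / \<bar>\<rho>\<bar> ^ D\<close> is finite, so these functions add up locally uniformly, and the inverse
  Laplace transform of \<open>f' / f\<close> is a combination of derivatives of the Dirac mass of order below \<open>G\<close>, plus
  \<open>n 0\<close> times the Heaviside function, plus the \<open>D\<close>-th derivative of a continuous function
  (\<open>inverse_laplace_logderiv\<close>).

  If \<open>f\<close> is not of Hadamard type, then \<open>d \<le> G\<close>.  Suppose first that \<open>G \<ge> 1\<close>.  The leading Dirac term, a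
  multiple of the derivative of order \<open>G - 1\<close> of the Dirac mass, is the derivative of order \<open>G + 1\<close> of
  a continuous function, namely of a multiple of \<open>max t 0\<close>, and everything else is
  the derivative of order \<open>G\<close> of a continuous function.  The leading term is not.  To see this, evaluate on
  \<open>\<phi> (m t)\<close> for large \<open>m\<close>: a \<open>G\<close>-th derivative of a continuous function contributes \<open>o (m ^ (G - 1))\<close>, whereas
  the leading term contributes a constant times \<open>m ^ (G - 1)\<close>.  Hence the vertical order is exactly \<open>G + 1\<close>
  (\<open>vertical_order_eq\<close>).  If \<open>G = d = 0\<close>, the divisor is finite, \<open>f\<close> is rational, and up to a continuous
  function the distribution is the total degree of the divisor times the Heaviside function, again of order
  \<open>G + 1 = 1\<close> unless that degree vanishes, which means that \<open>f\<close> is finite and nonzero at infinity.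

  For a Dirichlet series, \<open>f - 1\<close> and therefore \<open>f' / f\<close> decay like \<open>exp (- \<delta> Re s)\<close>.  The pairing of the
  inverse Laplace transform with a test function is an integral over the line \<open>Re s = c\<close> that does not depend
  on \<open>c\<close>; for a test function supported in a sufficiently small neighbourhood of 0 it tends to 0 as \<open>c\<close>
  grows, so the distribution vanishes near 0 (\<open>lld_distr_vanishes_near_0\<close>).  This excludes the leading
  Dirac term that \<open>d \<le> G\<close> with \<open>G \<ge> 1\<close> would force.  If \<open>G = d = 0\<close>, then \<open>f\<close> is a rational function that
  approaches 1 exponentially fast, hence \<open>f = 1\<close>.

  Finite order enters through Jensen's formula (\<open>jensen_estimate\<close>), which bounds both the mean of \<open>\<bar>ln \<bar>f\<bar>\<bar>\<close>
  over a circle and the size of the divisor in a disc by a power of the radius.  The second bound makes \<open>d\<close>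
  finite.  The first one bounds the Taylor coefficients of \<open>f' / f\<close> minus its polar part in a large disc, and
  letting the disc grow only a polynomial survives in the limit (\<open>partial_logderiv_limit\<close>).
\<close>

section \<open>Taylor coefficients as integrals over a circle\<close>

text \<open>
  Cauchy's formula for higher derivatives, written as a Fourier coefficient of \<open>B\<close> on the circle.
\<close>

lemma taylor_coeff_circle_integral:
  assumes B: "B holomorphic_on ball 0 R" and r: "0 < r" "r < R"
  shows "((\<lambda>\<theta>. B (of_real r * cis \<theta>) * cis (- (real k * \<theta>))) has_integral
           2 * of_real pi * of_real r ^ k * ((deriv ^^ k) B 0 / fact k)) {0..2*pi}"
proof -
  have cont: "continuous_on (cball 0 r) B"
    by (rule continuous_on_subset[OF holomorphic_on_imp_continuous_on[OF B]]) (use r in auto)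
  have hol: "B holomorphic_on ball 0 r"
    by (rule holomorphic_on_subset[OF B]) (use r in auto)
  have "((\<lambda>u. B u / (u - 0) ^ Suc k) has_contour_integral
          ((2 * pi * \<i>) / fact k * (deriv ^^ k) B 0)) (circlepath 0 r)"
    by (rule Cauchy_has_contour_integral_higher_derivative_circlepath[OF cont hol]) (use r in auto)
  hence "((\<lambda>t. B (0 + r * cis t) / (0 + r * cis t - 0) ^ Suc k * r * \<i> * cis t) has_integral
            ((2 * pi * \<i>) / fact k * (deriv ^^ k) B 0)) {0..2*pi}"
    unfolding circlepath_def by (subst (asm) has_contour_integral_part_circlepath_iff) auto
  hence "((\<lambda>t. (of_real r ^ k / \<i>) * (B (0 + r * cis t) / (0 + r * cis t - 0) ^ Suc k * r * \<i> * cis t))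
          has_integral (of_real r ^ k / \<i>) * ((2 * pi * \<i>) / fact k * (deriv ^^ k) B 0)) {0..2*pi}"
    by (rule has_integral_mult_right)
  moreover have "(of_real r ^ k / \<i>) * (B (0 + r * cis t) / (0 + r * cis t - 0) ^ Suc k * r * \<i> * cis t)
      = B (of_real r * cis t) * cis (- (real k * t))" for t
  proof -
    have "cis (- (real k * t)) = inverse (cis t ^ k)"
      by (simp only: Complex.DeMoivre cis_inverse)
    moreover have "(of_real r ^ k / \<i>) * (b / (of_real r * c) ^ Suc k * r * \<i> * c) = b * inverse (c ^ k)"
      if "c \<noteq> 0" for b c :: complex
      using r that by (simp add: power_mult_distrib divide_simps mult.left_commute[of \<i>])
    ultimately show ?thesis by simp
  qed
  moreover have "(of_real r ^ k / \<i>) * ((2 * pi * \<i>) / fact k * (deriv ^^ k) B 0)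
     = 2 * of_real pi * of_real r ^ k * ((deriv ^^ k) B 0 / fact k)"
    by (simp add: mult_ac)
  ultimately show ?thesis by (simp only:)
qed

lemma circle_integral_positive_frequency:
  assumes B: "B holomorphic_on ball 0 R" and r: "0 < r" "r < R" and k: "k > 0"
  shows "((\<lambda>\<theta>. B (of_real r * cis \<theta>) * cis (real k * \<theta>)) has_integral 0) {0..2*pi}"
proof -
  have "((\<lambda>\<theta>. B (of_real r * cis \<theta>) * (of_real r * cis \<theta>) ^ k * cis (- (real 0 * \<theta>))) has_integral
           2 * of_real pi * of_real r ^ 0 * ((deriv ^^ 0) (\<lambda>z. B z * z ^ k) 0 / fact 0)) {0..2*pi}"
    by (rule taylor_coeff_circle_integral[OF _ r]) (intro holomorphic_intros B)
  hence "((\<lambda>\<theta>. B (of_real r * cis \<theta>) * (of_real r * cis \<theta>) ^ k) has_integral 0) {0..2*pi}"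
    using k by (simp add: power_0_left)
  from has_integral_mult_right[OF this, of "inverse (of_real r ^ k)"]
  moreover have "inverse (of_real r ^ k) * (b * (of_real r * cis t) ^ k) = b * cis (real k * t)" for b t
    using r by (simp add: power_mult_distrib Complex.DeMoivre)
  ultimately show ?thesis by simp
qed

lemma circle_mean_Re:
  assumes B: "B holomorphic_on ball 0 R" and r: "0 < r" "r < R"
  shows "((\<lambda>\<theta>. Re (B (of_real r * cis \<theta>))) has_integral 2 * pi * Re (B 0)) {0..2*pi}"
  using has_integral_Re[OF taylor_coeff_circle_integral[OF assms, of 0]] by simp

lemma continuous_on_circle:
  assumes "continuous_on (sphere 0 r) B" "r \<ge> 0"
  shows "continuous_on A (\<lambda>\<theta>. B (complex_of_real r * cis \<theta>))"
  by (rule continuous_on_compose2[OF assms(1)])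
     (use assms(2) in \<open>auto intro!: continuous_intros simp: norm_mult\<close>)

text \<open>
  On the circle \<open>2 Re B\<close> is \<open>B + cnj B\<close>, and \<open>cnj B\<close> has no Fourier coefficient of positive index.  So the
  coefficients of \<open>B\<close> of positive index are those of \<open>2 Re B\<close>, and the mean of \<open>\<bar>Re B\<bar>\<close> bounds them.  This is
  the form needed for \<open>B\<close> a logarithm of a function \<open>f\<close>: only \<open>ln \<bar>f\<bar>\<close> is controlled by growth.
\<close>

lemma taylor_coeff_le_circle_integral_Re:
  assumes B: "B holomorphic_on ball 0 R" and r: "0 < r" "r < R" and k: "k > 0"
  shows "pi * r ^ k * norm ((deriv ^^ k) B 0 / fact k) \<le> integral {0..2*pi} (\<lambda>\<theta>. \<bar>Re (B (of_real r * cis \<theta>))\<bar>)"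
proof -
  let ?I = "2 * of_real pi * of_real r ^ k * ((deriv ^^ k) B 0 / fact k)"
  have cB: "continuous_on (sphere 0 r) B"
    by (rule continuous_on_subset[OF holomorphic_on_imp_continuous_on[OF B]]) (use r in auto)
  have 1: "((\<lambda>\<theta>. cnj (B (of_real r * cis \<theta>) * cis (real k * \<theta>))) has_integral cnj 0) {0..2*pi}"
    using iffD2[OF has_integral_cnj circle_integral_positive_frequency[OF assms]] by (simp only: o_def)
  have 2: "((\<lambda>\<theta>. B (of_real r * cis \<theta>) * cis (- (real k * \<theta>)) + cnj (B (of_real r * cis \<theta>) * cis (real k * \<theta>)))
         has_integral (?I + cnj 0)) {0..2*pi}"
    by (intro has_integral_add 1 taylor_coeff_circle_integral[OF B r])
  have "b * c + cnj (b * cnj c) = of_real (2 * Re b) * c" for b c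
  proof -
    have "b * c + cnj (b * cnj c) = (b + cnj b) * c" by (simp add: distrib_right)
    thus ?thesis unfolding complex_add_cnj .
  qed
  from this[where c = "cis (- (real k * \<theta>))" for \<theta>]
  have eq: "B (of_real r * cis \<theta>) * cis (- (real k * \<theta>)) + cnj (B (of_real r * cis \<theta>) * cis (real k * \<theta>))
      = of_real (2 * Re (B (of_real r * cis \<theta>))) * cis (- (real k * \<theta>))" for \<theta>
    unfolding cis_cnj minus_minus .
  have 3: "((\<lambda>\<theta>. of_real (2 * Re (B (of_real r * cis \<theta>))) * cis (- (real k * \<theta>))) has_integral ?I) {0..2*pi}"
    using 2 unfolding eq by simp
  have 4: "norm ?I \<le> integral {0..2*pi} (\<lambda>\<theta>. 2 * \<bar>Re (B (of_real r * cis \<theta>))\<bar>)"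
    unfolding integral_unique[OF 3, symmetric]
  proof (rule integral_norm_bound_integral)
    show "(\<lambda>\<theta>. of_real (2 * Re (B (of_real r * cis \<theta>))) * cis (- (real k * \<theta>))) integrable_on {0..2*pi}"
      using 3 by blast
    show "(\<lambda>\<theta>. 2 * \<bar>Re (B (of_real r * cis \<theta>))\<bar>) integrable_on {0..2*pi}"
      by (intro integrable_continuous_real continuous_intros continuous_on_circle[OF cB]) (use r in auto)
  qed (simp add: norm_mult)
  show ?thesis using 4 r by (simp add: norm_mult norm_power norm_divide mult.assoc)
qed

lemma poly_of_coeffs:
  fixes a :: "nat \<Rightarrow> complex"
  obtains q where "\<And>z. poly q z = (\<Sum>n<K. a n * z ^ n)" "\<And>i. i \<ge> K \<Longrightarrow> coeff q i = 0"
proof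
  define q where "q = (\<Sum>n<K. monom (a n) n)"
  show "poly q z = (\<Sum>n<K. a n * z ^ n)" for z by (simp add: q_def poly_sum poly_monom)
  show "coeff q i = 0" if "i \<ge> K" for i using that by (auto simp: q_def coeff_sum)
qed

text \<open>
  The Taylor polynomial of \<open>B'\<close> of degree below \<open>K\<close> is the approximation; its error in the half disc is a
  geometric tail of coefficients bounded through the mean of \<open>\<bar>Re B\<bar>\<close>.  The constant does not depend on
  \<open>B\<close> or the radius, so if the mean is at most of order \<open>r ^ K\<close>, the error tends to 0 as \<open>r\<close> grows.
\<close>

lemma deriv_approx_poly_real_part_bound:
  fixes K :: nat
  obtains C :: real where "C \<ge> 0"
    "\<And>B R r. \<lbrakk>B holomorphic_on ball 0 R; 0 < r; r < R\<rbrakk> \<Longrightarrow>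
       \<exists>q. (\<forall>i\<ge>K. coeff q i = 0) \<and>
         (\<forall>z. norm z \<le> r / 2 \<longrightarrow> norm (deriv B z - poly q z) \<le>
            C * integral {0..2*pi} (\<lambda>\<theta>. \<bar>Re (B (of_real r * cis \<theta>))\<bar>) / r ^ (K + 1) * norm z ^ K)"
proof -
  define s where "s = (\<lambda>j. real (K + 1 + j) * (1/2) ^ j)"
  have sm: "summable s"
  proof -
    have "summable (\<lambda>j. real (Suc j) * (1/2::real) ^ j)"
      using geometric_deriv_sums[of "1/2::real"] by (auto simp: sums_iff)
    hence "summable (\<lambda>j. real K * (1/2) ^ j + real (Suc j) * (1/2::real) ^ j)"
      by (intro summable_add summable_mult) (auto intro: summable_geometric)
    thus ?thesis by (simp add: s_def algebra_simps)
  qed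
  have s0: "s j \<ge> 0" for j by (simp add: s_def)
  show ?thesis
  proof (rule that[of "suminf s / pi"])
    show "suminf s / pi \<ge> 0" using s0 sm by (simp add: suminf_nonneg)
  next
    fix B :: "complex \<Rightarrow> complex" and R r :: real
    assume B: "B holomorphic_on ball 0 R" and r: "0 < r" "r < R"
    define I where "I = integral {0..2*pi} (\<lambda>\<theta>. \<bar>Re (B (of_real r * cis \<theta>))\<bar>)"
    define a where "a = (\<lambda>n. (deriv ^^ n) (deriv B) 0 / fact n)"
    have a_bd: "norm (a n) \<le> real (n + 1) * (I / pi) / r ^ (n + 1)" for n
    proof -
      have "pi * r ^ Suc n * norm ((deriv ^^ Suc n) B 0 / fact (Suc n)) \<le> I"
        unfolding I_def by (rule taylor_coeff_le_circle_integral_Re[OF B r]) simp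
      moreover have "(deriv ^^ Suc n) B 0 / fact (Suc n) = a n / of_nat (n + 1)"
        by (simp add: a_def funpow_Suc_right del: funpow.simps)
      ultimately have "pi * r ^ Suc n * norm (a n / of_nat (n + 1)) \<le> I"
        by (simp only:)
      hence "pi * r ^ Suc n * (norm (a n) / real (n + 1)) \<le> I"
        by (simp only: norm_divide norm_of_nat)
      thus ?thesis using r by (simp add: field_simps)
    qed
    have I0: "I \<ge> 0"
      unfolding I_def
      by (rule order_trans[OF _ taylor_coeff_le_circle_integral_Re[OF B r zero_less_one]]) (use r in simp)
    obtain q where q: "\<And>z. poly q z = (\<Sum>n<K. a n * z ^ n)" "\<And>i. i \<ge> K \<Longrightarrow> coeff q i = 0"
      using poly_of_coeffs[where K = K and a = a] by blast
    have bound: "norm (deriv B z - poly q z) \<le> suminf s / pi * I / r ^ (K + 1) * norm z ^ K"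
      if z: "norm z \<le> r / 2" for z
    proof -
      have "(\<lambda>n. a n * (z - 0) ^ n) sums deriv B z"
        unfolding a_def
        by (rule holomorphic_power_series[OF holomorphic_deriv[OF B open_ball]]) (use r z in auto)
      hence sums: "(\<lambda>n. a n * z ^ n) sums deriv B z" by simp
      hence "(\<lambda>j. a (j + K) * z ^ (j + K)) sums (deriv B z - poly q z)"
        unfolding q by (rule sums_split_initial_segment)
      hence eq: "deriv B z - poly q z = (\<Sum>j. a (j + K) * z ^ (j + K))"
        by (simp add: sums_iff)
      have bd: "norm (a (j + K) * z ^ (j + K)) \<le> (I / pi) / r ^ (K + 1) * norm z ^ K * s j" for j
      proof -
        have "norm (a (j + K) * z ^ (j + K)) \<le> real (j + K + 1) * (I / pi) / r ^ (j + K + 1) * norm z ^ (j + K)"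
          unfolding norm_mult norm_power by (rule mult_right_mono[OF a_bd]) simp
        also have "\<dots> = (I / pi) / r ^ (K + 1) * norm z ^ K * (real (j + K + 1) * (norm z / r) ^ j)"
          by (simp add: power_add power_divide mult_ac)
        also have "\<dots> \<le> (I / pi) / r ^ (K + 1) * norm z ^ K * (real (j + K + 1) * (1/2) ^ j)"
        proof (intro mult_left_mono power_mono)
          show "norm z / r \<le> 1 / 2" using r z by (simp add: field_simps)
        qed (use I0 r in auto)
        also have "real (j + K + 1) * (1/2) ^ j = s j" by (simp add: s_def add_ac)
        finally show ?thesis .
      qed
      have "norm (\<Sum>j. a (j + K) * z ^ (j + K)) \<le> (\<Sum>j. (I / pi) / r ^ (K + 1) * norm z ^ K * s j)"
        by (rule norm_suminf_le[OF bd]) (intro summable_mult sm)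
      also have "\<dots> = (I / pi) / r ^ (K + 1) * norm z ^ K * suminf s"
        by (rule suminf_mult[OF sm])
      also have "\<dots> = suminf s / pi * I / r ^ (K + 1) * norm z ^ K" by (simp add: mult_ac)
      finally show ?thesis unfolding eq .
    qed
    thus "\<exists>q. (\<forall>i\<ge>K. coeff q i = 0) \<and> (\<forall>z. norm z \<le> r / 2 \<longrightarrow> norm (deriv B z - poly q z) \<le>
            suminf s / pi * integral {0..2*pi} (\<lambda>\<theta>. \<bar>Re (B (of_real r * cis \<theta>))\<bar>) / r ^ (K + 1) * norm z ^ K)"
      unfolding I_def[symmetric] using q(2) bound by (intro exI[of _ q] conjI allI impI)
  qed
qed

section \<open>Divisors and zero-free parts\<close>

text \<open>
  The factor with simple zero \<open>\<rho>\<close> that occurs in the Hadamard product, with \<open>\<rho> = 0\<close> included.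
\<close>

definition root_factor :: "complex \<Rightarrow> complex \<Rightarrow> complex" where
  "root_factor \<rho> z = (if \<rho> = 0 then z else 1 - z / \<rho>)"

lemma root_factor_eq_0_iff [simp]: "root_factor \<rho> z = 0 \<longleftrightarrow> z = \<rho>"
  by (auto simp: root_factor_def field_simps)

lemma root_factor_holomorphic [holomorphic_intros]: "root_factor \<rho> holomorphic_on A"
  unfolding root_factor_def by (cases "\<rho> = 0") (auto intro!: holomorphic_intros)

lemma root_factor_analytic: "root_factor \<rho> analytic_on A"
  using root_factor_holomorphic[of \<rho> UNIV] analytic_on_holomorphic by blast

lemma zorder_root_factor: "zorder (root_factor \<rho>) w = (if w = \<rho> then 1 else 0)"
proof (cases "w = \<rho>")
  case True
  have "zorder (root_factor \<rho>) w = 1"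
  proof (rule zorder_eqI[of UNIV _ "\<lambda>_. if \<rho> = 0 then 1 else - 1 / \<rho>"])
    fix z assume "z \<noteq> w"
    thus "root_factor \<rho> z = (if \<rho> = 0 then 1 else - 1 / \<rho>) * (z - w) powi 1"
      using True by (auto simp: root_factor_def field_simps)
  qed (use True in auto)
  thus ?thesis using True by simp
next
  case False
  thus ?thesis using zorder_eq_0I[OF root_factor_analytic, of \<rho> w] by simp
qed

lemma eventually_root_factor_nonzero: "eventually (\<lambda>z. root_factor \<rho> z \<noteq> 0) (at w)"
  by (simp add: eventually_neq_at_within)

lemma eventually_prod_nonzero:
  fixes g :: "'a \<Rightarrow> complex \<Rightarrow> complex"
  assumes "finite X" "\<And>x. x \<in> X \<Longrightarrow> eventually (\<lambda>z. g x z \<noteq> 0) F"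
  shows "eventually (\<lambda>z. (\<Prod>x\<in>X. g x z) \<noteq> 0) F"
proof -
  have "eventually (\<lambda>z. \<forall>x\<in>X. g x z \<noteq> 0) F"
    using assms by (intro eventually_ball_finite) auto
  thus ?thesis by eventually_elim (use assms(1) in auto)
qed

lemma has_field_derivative_prod_power_int:
  fixes F :: "'a \<Rightarrow> complex \<Rightarrow> complex"
  assumes "finite X"
    and "\<And>\<rho>. \<rho> \<in> X \<Longrightarrow> (F \<rho> has_field_derivative F \<rho> z * L \<rho>) (at z)"
    and "\<And>\<rho>. \<rho> \<in> X \<Longrightarrow> F \<rho> z \<noteq> 0"
  shows "((\<lambda>z. \<Prod>\<rho>\<in>X. F \<rho> z powi m \<rho>) has_field_derivative
           (\<Prod>\<rho>\<in>X. F \<rho> z powi m \<rho>) * (\<Sum>\<rho>\<in>X. of_int (m \<rho>) * L \<rho>)) (at z)"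
  using assms
proof (induction X rule: finite_induct)
  case (insert a X)
  have a: "((\<lambda>z. F a z powi m a) has_field_derivative F a z powi m a * (of_int (m a) * L a)) (at z)"
    using DERIV_power_int[OF insert.prems(1)[of a], of "m a"] insert.prems(2)[of a]
    by (simp add: power_int_diff mult_ac)
  have "((\<lambda>z. F a z powi m a * (\<Prod>\<rho>\<in>X. F \<rho> z powi m \<rho>)) has_field_derivative
      F a z powi m a * (\<Prod>\<rho>\<in>X. F \<rho> z powi m \<rho>) * (of_int (m a) * L a + (\<Sum>\<rho>\<in>X. of_int (m \<rho>) * L \<rho>))) (at z)"
    by (rule DERIV_cong[OF DERIV_mult[OF a insert.IH]]) (use insert in \<open>auto simp: algebra_simps\<close>)
  thus ?case using insert.hyps by simp
qed simp

lemma ln_power_int: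
  assumes "(x::real) > 0"
  shows "ln (x powi k) = of_int k * ln x"
  using assms by (cases k rule: int_cases2) (auto simp: ln_realpow power_int_minus ln_inverse)

locale mero_fun =
  fixes f :: "complex \<Rightarrow> complex"
  assumes nicely: "f nicely_meromorphic_on UNIV" and nonzero: "f \<noteq> (\<lambda>_. 0)"
begin

lemma mero: "f meromorphic_on A"
  using nicely meromorphic_on_subset unfolding nicely_meromorphic_on_def by blast

lemma cosparse_nonzero: "eventually (\<lambda>z. f z \<noteq> 0) (cosparse UNIV)"
  using nicely_meromorphic_imp_constant_or_avoid[OF nicely open_UNIV connected_UNIV, of 0] nonzero by auto

lemma ev_nonzero: "eventually (\<lambda>z. f z \<noteq> 0) (at w)"
  using cosparse_nonzero by (simp add: eventually_cosparse_open_eq)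

lemma divisor_supp_eq: "divisor_supp f = {z. f z = 0}"
  using is_pole_zero_at_nicely_mero[OF nicely] by (auto simp: divisor_supp_def)

lemma finite_divisor: "finite (divisor_supp f \<inter> cball 0 r)"
proof -
  have "divisor_supp f sparse_in UNIV"
    using cosparse_nonzero by (simp add: eventually_cosparse divisor_supp_eq)
  hence "divisor_supp f sparse_in cball 0 r" by (rule sparse_in_subset) auto
  from sparse_in_compact_finite[OF this] show ?thesis by (simp add: Int_commute)
qed

lemma analytic_off_divisor: "w \<notin> divisor_supp f \<Longrightarrow> f analytic_on {w}"
  using nicely_meromorphic_on_imp_analytic_at[OF nicely] by (auto simp: divisor_supp_def)

lemma zorder_eq_0_iff_not_divisor: "zorder f w = 0 \<longleftrightarrow> w \<notin> divisor_supp f"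
proof (cases "is_pole f w")
  case True
  thus ?thesis
    using isolated_pole_imp_neg_zorder[of f w] mero[of "{w}"]
    by (auto simp: meromorphic_at_iff divisor_supp_def)
next
  case False
  hence "f analytic_on {w}" using nicely_meromorphic_on_imp_analytic_at[OF nicely] by auto
  thus ?thesis
    using zorder_eq_0_iff[of f w] eventually_frequently[OF at_neq_bot ev_nonzero] False
    by (auto simp: divisor_supp_def)
qed

lemma zorder_neg_iff_pole: "zorder f w < 0 \<longleftrightarrow> is_pole f w"
  using isolated_pole_imp_neg_zorder[of f w] mero[of "{w}"] zorder_neg_imp_is_pole[OF _ ev_nonzero, of w]
  by (auto simp: meromorphic_at_iff)

definition divisor_disc :: "real \<Rightarrow> complex set" where
  "divisor_disc r = divisor_supp f \<inter> cball 0 r - {0}"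

lemma finite_divisor_disc: "finite (divisor_disc r)"
  unfolding divisor_disc_def using finite_divisor by auto

text \<open>
  The function \<open>h\<close> is \<open>f\<close> with its divisor in the closed disc of radius \<open>r\<close> divided out.  The larger radius
  \<open>R\<close> gives room for holomorphy on a neighbourhood of the closed disc.
\<close>

definition zero_free_part :: "real \<Rightarrow> real \<Rightarrow> (complex \<Rightarrow> complex) \<Rightarrow> bool" where
  "zero_free_part r R h \<longleftrightarrow> R > r \<and> h holomorphic_on ball 0 R \<and> (\<forall>z\<in>ball 0 R. h z \<noteq> 0) \<and>
     divisor_supp f \<inter> ball 0 R = divisor_supp f \<inter> cball 0 r \<and>
     (\<forall>z\<in>ball 0 R. f z = z powi zorder f 0 * h z * (\<Prod>\<rho>\<in>divisor_disc r. (1 - z / \<rho>) powi zorder f \<rho>))"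

text \<open>
  The quotient of \<open>f\<close> by the finite product has order 0 at every point of a slightly larger disc, so after
  removing singularities it is holomorphic and without zeros there.
\<close>

lemma zero_free_part_exists:
  assumes r: "r > 0"
  obtains R h where "zero_free_part r R h"
proof -
  define X where "X = divisor_supp f \<inter> cball 0 r"
  have finX: "finite X" unfolding X_def by (rule finite_divisor)
  define g where "g z = (\<Prod>\<rho>\<in>insert 0 X. root_factor \<rho> z powi zorder f \<rho>)" for z
  have g_eq: "g z = z powi zorder f 0 * (\<Prod>\<rho>\<in>X - {0}. (1 - z / \<rho>) powi zorder f \<rho>)" for z
  proof -
    have "g z = root_factor 0 z powi zorder f 0 * (\<Prod>\<rho>\<in>X - {0}. root_factor \<rho> z powi zorder f \<rho>)"
      unfolding g_def using finX by (simp add: prod.insert_remove)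
    also have "(\<Prod>\<rho>\<in>X - {0}. root_factor \<rho> z powi zorder f \<rho>) = (\<Prod>\<rho>\<in>X - {0}. (1 - z / \<rho>) powi zorder f \<rho>)"
      by (rule prod.cong) (auto simp: root_factor_def)
    finally show ?thesis by (simp add: root_factor_def)
  qed
  have mero_factor: "(\<lambda>z. root_factor \<rho> z powi k) meromorphic_on A" for \<rho> k A
    by (intro meromorphic_on_powi analytic_on_imp_meromorphic_on root_factor_analytic)
  have mero_g: "g meromorphic_on A" for A
    unfolding g_def by (intro meromorphic_on_prod mero_factor)
  have ev_factor: "eventually (\<lambda>z. root_factor \<rho> z powi k \<noteq> 0) (at w)" for \<rho> k w
    using eventually_root_factor_nonzero[of \<rho> w] by eventually_elim simp
  have ev_g: "eventually (\<lambda>z. g z \<noteq> 0) (at w)" for w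
    unfolding g_def using finX by (intro eventually_prod_nonzero ev_factor) auto
  have zorder_g: "zorder g w = (if w \<in> insert 0 X then zorder f w else 0)" for w
  proof -
    have "zorder g w = (\<Sum>\<rho>\<in>insert 0 X. zorder (\<lambda>z. root_factor \<rho> z powi zorder f \<rho>) w)"
      unfolding g_def
      by (rule zorder_prod[OF mero_factor]) (use ev_g[of w, unfolded g_def] in auto)
    also have "\<dots> = (\<Sum>\<rho>\<in>insert 0 X. if w = \<rho> then zorder f \<rho> else 0)"
    proof (rule sum.cong[OF refl])
      fix \<rho>
      have "zorder (\<lambda>z. root_factor \<rho> z powi zorder f \<rho>) w = zorder f \<rho> * zorder (root_factor \<rho>) w"
        by (rule zorder_power_int[OF analytic_on_imp_meromorphic_on[OF root_factor_analytic]
              eventually_frequently[OF at_neq_bot eventually_root_factor_nonzero]])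
      thus "zorder (\<lambda>z. root_factor \<rho> z powi zorder f \<rho>) w = (if w = \<rho> then zorder f \<rho> else 0)"
        by (simp add: zorder_root_factor)
    qed
    also have "\<dots> = (if w \<in> insert 0 X then zorder f w else 0)"
      using finX by (subst sum.delta') auto
    finally show ?thesis .
  qed
  (* \<open>R\<close> is at most the modulus of every point of the divisor outside the closed disc. *)
  obtain R where R: "R > r" "divisor_supp f \<inter> ball 0 R = X"
  proof -
    define Y where "Y = norm ` (divisor_supp f \<inter> cball 0 (r + 1) - X)"
    have finY: "finite (insert (r + 1) Y)" unfolding Y_def using finite_divisor by auto
    define R where "R = Min (insert (r + 1) Y)"
    have "\<forall>y\<in>insert (r + 1) Y. r < y" by (auto simp: Y_def X_def)
    hence "R > r" using finY unfolding R_def by (subst Min_gr_iff) auto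
    moreover have "divisor_supp f \<inter> ball 0 R = X"
    proof (intro equalityI subsetI)
      fix z assume z: "z \<in> divisor_supp f \<inter> ball 0 R"
      show "z \<in> X"
      proof (rule ccontr)
        assume "z \<notin> X"
        moreover have "R \<le> r + 1" unfolding R_def using finY by (intro Min_le) auto
        ultimately have "norm z \<in> Y" using z by (auto simp: Y_def)
        hence "R \<le> norm z" unfolding R_def using finY by (intro Min_le) auto
        thus False using z by auto
      qed
    next
      fix z assume "z \<in> X"
      thus "z \<in> divisor_supp f \<inter> ball 0 R" using \<open>R > r\<close> by (auto simp: X_def)
    qed
    ultimately show ?thesis using that by blast
  qed
  define h where "h = remove_sings (\<lambda>z. f z / g z)"
  have mero_q: "(\<lambda>z. f z / g z) meromorphic_on A" for A
    by (intro meromorphic_on_divide mero mero_g)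
  have nice_h: "h nicely_meromorphic_on UNIV"
    unfolding h_def by (rule remove_sings_nicely_meromorphic[OF mero_q])
  have ev_q: "eventually (\<lambda>z. f z / g z \<noteq> 0) (at w)" for w
    using ev_nonzero[of w] ev_g[of w] by eventually_elim simp
  have ev_eq: "eventually (\<lambda>z. h z = f z / g z) (at w)" for w
    unfolding h_def by (rule eventually_remove_sings_eq_at) (use mero_q[of "{w}"] in \<open>simp add: meromorphic_at_iff\<close>)
  have ev_h: "eventually (\<lambda>z. h z \<noteq> 0) (at w)" for w
    using ev_q[of w] ev_eq[of w] by eventually_elim simp
  have zorder_h: "zorder h w = 0" if "w \<in> ball 0 R" for w
  proof -
    have "zorder h w = zorder (\<lambda>z. f z / g z) w"
      by (rule zorder_cong[OF ev_eq refl])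
    also have "\<dots> = zorder f w - zorder g w"
      using ev_nonzero ev_g by (intro zorder_divide mero mero_g eventually_frequently) auto
    also have "\<dots> = 0"
    proof (cases "w \<in> insert 0 X")
      case True
      thus ?thesis unfolding zorder_g by simp
    next
      case False
      hence "w \<notin> divisor_supp f" using R that by auto
      thus ?thesis using False zorder_eq_0_iff_not_divisor[of w] by (simp add: zorder_g)
    qed
    finally show ?thesis .
  qed
  have an_h: "h analytic_on {w} \<and> h w \<noteq> 0" if w: "w \<in> ball 0 R" for w
  proof -
    have mh: "h meromorphic_on {w}"
      using nice_h meromorphic_on_subset unfolding nicely_meromorphic_on_def by blast
    have "\<not> is_pole h w"
      using isolated_pole_imp_neg_zorder[of h w] mh zorder_h[OF w] by (auto simp: meromorphic_at_iff)
    hence "h analytic_on {w}" using nicely_meromorphic_on_imp_analytic_at[OF nice_h] by auto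
    moreover have "h w \<noteq> 0"
      using zorder_eq_0_iff[OF calculation eventually_frequently[OF at_neq_bot ev_h]] zorder_h[OF w] by simp
    ultimately show ?thesis by blast
  qed
  have hol_h: "h holomorphic_on ball 0 R"
    using an_h analytic_on_analytic_at analytic_imp_holomorphic by blast
  have f_eq: "f z = g z * h z" if z: "z \<in> ball 0 R" for z
  proof (cases "z \<in> X")
    case True
    hence "f z = 0" by (auto simp: X_def divisor_supp_eq)
    moreover have "zorder f z \<noteq> 0" using True zorder_eq_0_iff_not_divisor by (auto simp: X_def)
    hence "root_factor z z powi zorder f z = 0" by (simp add: power_int_0_left_if)
    hence "g z = 0" unfolding g_def using finX True by (subst prod_zero_iff) (auto intro: bexI[of _ z])
    ultimately show ?thesis by simp
  next
    case False
    hence zS: "z \<notin> divisor_supp f" using R z by auto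
    have gz: "g z \<noteq> 0"
    proof -
      have "root_factor \<rho> z powi zorder f \<rho> \<noteq> 0" if "\<rho> \<in> insert 0 X" for \<rho>
      proof (cases "\<rho> = z")
        case True
        hence "zorder f \<rho> = 0" using zS zorder_eq_0_iff_not_divisor by auto
        thus ?thesis by simp
      qed auto
      thus ?thesis unfolding g_def using finX by (subst prod_zero_iff) auto
    qed
    have "(\<lambda>z. root_factor \<rho> z powi zorder f \<rho>) analytic_on {z}" for \<rho>
    proof (cases "\<rho> = z")
      case True
      hence "zorder f \<rho> = 0" using zS zorder_eq_0_iff_not_divisor by auto
      thus ?thesis by simp
    qed (auto intro!: analytic_on_power_int root_factor_analytic)
    hence "g analytic_on {z}" unfolding g_def by (intro analytic_on_prod) auto
    hence "(\<lambda>z. f z / g z) analytic_on {z}"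
      using analytic_off_divisor[OF zS] gz by (intro analytic_on_divide) auto
    hence "h z = f z / g z" unfolding h_def by (rule remove_sings_at_analytic)
    thus ?thesis using gz by simp
  qed
  have "f z = z powi zorder f 0 * h z * (\<Prod>\<rho>\<in>divisor_disc r. (1 - z / \<rho>) powi zorder f \<rho>)"
    if "z \<in> ball 0 R" for z
    using f_eq[OF that] unfolding g_eq X_def divisor_disc_def by (simp add: mult_ac)
  hence "zero_free_part r R h"
    using R hol_h an_h unfolding zero_free_part_def X_def by blast
  thus ?thesis by (rule that)
qed

text \<open>
  The first nonzero Laurent coefficient of \<open>f\<close> at 0.  It is the value at 0 of every zero-free part,
  whatever the radius, and thus normalizes them all alike.
\<close>

definition leading_coeff0 :: complex where
  "leading_coeff0 = Lim (at 0) (\<lambda>z. f z / z powi zorder f 0)"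

lemma zero_free_part_at_0:
  assumes r: "r > 0" and h: "zero_free_part r R h"
  shows "h 0 = leading_coeff0"
proof -
  let ?P = "\<lambda>z. h z * (\<Prod>\<rho>\<in>divisor_disc r. (1 - z / \<rho>) powi zorder f \<rho>)"
  have R: "R > 0" using r h by (auto simp: zero_free_part_def)
  have "h analytic_on {0}"
    using h R analytic_at[of h 0] by (auto simp: zero_free_part_def analytic_on_holomorphic intro!: exI[of _ "ball 0 R"])
  hence "isCont h 0" by (rule analytic_at_imp_isCont)
  hence "?P \<midarrow>0\<rightarrow> h 0 * (\<Prod>\<rho>\<in>divisor_disc r. (1 - 0 / \<rho>) powi zorder f \<rho>)"
    by (intro tendsto_intros isContD) (auto simp: divisor_disc_def)
  hence "?P \<midarrow>0\<rightarrow> h 0" by simp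
  moreover have "eventually (\<lambda>z. f z / z powi zorder f 0 = ?P z) (at 0)"
  proof -
    have "eventually (\<lambda>z. z \<in> ball 0 R) (at (0::complex))"
      using R by (intro eventually_at_in_open') auto
    moreover have "eventually (\<lambda>z::complex. z \<noteq> 0) (at 0)" by (simp add: eventually_neq_at_within)
    ultimately show ?thesis
      by eventually_elim (use h in \<open>simp add: zero_free_part_def\<close>)
  qed
  ultimately have "((\<lambda>z. f z / z powi zorder f 0) \<longlongrightarrow> h 0) (at 0)"
    using tendsto_cong by fast
  thus ?thesis unfolding leading_coeff0_def by (intro tendsto_Lim[symmetric]) auto
qed

lemma leading_coeff0_nonzero: "leading_coeff0 \<noteq> 0"
proof -
  obtain R h where h: "zero_free_part 1 R h" using zero_free_part_exists[of 1] by auto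
  thus ?thesis using zero_free_part_at_0[OF _ h] by (auto simp: zero_free_part_def)
qed

lemma logderiv_eq_zero_free_part:
  assumes h: "zero_free_part r R h" and z: "z \<in> ball 0 R" "z \<notin> divisor_supp f" "z \<noteq> 0"
  shows "deriv f z / f z = of_int (zorder f 0) / z + deriv h z / h z +
           (\<Sum>\<rho>\<in>divisor_disc r. of_int (zorder f \<rho>) / (z - \<rho>))"
proof -
  let ?D = "divisor_disc r" and ?P = "\<lambda>z. \<Prod>\<rho>\<in>divisor_disc r. (1 - z / \<rho>) powi zorder f \<rho>"
  let ?s = "\<Sum>\<rho>\<in>?D. of_int (zorder f \<rho>) * (1 / (z - \<rho>))"
  have holh: "h holomorphic_on ball 0 R" and hz: "h z \<noteq> 0" using h z by (auto simp: zero_free_part_def)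
  have nz: "z \<noteq> \<rho>" "\<rho> \<noteq> 0" if "\<rho> \<in> ?D" for \<rho> using that z by (auto simp: divisor_disc_def)
  have P: "(?P has_field_derivative ?P z * ?s) (at z)"
  proof (rule has_field_derivative_prod_power_int)
    fix \<rho> assume "\<rho> \<in> ?D"
    from nz[OF this] show "((\<lambda>z. 1 - z / \<rho>) has_field_derivative (1 - z / \<rho>) * (1 / (z - \<rho>))) (at z)"
      by (auto intro!: derivative_eq_intros simp: divide_simps)
    from nz[OF \<open>\<rho> \<in> ?D\<close>] show "1 - z / \<rho> \<noteq> 0" by auto
  qed (rule finite_divisor_disc)
  have Pz: "?P z \<noteq> 0" using nz by (auto simp: prod_zero_iff finite_divisor_disc power_int_eq_0_iff)
  have H: "(h has_field_derivative deriv h z) (at z)"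
    using holomorphic_derivI[OF holh open_ball z(1)] .
  have Z: "((\<lambda>z. z powi zorder f 0) has_field_derivative z powi zorder f 0 * (of_int (zorder f 0) / z)) (at z)"
    using z(3) by (auto intro!: derivative_eq_intros simp: power_int_diff)
  have "((\<lambda>z. z powi zorder f 0 * h z * ?P z) has_field_derivative
      z powi zorder f 0 * h z * ?P z * (of_int (zorder f 0) / z + deriv h z / h z + ?s)) (at z)"
    by (rule derivative_eq_intros Z H P refl)+ (use hz in \<open>simp add: field_simps\<close>)
  moreover have "eventually (\<lambda>w. w \<in> ball 0 R) (nhds z)" using z by (intro eventually_nhds_in_open) auto
  hence "eventually (\<lambda>w. w powi zorder f 0 * h w * ?P w = f w) (nhds z)"
    by eventually_elim (use h in \<open>simp add: zero_free_part_def\<close>)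
  moreover have fz: "f z = z powi zorder f 0 * h z * ?P z" using h z by (simp add: zero_free_part_def)
  ultimately have "(f has_field_derivative f z * (of_int (zorder f 0) / z + deriv h z / h z + ?s)) (at z)"
    using DERIV_cong_ev[OF refl] by force
  hence "deriv f z = f z * (of_int (zorder f 0) / z + deriv h z / h z + ?s)" by (rule DERIV_imp_deriv)
  moreover have "f z \<noteq> 0" using z(2) by (simp add: divisor_supp_eq)
  ultimately show ?thesis by simp
qed

text \<open>
  Replacing each \<open>1 - z / \<rho>\<close> by \<open>(r - cnj \<rho> z / r) / \<rho>\<close>, which has the same absolute value on the circle
  \<open>\<bar>z\<bar> = r\<close> but vanishes only outside it, turns \<open>f\<close> into a function that has a holomorphic logarithm \<open>g\<close>
  past the circle.  So \<open>ln \<bar>f\<bar>\<close> on the circle is the real part of a holomorphic function; its value at 0 is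
  the right hand side of Jensen's formula, and its derivative differs from \<open>h' / h\<close> only by poles
  at the reflected points \<open>r\<^sup>2 / cnj \<rho>\<close>.
\<close>

lemma blaschke_log:
  assumes r: "r > 0" and sph: "divisor_supp f \<inter> sphere 0 r = {}" and h: "zero_free_part r R h"
  obtains R' g where "R' > r" "g holomorphic_on ball 0 R'"
    "\<And>z. norm z = r \<Longrightarrow> Re (g z) = ln (norm (f z))"
    "Re (g 0) = ln (norm leading_coeff0) + real_of_int (zorder f 0) * ln r +
        (\<Sum>\<rho>\<in>divisor_disc r. real_of_int (zorder f \<rho>) * ln (r / norm \<rho>))"
    "\<And>z. z \<in> ball 0 r \<Longrightarrow> deriv h z / h z = deriv g z +
        (\<Sum>\<rho>\<in>divisor_disc r. of_int (zorder f \<rho>) * (cnj \<rho> / (of_real r ^ 2 - cnj \<rho> * z)))"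
proof -
  let ?D = "divisor_disc r"
  (* The first zero of the reflected factors lies at modulus \<open>r\<^sup>2 / \<bar>\<rho>\<bar> > r\<close>. *)
  define R' where "R' = Min (insert R ((\<lambda>\<rho>. r\<^sup>2 / norm \<rho>) ` ?D))"
  have fin: "finite (insert R ((\<lambda>\<rho>. r\<^sup>2 / norm \<rho>) ` ?D))" using finite_divisor_disc by auto
  have D: "\<rho> \<noteq> 0 \<and> norm \<rho> < r" if "\<rho> \<in> ?D" for \<rho>
    using that sph by (force simp: divisor_disc_def)
  have R': "R' > r"
    unfolding R'_def using fin h D r
    by (subst Min_gr_iff) (auto simp: zero_free_part_def field_simps power2_eq_square)
  have R'R: "R' \<le> R" unfolding R'_def using fin by (intro Min_le) auto
  have R'D: "R' \<le> r\<^sup>2 / norm \<rho>" if "\<rho> \<in> ?D" for \<rho>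
    unfolding R'_def using fin that by (intro Min_le) auto
  define b where "b \<rho> z = (of_real r - cnj \<rho> * z / of_real r) / \<rho>" for \<rho> z
  define Bl where "Bl z = h z * of_real r powi zorder f 0 * (\<Prod>\<rho>\<in>?D. b \<rho> z powi zorder f \<rho>)" for z
  have ne: "of_real r ^ 2 - cnj \<rho> * z \<noteq> 0" if "\<rho> \<in> ?D" "norm z < R'" for \<rho> z
  proof
    assume "of_real r ^ 2 - cnj \<rho> * z = 0"
    hence "norm (cnj \<rho> * z) = norm (complex_of_real r ^ 2)" by simp
    hence "norm \<rho> * norm z = r\<^sup>2" by (simp add: norm_mult norm_power)
    moreover have "norm z < r\<^sup>2 / norm \<rho>" using R'D[OF that(1)] that(2) by simp
    ultimately show False using D[OF that(1)] by (simp add: field_simps)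
  qed
  have b_ne: "b \<rho> z \<noteq> 0" if "\<rho> \<in> ?D" "norm z < R'" for \<rho> z
    using ne[OF that] D[OF that(1)] r by (auto simp: b_def field_simps power2_eq_square)
  have hR: "h z \<noteq> 0" if "norm z < R'" for z using h that R'R by (auto simp: zero_free_part_def)
  have Bl_ne: "Bl z \<noteq> 0" if "norm z < R'" for z
    unfolding Bl_def using hR[OF that] b_ne[OF _ that] r
    by (auto simp: prod_zero_iff finite_divisor_disc power_int_eq_0_iff)
  have holh: "h holomorphic_on ball 0 R'"
    using h R'R by (auto simp: zero_free_part_def intro: holomorphic_on_subset)
  have "b \<rho> holomorphic_on ball 0 R'" for \<rho>
    unfolding b_def divide_inverse by (intro holomorphic_intros)
  hence "Bl holomorphic_on ball 0 R'"
    unfolding Bl_def using b_ne by (intro holomorphic_intros holh holomorphic_on_power_int) auto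
  moreover have "contractible (ball (0::complex) R')" by (simp add: convex_imp_contractible)
  ultimately obtain g where g: "g holomorphic_on ball 0 R'" "\<And>z. z \<in> ball 0 R' \<Longrightarrow> Bl z = exp (g z)"
    using Bl_ne by (rule contractible_imp_holomorphic_log) auto
  have Re_g: "Re (g z) = ln (norm (Bl z))" if "norm z < R'" for z
    using g(2)[of z] that by simp
  have norm_h: "norm (Bl z) = norm (f z)" if z: "norm z = r" for z
  proof -
    have "norm (b \<rho> z) = norm (1 - z / \<rho>)" if "\<rho> \<in> ?D" for \<rho>
    proof -
      have "z * cnj z = of_real r ^ 2" using z by (simp add: complex_norm_square[symmetric])
      hence "of_real r - cnj \<rho> * z / of_real r = (z / of_real r) * cnj (z - \<rho>)"
        using r by (simp add: field_simps power2_eq_square)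
      hence "norm (b \<rho> z) = norm (z - \<rho>) / norm \<rho>"
        unfolding b_def norm_divide using z r by (simp add: norm_mult norm_divide flip: complex_cnj_diff)
      also have "\<dots> = norm (1 - z / \<rho>)"
        using D[OF that] by (simp add: norm_minus_commute diff_divide_distrib flip: norm_divide)
      finally show ?thesis .
    qed
    moreover have "z \<in> ball 0 R" using z h by (auto simp: zero_free_part_def)
    ultimately show ?thesis
      using h z r by (simp add: zero_free_part_def Bl_def norm_mult norm_power_int prod_norm[symmetric])
  qed
  show ?thesis
  proof (rule that[OF R' g(1)])
    show "Re (g z) = ln (norm (f z))" if "norm z = r" for z
      using Re_g[of z] norm_h[OF that] R' that by simp
    have "ln (norm (Bl 0)) = ln (norm leading_coeff0 * r powi zorder f 0 * (\<Prod>\<rho>\<in>?D. (r / norm \<rho>) powi zorder f \<rho>))"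
      using zero_free_part_at_0[OF r h] r
      by (simp add: Bl_def b_def norm_mult norm_power_int norm_divide prod_norm[symmetric])
    also have "\<dots> = ln (norm leading_coeff0) + real_of_int (zorder f 0) * ln r +
        ln (\<Prod>\<rho>\<in>?D. (r / norm \<rho>) powi zorder f \<rho>)"
      using leading_coeff0_nonzero r D
      by (subst ln_mult_pos) (auto simp: ln_mult_pos ln_power_int intro!: prod_pos zero_less_power_int)
    also have "ln (\<Prod>\<rho>\<in>?D. (r / norm \<rho>) powi zorder f \<rho>) =
        (\<Sum>\<rho>\<in>?D. real_of_int (zorder f \<rho>) * ln (r / norm \<rho>))"
      using r D by (subst ln_prod) (auto simp: ln_power_int finite_divisor_disc intro!: zero_less_power_int)
    finally show "Re (g 0) = ln (norm leading_coeff0) + real_of_int (zorder f 0) * ln r +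
        (\<Sum>\<rho>\<in>divisor_disc r. real_of_int (zorder f \<rho>) * ln (r / norm \<rho>))"
      using Re_g[of 0] R' r by simp
  next
    fix z assume "z \<in> ball (0::complex) r"
    hence z: "norm z < R'" using R' by simp
    let ?L = "\<lambda>\<rho>. - (cnj \<rho> / (of_real r ^ 2 - cnj \<rho> * z))"
    have P: "((\<lambda>z. \<Prod>\<rho>\<in>?D. b \<rho> z powi zorder f \<rho>) has_field_derivative
       (\<Prod>\<rho>\<in>?D. b \<rho> z powi zorder f \<rho>) * (\<Sum>\<rho>\<in>?D. of_int (zorder f \<rho>) * ?L \<rho>)) (at z)"
    proof (rule has_field_derivative_prod_power_int[OF finite_divisor_disc])
      fix \<rho> assume \<rho>: "\<rho> \<in> ?D"
      have "(b \<rho> has_field_derivative - (cnj \<rho> / (\<rho> * of_real r))) (at z)"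
        unfolding b_def[abs_def] using D[OF \<rho>] r by (auto intro!: derivative_eq_intros)
      moreover have "- (cnj \<rho> / (\<rho> * of_real r)) = b \<rho> z * ?L \<rho>"
      proof -
        have "b \<rho> z = (of_real r ^ 2 - cnj \<rho> * z) / (\<rho> * of_real r)"
          using D[OF \<rho>] r by (simp add: b_def field_simps power2_eq_square)
        thus ?thesis using ne[OF \<rho> z] by simp
      qed
      ultimately show "(b \<rho> has_field_derivative b \<rho> z * ?L \<rho>) (at z)" by simp
    qed (use b_ne z in auto)
    have H: "(h has_field_derivative deriv h z) (at z)"
      using holomorphic_derivI[OF holh open_ball, of z] z by simp
    have "(Bl has_field_derivative Bl z * (deriv h z / h z + (\<Sum>\<rho>\<in>?D. of_int (zorder f \<rho>) * ?L \<rho>))) (at z)"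
      unfolding Bl_def[abs_def]
      by (rule derivative_eq_intros H P refl)+ (use hR[OF z] in \<open>simp add: field_simps\<close>)
    moreover have "(Bl has_field_derivative Bl z * deriv g z) (at z)"
    proof -
      have "((\<lambda>z. exp (g z)) has_field_derivative exp (g z) * deriv g z) (at z)"
        by (rule DERIV_fun_exp[OF holomorphic_derivI[OF g(1) open_ball, of z]]) (use z in simp)
      moreover have "eventually (\<lambda>w. w \<in> ball 0 R') (nhds z)" using z by (intro eventually_nhds_in_open) auto
      hence "eventually (\<lambda>w. exp (g w) = Bl w) (nhds z)" by eventually_elim (use g(2) in simp)
      ultimately show ?thesis using DERIV_cong_ev[OF refl] g(2)[of z] z by force
    qed
    ultimately have "Bl z * (deriv h z / h z + (\<Sum>\<rho>\<in>?D. of_int (zorder f \<rho>) * ?L \<rho>)) = Bl z * deriv g z"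
      by (rule DERIV_unique)
    hence "deriv h z / h z + (\<Sum>\<rho>\<in>?D. of_int (zorder f \<rho>) * ?L \<rho>) = deriv g z"
      using Bl_ne[OF z] by simp
    thus "deriv h z / h z = deriv g z + (\<Sum>\<rho>\<in>?D. of_int (zorder f \<rho>) * (cnj \<rho> / (of_real r ^ 2 - cnj \<rho> * z)))"
      by (simp add: sum_negf diff_eq_eq)
  qed
qed

end

section \<open>Jensen's formula and growth of the divisor\<close>

context mero_fun begin

definition circle_log_plus :: "real \<Rightarrow> real" where
  "circle_log_plus r = integral {0..2*pi} (\<lambda>\<theta>. ln (max 1 (norm (f (of_real r * cis \<theta>)))))"

definition circle_log_abs :: "real \<Rightarrow> real" where
  "circle_log_abs r = integral {0..2*pi} (\<lambda>\<theta>. \<bar>ln (norm (f (of_real r * cis \<theta>)))\<bar>)"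

definition pole_log_sum :: "real \<Rightarrow> real" where
  "pole_log_sum r = (\<Sum>\<rho> | \<rho> \<in> divisor_disc r \<and> is_pole f \<rho>. - real_of_int (zorder f \<rho>) * ln (r / norm \<rho>))"

lemma continuous_circle:
  assumes "r > 0" "divisor_supp f \<inter> sphere 0 r = {}"
  shows "continuous_on A (\<lambda>\<theta>. norm (f (of_real r * cis \<theta>)))" "f (of_real r * cis \<theta>) \<noteq> 0"
proof -
  have "f analytic_on sphere 0 r"
    using analytic_off_divisor assms(2) by (subst analytic_on_analytic_at) blast
  hence "continuous_on (sphere 0 r) f" by (rule analytic_imp_holomorphic[THEN holomorphic_on_imp_continuous_on])
  thus "continuous_on A (\<lambda>\<theta>. norm (f (of_real r * cis \<theta>)))"
    using assms(1) by (intro continuous_intros continuous_on_circle) auto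
  have "of_real r * cis \<theta> \<in> sphere 0 r" using assms(1) by (simp add: norm_mult)
  thus "f (of_real r * cis \<theta>) \<noteq> 0" using assms(2) by (auto simp: divisor_supp_eq)
qed

lemma continuous_circle_log:
  assumes "r > 0" "divisor_supp f \<inter> sphere 0 r = {}"
  shows "continuous_on A (\<lambda>\<theta>. ln (norm (f (of_real r * cis \<theta>))))"
    "continuous_on A (\<lambda>\<theta>. ln (max 1 (norm (f (of_real r * cis \<theta>)))))"
  using continuous_circle(2)[OF assms]
  by (intro continuous_on_ln continuous_on_max continuous_on_const continuous_circle(1)[OF assms]; force)+

lemma circle_log_plus_nonneg: "r > 0 \<Longrightarrow> divisor_supp f \<inter> sphere 0 r = {} \<Longrightarrow> circle_log_plus r \<ge> 0"
  unfolding circle_log_plus_def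
  by (intro integral_nonneg integrable_continuous_real continuous_circle_log) auto

lemma circle_log_abs_nonneg: "r > 0 \<Longrightarrow> divisor_supp f \<inter> sphere 0 r = {} \<Longrightarrow> circle_log_abs r \<ge> 0"
  unfolding circle_log_abs_def
  by (intro integral_nonneg integrable_continuous_real continuous_intros continuous_circle_log) auto

lemma pole_log_sum_nonneg: "r > 0 \<Longrightarrow> pole_log_sum r \<ge> 0"
  unfolding pole_log_sum_def
proof (rule sum_nonneg)
  fix \<rho> assume r: "r > 0" and \<rho>: "\<rho> \<in> {\<rho> \<in> divisor_disc r. is_pole f \<rho>}"
  have "ln (r / norm \<rho>) \<ge> 0" using \<rho> r by (intro ln_ge_zero) (auto simp: divisor_disc_def field_simps)
  moreover have "zorder f \<rho> < 0" using \<rho> zorder_neg_iff_pole by auto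
  ultimately show "0 \<le> - real_of_int (zorder f \<rho>) * ln (r / norm \<rho>)" by (intro mult_nonneg_nonneg) auto
qed

text \<open>
  Jensen's formula, namely the mean value property of \<open>Re g\<close> for the logarithm \<open>g\<close> above, with the signs
  rearranged by \<open>\<bar>ln x\<bar> = 2 ln (max 1 x) - ln x\<close> and \<open>\<bar>n\<bar> = n + 2 max 0 (- n)\<close>.  The two
  quantities to be estimated are on the left; on the right, apart from the behaviour of \<open>f\<close> at 0, only
  \<open>ln (max 1 \<bar>f\<bar>)\<close> and the poles occur, which the Nevanlinna characteristic controls.
\<close>

lemma jensen_estimate:
  assumes r: "r > 0" and sph: "divisor_supp f \<inter> sphere 0 r = {}"
  shows "circle_log_abs r + 2 * pi * (\<Sum>\<rho>\<in>divisor_disc r. \<bar>real_of_int (zorder f \<rho>)\<bar> * ln (r / norm \<rho>)) =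
     2 * circle_log_plus r + 4 * pi * pole_log_sum r
     - 2 * pi * (ln (norm leading_coeff0) + real_of_int (zorder f 0) * ln r)"
proof -
  obtain R h where h: "zero_free_part r R h" using zero_free_part_exists[OF r] .
  obtain R' g where R': "R' > r" and g: "g holomorphic_on ball 0 R'"
    "\<And>z. norm z = r \<Longrightarrow> Re (g z) = ln (norm (f z))"
    "Re (g 0) = ln (norm leading_coeff0) + real_of_int (zorder f 0) * ln r +
        (\<Sum>\<rho>\<in>divisor_disc r. real_of_int (zorder f \<rho>) * ln (r / norm \<rho>))"
    by (rule blaschke_log[OF r sph h]) (rule that)
  have I: "((\<lambda>\<theta>. ln (norm (f (of_real r * cis \<theta>)))) has_integral 2 * pi * Re (g 0)) {0..2*pi}"
    using circle_mean_Re[OF g(1) r R'] g(2) r by (simp add: norm_mult)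
  have P: "((\<lambda>\<theta>. ln (max 1 (norm (f (of_real r * cis \<theta>))))) has_integral circle_log_plus r) {0..2*pi}"
    unfolding circle_log_plus_def
    by (intro integrable_integral integrable_continuous_real continuous_circle_log r sph)
  have "((\<lambda>\<theta>. 2 * ln (max 1 (norm (f (of_real r * cis \<theta>)))) - ln (norm (f (of_real r * cis \<theta>))))
      has_integral 2 * circle_log_plus r - 2 * pi * Re (g 0)) {0..2*pi}"
    by (intro has_integral_diff has_integral_mult_right P I)
  moreover have "2 * ln (max 1 x) - ln x = \<bar>ln x\<bar>" if "x > 0" for x :: real
    using that by (cases "x \<ge> 1") (auto simp: max_def)
  ultimately have eq: "circle_log_abs r = 2 * circle_log_plus r - 2 * pi * Re (g 0)"
    unfolding circle_log_abs_def using continuous_circle(2)[OF r sph] by (intro integral_unique) simp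
  have "(\<Sum>\<rho>\<in>divisor_disc r. \<bar>real_of_int (zorder f \<rho>)\<bar> * ln (r / norm \<rho>)) =
        (\<Sum>\<rho>\<in>divisor_disc r. real_of_int (zorder f \<rho>) * ln (r / norm \<rho>)
           + 2 * (if is_pole f \<rho> then - real_of_int (zorder f \<rho>) * ln (r / norm \<rho>) else 0))"
    using zorder_neg_iff_pole by (intro sum.cong) (auto simp: abs_if algebra_simps)
  also have "\<dots> = (\<Sum>\<rho>\<in>divisor_disc r. real_of_int (zorder f \<rho>) * ln (r / norm \<rho>)) + 2 * pole_log_sum r"
    unfolding sum.distrib sum_distrib_left[symmetric] pole_log_sum_def
    by (subst sum.inter_filter) (auto simp: finite_divisor_disc)
  finally show ?thesis unfolding eq g(3) by (simp add: algebra_simps)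
qed

lemma finite_poles: "finite {\<rho>. is_pole f \<rho> \<and> norm \<rho> \<le> r}"
  by (rule finite_subset[OF _ finite_divisor[of r]]) (auto simp: divisor_supp_def)

text \<open>
  A pole \<open>\<rho>\<close> contributes to the counting function exactly for \<open>t \<ge> \<bar>\<rho>\<bar>\<close>, and the integral of \<open>1 / t\<close>
  from \<open>\<bar>\<rho>\<bar>\<close> to \<open>r\<close> is \<open>ln (r / \<bar>\<rho>\<bar>)\<close>.
\<close>

lemma nevanlinna_N_eq:
  assumes r: "r > 0"
  shows "nevanlinna_N f r = pole_log_sum r + pole_count f 0 * ln r"
proof -
  let ?D = "{\<rho>. \<rho> \<in> divisor_disc r \<and> is_pole f \<rho>}"
  have D: "norm \<rho> > 0 \<and> norm \<rho> \<le> r" if "\<rho> \<in> ?D" for \<rho> using that by (auto simp: divisor_disc_def)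
  have diff: "pole_count f t - pole_count f 0 = (\<Sum>\<rho>\<in>?D. if norm \<rho> \<le> t then - real_of_int (zorder f \<rho>) else 0)"
    if t: "0 \<le> t" "t \<le> r" for t
  proof -
    have "pole_count f t - pole_count f 0 =
       (\<Sum>\<rho>\<in>{\<rho>. is_pole f \<rho> \<and> norm \<rho> \<le> t} - {\<rho>. is_pole f \<rho> \<and> norm \<rho> \<le> 0}. real_of_int (- zorder f \<rho>))"
      unfolding pole_count_def using t by (subst sum_diff[OF finite_poles]) auto
    also have "{\<rho>. is_pole f \<rho> \<and> norm \<rho> \<le> t} - {\<rho>. is_pole f \<rho> \<and> norm \<rho> \<le> 0} = {\<rho>\<in>?D. norm \<rho> \<le> t}"
      using t by (auto simp: divisor_disc_def divisor_supp_def)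
    also have "(\<Sum>\<rho>\<in>\<dots>. real_of_int (- zorder f \<rho>)) = (\<Sum>\<rho>\<in>?D. if norm \<rho> \<le> t then - real_of_int (zorder f \<rho>) else 0)"
      by (subst sum.inter_filter) (auto simp: finite_divisor_disc intro!: sum.cong)
    finally show ?thesis .
  qed
  have one: "((\<lambda>t. if norm \<rho> \<le> t then 1 / t else 0) has_integral ln (r / norm \<rho>)) {0..r}" if "\<rho> \<in> ?D" for \<rho> :: complex
  proof -
    have "((\<lambda>t. 1 / t) has_integral ln r - ln (norm \<rho>)) {norm \<rho>..r}"
    proof (rule fundamental_theorem_of_calculus)
      fix t assume "t \<in> {norm \<rho>..r}"
      hence "norm \<rho> \<le> t" by simp
      hence "t > 0" using D[OF that] by linarith
      thus "(ln has_vector_derivative 1 / t) (at t within {norm \<rho>..r})"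
        by (auto intro!: derivative_eq_intros simp flip: has_real_derivative_iff_has_vector_derivative)
    qed (use D[OF that] in auto)
    hence "((\<lambda>t. if t \<in> {norm \<rho>..r} then 1 / t else 0) has_integral ln r - ln (norm \<rho>)) {0..r}"
      using D[OF that] by (subst has_integral_restrict) auto
    moreover have "ln r - ln (norm \<rho>) = ln (r / norm \<rho>)" using D[OF that] by (subst ln_div) auto
    ultimately show ?thesis by (elim has_integral_eq[rotated, OF has_integral_eq_rhs]) auto
  qed
  have "((\<lambda>t. \<Sum>\<rho>\<in>?D. - real_of_int (zorder f \<rho>) * (if norm \<rho> \<le> t then 1 / t else 0)) has_integral
           pole_log_sum r) {0..r}"
    unfolding pole_log_sum_def by (intro has_integral_sum has_integral_mult_right one) (auto simp: finite_divisor_disc)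
  hence "((\<lambda>t. (pole_count f t - pole_count f 0) / t) has_integral pole_log_sum r) {0..r}"
  proof (rule has_integral_eq[rotated])
    fix t assume "t \<in> {0..r}"
    thus "(\<Sum>\<rho>\<in>?D. - real_of_int (zorder f \<rho>) * (if norm \<rho> \<le> t then 1 / t else 0)) = (pole_count f t - pole_count f 0) / t"
      using diff[of t] by (auto simp: sum_divide_distrib intro!: sum.cong)
  qed
  thus ?thesis unfolding nevanlinna_N_def by (simp add: integral_unique)
qed

lemma ln_growth_imp_power_bound:
  fixes T :: "real \<Rightarrow> real"
  assumes "Limsup at_top (\<lambda>r::real. ereal (ln (T r) / ln r)) < \<infinity>"
  obtains A :: nat and r0 where "A \<ge> 1" "r0 \<ge> 1" "\<And>r. r \<ge> r0 \<Longrightarrow> T r \<le> r ^ A"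
proof -
  obtain c :: real where "Limsup at_top (\<lambda>r::real. ereal (ln (T r) / ln r)) < ereal c"
    using ereal_dense2[OF assms] by blast
  hence "eventually (\<lambda>r. ereal (ln (T r) / ln r) < ereal c) at_top" by (rule Limsup_lessD)
  then obtain r1 where r1: "\<And>r. r \<ge> r1 \<Longrightarrow> ln (T r) / ln r < c" by (auto simp: eventually_at_top_linorder)
  define A where "A = nat \<lceil>max c 1\<rceil>"
  have A: "A \<ge> 1" "c \<le> real A" unfolding A_def by linarith+
  show ?thesis
  proof (rule that[of A "max r1 2"])
    fix r assume r: "max r1 2 \<le> r"
    show "T r \<le> r ^ A"
    proof (cases "T r \<ge> 1")
      case True
      have "ln (T r) < c * ln r" using r1[of r] r by (simp add: field_simps)
      also have "\<dots> \<le> real A * ln r" using A r by (intro mult_right_mono) auto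
      also have "\<dots> = ln (r ^ A)" by (simp add: ln_realpow)
      finally show ?thesis using True r by (subst (asm) ln_less_cancel_iff) auto
    next
      case False
      moreover have "r ^ A \<ge> 1" using r by (intro one_le_power) auto
      ultimately show ?thesis by linarith
    qed
  qed (use A in auto)
qed

text \<open>
  Both notions of order, by the maximum modulus for entire functions and by the characteristic otherwise,
  bound the part of the right hand side of Jensen's formula that depends on the growth of \<open>f\<close>.
\<close>

lemma log_plus_growth:
  assumes ord: "growth_order f < \<infinity>"
  obtains A :: nat and C r0 where "A \<ge> 1" "r0 \<ge> 1" "C \<ge> 0"
    "\<And>r. r \<ge> r0 \<Longrightarrow> divisor_supp f \<inter> sphere 0 r = {} \<Longrightarrow> circle_log_plus r + pole_log_sum r \<le> C * r ^ A"
proof (cases "f holomorphic_on UNIV")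
  case True
  hence "Limsup at_top (\<lambda>R::real. ereal (ln (ln (SUP z\<in>ball 0 R. norm (f z))) / ln R)) < \<infinity>"
    using ord by (simp add: growth_order_def entire_order_def)
  then obtain A :: nat and r0 where A: "A \<ge> 1" "r0 \<ge> 1"
    "\<And>r. r \<ge> r0 \<Longrightarrow> ln (SUP z\<in>ball 0 r. norm (f z)) \<le> r ^ A"
    using ln_growth_imp_power_bound[of "\<lambda>R. ln (SUP z\<in>ball 0 R. norm (f z))"] by metis
  show ?thesis
  proof (rule that[of A r0 "2 * pi * 2 ^ A"])
    fix r assume r: "r \<ge> r0" and sph: "divisor_supp f \<inter> sphere 0 r = {}"
    have r_pos: "r > 0" using r A by linarith
    have "\<not> is_pole f \<rho>" for \<rho>
      using True analytic_on_holomorphic not_is_pole_holomorphic by blast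
    hence "pole_log_sum r = 0" by (simp add: pole_log_sum_def)
    (* The supremum over the open disc of radius \<open>r\<close> omits the circle, hence the disc of radius \<open>2 r\<close>. *)
    have bd: "ln (max 1 (norm (f z))) \<le> 2 ^ A * r ^ A" if z: "norm z = r" for z
    proof (cases "norm (f z) \<le> 1")
      case False
      have "compact (f ` cball 0 (2 * r))"
        by (intro compact_continuous_image holomorphic_on_imp_continuous_on holomorphic_on_subset[OF True]) auto
      hence "bounded (f ` ball 0 (2 * r))"
        by (rule bounded_subset[OF compact_imp_bounded]) auto
      then obtain B where "\<And>x. x \<in> f ` ball 0 (2 * r) \<Longrightarrow> norm x \<le> B" unfolding bounded_iff by blast
      hence "bdd_above ((\<lambda>z. norm (f z)) ` ball 0 (2 * r))" by (intro bdd_aboveI) auto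
      hence "norm (f z) \<le> (SUP z\<in>ball 0 (2 * r). norm (f z))" using z r_pos by (intro cSUP_upper) auto
      hence "ln (norm (f z)) \<le> ln (SUP z\<in>ball 0 (2 * r). norm (f z))"
        using False by (subst ln_le_cancel_iff) linarith+
      also have "\<dots> \<le> (2 * r) ^ A" using r r_pos by (intro A) auto
      finally show ?thesis using False by (simp add: max_def power_mult_distrib)
    qed (use r_pos in simp)
    have "circle_log_plus r \<le> integral {0..2*pi} (\<lambda>_. 2 ^ A * r ^ A)"
      unfolding circle_log_plus_def using r_pos
      by (intro integral_le integrable_continuous_real continuous_circle_log sph continuous_intros bd) (auto simp: norm_mult)
    thus "circle_log_plus r + pole_log_sum r \<le> 2 * pi * 2 ^ A * r ^ A"
      using \<open>pole_log_sum r = 0\<close> by (simp add: mult_ac)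
  qed (use A in auto)
next
  case False
  hence "Limsup at_top (\<lambda>r::real. ereal (ln (nevanlinna_T f r) / ln r)) < \<infinity>"
    using ord by (simp add: growth_order_def nevanlinna_order_def)
  then obtain A :: nat and r0 where A: "A \<ge> 1" "r0 \<ge> 1" "\<And>r. r \<ge> r0 \<Longrightarrow> nevanlinna_T f r \<le> r ^ A"
    using ln_growth_imp_power_bound by metis
  show ?thesis
  proof (rule that[of A r0 "2 * pi"])
    fix r assume r: "r \<ge> r0" and sph: "divisor_supp f \<inter> sphere 0 r = {}"
    have r_pos: "r > 0" and r1: "r \<ge> 1" using r A by linarith+
    have "pole_count f 0 * ln r \<ge> 0"
      unfolding pole_count_def using r1 zorder_neg_iff_pole
      by (intro mult_nonneg_nonneg sum_nonneg) (auto simp: less_imp_le)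
    hence "circle_log_plus r / (2 * pi) + pole_log_sum r \<le> nevanlinna_T f r"
      unfolding nevanlinna_T_def nevanlinna_N_eq[OF r_pos] nevanlinna_m_def circle_log_plus_def by simp
    also have "\<dots> \<le> r ^ A" by (rule A(3)[OF r])
    finally have "circle_log_plus r + 2 * pi * pole_log_sum r \<le> 2 * pi * r ^ A"
      by (simp add: field_simps)
    moreover have "1 * pole_log_sum r \<le> 2 * pi * pole_log_sum r"
      using pole_log_sum_nonneg[OF r_pos] pi_ge_two by (intro mult_right_mono) auto
    ultimately show "circle_log_plus r + pole_log_sum r \<le> 2 * pi * r ^ A" by simp
  qed (use A in auto)
qed

text \<open>
  Jensen's formula is used on circles that avoid the divisor, so that \<open>ln \<bar>f\<bar>\<close> is continuous on them.
\<close>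

lemma divisor_free_radius:
  assumes "a < b"
  obtains r where "a < r" "r < b" "divisor_supp f \<inter> sphere 0 r = {}"
proof -
  have "finite (norm ` (divisor_supp f \<inter> cball 0 b))" using finite_divisor by auto
  moreover have "infinite {a<..<b}" using assms by (simp add: infinite_Ioo)
  ultimately have "\<not> {a<..<b} \<subseteq> norm ` (divisor_supp f \<inter> cball 0 b)" using finite_subset by blast
  then obtain r where "r \<in> {a<..<b}" and notin: "r \<notin> norm ` (divisor_supp f \<inter> cball 0 b)" by blast
  hence r: "a < r" "r < b" by auto
  have sph: "divisor_supp f \<inter> sphere 0 r = {}"
  proof (rule ccontr)
    assume "divisor_supp f \<inter> sphere 0 r \<noteq> {}"
    then obtain z where "z \<in> divisor_supp f \<inter> sphere 0 r" by blast
    hence "z \<in> divisor_supp f" "norm z = r" by simp_all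
    hence "r \<in> norm ` (divisor_supp f \<inter> cball 0 b)" using r by (intro image_eqI[of _ _ z]) auto
    thus False using notin by blast
  qed
  show ?thesis by (rule that[OF r sph])
qed

lemma growth_estimates:
  assumes ord: "growth_order f < \<infinity>"
  obtains A :: nat and C r0 where "A \<ge> 1" "r0 \<ge> 1" "C \<ge> 0"
    "\<And>r. r \<ge> r0 \<Longrightarrow> divisor_supp f \<inter> sphere 0 r = {} \<Longrightarrow> circle_log_abs r \<le> C * r ^ A"
    "\<And>r. r \<ge> r0 \<Longrightarrow> (\<Sum>\<rho>\<in>divisor_disc r. \<bar>real_of_int (zorder f \<rho>)\<bar>) \<le> C * r ^ A"
proof -
  obtain A :: nat and C r0 where A: "A \<ge> 1" "r0 \<ge> 1" "C \<ge> 0"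
    "\<And>r. r \<ge> r0 \<Longrightarrow> divisor_supp f \<inter> sphere 0 r = {} \<Longrightarrow> circle_log_plus r + pole_log_sum r \<le> C * r ^ A"
    by (rule log_plus_growth[OF ord]) (rule that)
  define C1 where "C1 = 2 * C + \<bar>ln (norm leading_coeff0)\<bar> + \<bar>real_of_int (zorder f 0)\<bar>"
  have C1: "C1 \<ge> 0" using A by (simp add: C1_def)
  define sm where "sm r = (\<Sum>\<rho>\<in>divisor_disc r. \<bar>real_of_int (zorder f \<rho>)\<bar> * ln (r / norm \<rho>))" for r
  have terms0: "0 \<le> \<bar>real_of_int (zorder f \<rho>)\<bar> * ln (r / norm \<rho>)" if "r > 0" "\<rho> \<in> divisor_disc r" for r \<rho>
    using that by (intro mult_nonneg_nonneg ln_ge_zero) (auto simp: divisor_disc_def field_simps)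
  hence sm0: "sm r \<ge> 0" if "r > 0" for r unfolding sm_def using that by (intro sum_nonneg) auto
  have bd: "circle_log_abs r + 2 * pi * sm r \<le> 2 * pi * C1 * r ^ A" if r: "r \<ge> r0" and sph: "divisor_supp f \<inter> sphere 0 r = {}" for r
  proof -
    have r_pos: "r > 0" and r1: "r \<ge> 1" using r A by linarith+
    have rA: "1 \<le> r ^ A" "r \<le> r ^ A" using r1 A self_le_power[of r A] by auto
    have "ln r \<le> r ^ A" using rA ln_le_minus_one[OF r_pos] by linarith
    have "- (ln (norm leading_coeff0) + real_of_int (zorder f 0) * ln r)
       \<le> \<bar>ln (norm leading_coeff0)\<bar> * 1 + \<bar>real_of_int (zorder f 0)\<bar> * ln r"
      using abs_ge_minus_self[of "real_of_int (zorder f 0) * ln r"] r1 by (simp add: abs_mult)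
    also have "\<dots> \<le> \<bar>ln (norm leading_coeff0)\<bar> * r ^ A + \<bar>real_of_int (zorder f 0)\<bar> * r ^ A"
      by (intro add_mono mult_left_mono rA \<open>ln r \<le> r ^ A\<close>) auto
    finally have 1: "2 * pi * - (ln (norm leading_coeff0) + real_of_int (zorder f 0) * ln r) \<le>
       2 * pi * (\<bar>ln (norm leading_coeff0)\<bar> * r ^ A + \<bar>real_of_int (zorder f 0)\<bar> * r ^ A)"
      by (intro mult_left_mono) auto
    have "2 * 1 * circle_log_plus r \<le> 2 * pi * 2 * circle_log_plus r"
      using pi_ge_two circle_log_plus_nonneg[OF r_pos sph] by (intro mult_right_mono) auto
    hence "2 * circle_log_plus r + 4 * pi * pole_log_sum r \<le> 4 * pi * (circle_log_plus r + pole_log_sum r)"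
      by (simp add: algebra_simps)
    also have "\<dots> \<le> 4 * pi * (C * r ^ A)" using A(4)[OF r sph] by (intro mult_left_mono) auto
    finally have 2: "2 * circle_log_plus r + 4 * pi * pole_log_sum r \<le> 4 * pi * (C * r ^ A)" .
    show ?thesis
      using jensen_estimate[OF r_pos sph] 1 2 by (simp add: sm_def C1_def algebra_simps)
  qed
  define C2 where "C2 = 2 * pi * C1 * 4 ^ A"
  have C2: "2 * pi * C1 \<le> C2"
    unfolding C2_def using C1 mult_left_mono[of 1 "4 ^ A" "2 * pi * C1"] by simp
  show ?thesis
  proof (rule that[of A r0 C2])
    show "0 \<le> C2" using C1 by (simp add: C2_def)
    show "circle_log_abs r \<le> C2 * r ^ A" if r: "r \<ge> r0" and sph: "divisor_supp f \<inter> sphere 0 r = {}" for r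
    proof -
      have r_pos: "r > 0" using r A by linarith
      have "circle_log_abs r \<le> 2 * pi * C1 * r ^ A"
        using bd[OF r sph] sm0[OF r_pos] by (smt (verit) mult_nonneg_nonneg pi_ge_zero)
      also have "\<dots> \<le> C2 * r ^ A" using C2 r_pos by (intro mult_right_mono) auto
      finally show ?thesis .
    qed
    show "(\<Sum>\<rho>\<in>divisor_disc r. \<bar>real_of_int (zorder f \<rho>)\<bar>) \<le> C2 * r ^ A" if r: "r \<ge> r0" for r
    proof -
      have r_pos: "r > 0" using r A by linarith
      (* For \<open>\<bar>\<rho>\<bar> \<le> r\<close> and \<open>r' > 3 r\<close> the weight \<open>ln (r' / \<bar>\<rho>\<bar>)\<close> in Jensen's formula is at least 1,
         as \<open>exp 1 < 3\<close>; so the weighted sum for \<open>r'\<close> dominates the size of the divisor in the disc of radius \<open>r\<close>. *)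
      obtain r' where r': "3 * r < r'" "r' < 4 * r" "divisor_supp f \<inter> sphere 0 r' = {}"
        using divisor_free_radius[of "3 * r" "4 * r"] r_pos by auto
      have r'_pos: "r' > 0" using r' r_pos by linarith
      have "(\<Sum>\<rho>\<in>divisor_disc r. \<bar>real_of_int (zorder f \<rho>)\<bar>) \<le>
         (\<Sum>\<rho>\<in>divisor_disc r. \<bar>real_of_int (zorder f \<rho>)\<bar> * ln (r' / norm \<rho>))"
      proof (rule sum_mono)
        fix \<rho> assume \<rho>: "\<rho> \<in> divisor_disc r"
        have "exp 1 \<le> (3::real)" by (rule exp_le)
        also have "3 \<le> r' / norm \<rho>" using \<rho> r' by (simp add: divisor_disc_def field_simps)
        finally have "1 \<le> ln (r' / norm \<rho>)" using \<rho> r'_pos by (subst ln_ge_iff) (auto simp: divisor_disc_def)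
        thus "\<bar>real_of_int (zorder f \<rho>)\<bar> \<le> \<bar>real_of_int (zorder f \<rho>)\<bar> * ln (r' / norm \<rho>)"
          using mult_left_mono[of 1 "ln (r' / norm \<rho>)" "\<bar>real_of_int (zorder f \<rho>)\<bar>"] by simp
      qed
      also have "\<dots> \<le> sm r'"
        unfolding sm_def
        by (rule sum_mono2[OF finite_divisor_disc])
           (use r' r_pos terms0[OF r'_pos] in \<open>auto simp: divisor_disc_def\<close>)
      also have "\<dots> \<le> 2 * pi * sm r'"
        using mult_right_mono[of 1 "2 * pi" "sm r'"] sm0[OF r'_pos] pi_ge_two by simp
      also have "\<dots> \<le> 2 * pi * C1 * r' ^ A"
        using bd[OF _ r'(3)] r' r r_pos circle_log_abs_nonneg[OF r'_pos r'(3)] by linarith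
      also have "\<dots> \<le> 2 * pi * C1 * (4 * r) ^ A"
        using r' r'_pos C1 by (intro mult_left_mono power_mono) auto
      finally show ?thesis by (simp add: C2_def power_mult_distrib)
    qed
  qed (use A in auto)
qed

text \<open>
  In the dyadic annulus \<open>r0 * 2 ^ J < \<bar>\<rho>\<bar> \<le> r0 * 2 ^ (J + 1)\<close> the divisor has size of order \<open>2 ^ (J * A)\<close>,
  so with exponent \<open>A + 1\<close> it contributes of order \<open>2 ^ (- J)\<close>.
\<close>

lemma divisor_summable_of_growth:
  assumes ord: "growth_order f < \<infinity>"
  shows "\<exists>k. (\<lambda>\<rho>. real_of_int \<bar>zorder f \<rho>\<bar> / norm \<rho> ^ k) summable_on (divisor_supp f - {0})"
proof -
  obtain A :: nat and C r0 where A: "A \<ge> 1" "r0 \<ge> 1" "C \<ge> 0"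
    "\<And>r. r \<ge> r0 \<Longrightarrow> (\<Sum>\<rho>\<in>divisor_disc r. \<bar>real_of_int (zorder f \<rho>)\<bar>) \<le> C * r ^ A"
    by (rule growth_estimates[OF ord]) (rule that)
  define t where "t \<rho> = real_of_int \<bar>zorder f \<rho>\<bar> / norm \<rho> ^ (A + 1)" for \<rho>
  have t0: "t \<rho> \<ge> 0" for \<rho> by (simp add: t_def)
  (* \<open>B J\<close> bounds the sum over the disc of radius \<open>r0 * 2 ^ J\<close>; it grows by the bound for one annulus at each step. *)
  define B where "B J = (\<Sum>\<rho>\<in>divisor_disc r0. t \<rho>) + (\<Sum>j<J. C * 2 ^ A * (1/2) ^ j)" for J :: nat
  have ind: "(\<Sum>\<rho>\<in>divisor_disc (r0 * 2 ^ J). t \<rho>) \<le> B J" for J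
  proof (induction J)
    case (Suc J)
    let ?r = "r0 * 2 ^ J" and ?r' = "r0 * 2 ^ Suc J"
    have r: "?r \<ge> 1" using A by (simp add: mult_ge1_I)
    have "(1::real) \<le> 2 ^ Suc J" by (rule one_le_power) simp
    hence r': "?r' \<ge> r0" using mult_left_mono[of 1 "2 ^ Suc J" r0] A by (simp del: power_Suc)
    have sub: "divisor_disc ?r \<subseteq> divisor_disc ?r'" using r by (auto simp: divisor_disc_def)
    have "(\<Sum>\<rho>\<in>divisor_disc ?r' - divisor_disc ?r. t \<rho>) \<le>
      (\<Sum>\<rho>\<in>divisor_disc ?r' - divisor_disc ?r. \<bar>real_of_int (zorder f \<rho>)\<bar> / ?r ^ (A + 1))"
    proof (rule sum_mono)
      fix \<rho> assume "\<rho> \<in> divisor_disc ?r' - divisor_disc ?r"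
      hence "norm \<rho> > ?r" by (auto simp: divisor_disc_def)
      thus "t \<rho> \<le> \<bar>real_of_int (zorder f \<rho>)\<bar> / ?r ^ (A + 1)"
        unfolding t_def using r by (intro frac_le power_mono) auto
    qed
    also have "\<dots> \<le> (\<Sum>\<rho>\<in>divisor_disc ?r'. \<bar>real_of_int (zorder f \<rho>)\<bar> / ?r ^ (A + 1))"
      by (rule sum_mono2[OF finite_divisor_disc]) (use A in auto)
    also have "\<dots> = (\<Sum>\<rho>\<in>divisor_disc ?r'. \<bar>real_of_int (zorder f \<rho>)\<bar>) / ?r ^ (A + 1)"
      by (simp add: sum_divide_distrib)
    also have "\<dots> \<le> C * ?r' ^ A / ?r ^ (A + 1)"
      using A(4)[OF r'] r by (intro divide_right_mono) auto
    also have "\<dots> = C * 2 ^ A / ?r"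
    proof -
      have "?r' ^ A = 2 ^ A * ?r ^ A" by (simp add: power_mult_distrib mult_ac)
      moreover have "?r ^ A \<noteq> 0" using r by auto
      ultimately show ?thesis by simp
    qed
    also have "\<dots> \<le> C * 2 ^ A / 2 ^ J"
      using A by (intro divide_left_mono) auto
    also have "\<dots> = C * 2 ^ A * (1/2) ^ J" by (simp add: power_one_over field_simps)
    finally have "(\<Sum>\<rho>\<in>divisor_disc ?r' - divisor_disc ?r. t \<rho>) \<le> C * 2 ^ A * (1/2) ^ J" .
    moreover have "(\<Sum>\<rho>\<in>divisor_disc ?r'. t \<rho>) = (\<Sum>\<rho>\<in>divisor_disc ?r' - divisor_disc ?r. t \<rho>) + (\<Sum>\<rho>\<in>divisor_disc ?r. t \<rho>)"
      by (rule sum.subset_diff[OF sub finite_divisor_disc])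
    ultimately show ?case using Suc.IH by (simp add: B_def)
  qed (simp add: B_def)
  have B: "B J \<le> (\<Sum>\<rho>\<in>divisor_disc r0. t \<rho>) + C * 2 ^ A * 2" for J
  proof -
    have "(\<Sum>j<J. (1/2::real) ^ j) \<le> (\<Sum>j. (1/2) ^ j)"
      by (intro sum_le_suminf summable_geometric) auto
    also have "\<dots> = 2" by (subst suminf_geometric) auto
    finally have "C * 2 ^ A * (\<Sum>j<J. (1/2::real) ^ j) \<le> C * 2 ^ A * 2" using A by (intro mult_left_mono) auto
    thus ?thesis by (simp add: B_def sum_distrib_left)
  qed
  have "t summable_on (divisor_supp f - {0})"
  proof (rule nonneg_bdd_above_summable_on)
    show "bdd_above (sum t ` {F. F \<subseteq> divisor_supp f - {0} \<and> finite F})"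
    proof (rule bdd_aboveI2)
      fix F assume F: "F \<in> {F. F \<subseteq> divisor_supp f - {0} \<and> finite F}"
      define M where "M = Max (insert 0 (norm ` F))"
      have M: "norm \<rho> \<le> M" if "\<rho> \<in> F" for \<rho> unfolding M_def using F that by (intro Max_ge) auto
      obtain J where J: "M < 2 ^ J" using real_arch_pow[of 2 M] by auto
      also have "2 ^ J \<le> r0 * 2 ^ J" using A by simp
      finally have "M < r0 * 2 ^ J" .
      hence "norm \<rho> \<le> r0 * 2 ^ J" if "\<rho> \<in> F" for \<rho> using M[OF that] by linarith
      hence "F \<subseteq> divisor_disc (r0 * 2 ^ J)" using F by (auto simp: divisor_disc_def)
      hence "sum t F \<le> sum t (divisor_disc (r0 * 2 ^ J))"
        using t0 by (intro sum_mono2 finite_divisor_disc) auto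
      also note ind
      also note B
      finally show "sum t F \<le> (\<Sum>\<rho>\<in>divisor_disc r0. t \<rho>) + C * 2 ^ A * 2" .
    qed
  qed (use t0 in auto)
  thus ?thesis unfolding t_def by blast
qed

end

section \<open>Convergence of series, polynomials and products\<close>

lemma abs_summable_on_cofinite_comparison:
  fixes h :: "'a \<Rightarrow> 'b :: banach" and g :: "'a \<Rightarrow> real"
  assumes g: "g summable_on A" and F: "finite F" and le: "\<And>x. x \<in> A - F \<Longrightarrow> norm (h x) \<le> g x"
  shows "(\<lambda>x. norm (h x)) summable_on A"
proof -
  have "(\<lambda>x. norm (h x)) summable_on (A - F)"
    by (rule Infinite_Sum.abs_summable_on_comparison_test'[OF summable_on_cofin_subset[OF g F] le])
  hence "(\<lambda>x. norm (h x)) summable_on ((A - F) \<union> (A \<inter> F))"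
    using F by (intro summable_on_Un_disjoint) (auto intro: summable_on_finite)
  moreover have "(A - F) \<union> (A \<inter> F) = A" by blast
  ultimately show ?thesis by simp
qed

text \<open>
  Pointwise convergence of polynomials of bounded degree at infinitely many points forces convergence of the
  coefficients: dividing by \<open>z - z0\<close> lowers the degree and preserves pointwise convergence off \<open>z0\<close>.
\<close>

lemma tendsto_poly_of_tendsto_coeffs:
  fixes q :: "nat \<Rightarrow> complex poly"
  assumes deg: "\<And>j i. i \<ge> K \<Longrightarrow> coeff (q j) i = 0" and Z: "infinite Z"
    and lim: "\<And>z. z \<in> Z \<Longrightarrow> (\<lambda>j. poly (q j) z) \<longlonglongrightarrow> W z"
  obtains p where "\<And>i. i \<ge> K \<Longrightarrow> coeff p i = 0" "\<And>i. (\<lambda>j. coeff (q j) i) \<longlonglongrightarrow> coeff p i"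
proof -
  have "\<exists>p. (\<forall>i\<ge>K. coeff p i = 0) \<and> (\<forall>i. (\<lambda>j. coeff (q j) i) \<longlonglongrightarrow> coeff p i)"
    using assms
  proof (induction K arbitrary: q Z W)
    case 0
    thus ?case by (intro exI[of _ 0]) auto
  next
    case (Suc K)
    obtain z0 where z0: "z0 \<in> Z" using Suc.prems(2) by (metis ex_in_conv finite.emptyI)
    define s where "s j = synthetic_div (q j) z0" for j
    have q: "q j = pCons 0 (s j) - smult z0 (s j) + [:poly (q j) z0:]" for j
      using synthetic_div_correct'[of z0 "q j"] by (simp add: s_def)
    have cq: "coeff (q j) (Suc i) = coeff (s j) i - z0 * coeff (s j) (Suc i)" for j i
      by (subst q) simp
    have "(\<lambda>j. poly (s j) z) \<longlonglongrightarrow> (W z - W z0) / (z - z0)" if "z \<in> Z - {z0}" for z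
    proof -
      have "poly (s j) z = (poly (q j) z - poly (q j) z0) / (z - z0)" for j
      proof -
        have "poly (q j) z = (z - z0) * poly (s j) z + poly (q j) z0"
          by (subst q) (simp add: algebra_simps)
        thus ?thesis using that by simp
      qed
      thus ?thesis using that z0 by (auto intro!: tendsto_intros Suc.prems(3))
    qed
    moreover have "coeff (s j) i = 0" if "i \<ge> K" for i j
    proof (cases "s j = 0")
      case False
      have "degree (q j) \<le> K" using Suc.prems(1) by (intro degree_le) auto
      moreover have "degree (s j) = degree (q j) - 1" by (simp add: s_def degree_synthetic_div)
      moreover have "degree (q j) \<noteq> 0" using False by (auto simp: s_def synthetic_div_eq_0_iff)
      ultimately show ?thesis using that by (intro coeff_eq_0) linarith
    qed simp
    moreover have "infinite (Z - {z0})" using Suc.prems(2) by simp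
    ultimately obtain p where p: "\<forall>i\<ge>K. coeff p i = 0" "\<forall>i. (\<lambda>j. coeff (s j) i) \<longlonglongrightarrow> coeff p i"
      using Suc.IH[of s "Z - {z0}" "\<lambda>z. (W z - W z0) / (z - z0)"] by blast
    let ?p = "pCons 0 p - smult z0 p + [:W z0:]"
    have "(\<lambda>j. coeff (q j) i) \<longlonglongrightarrow> coeff ?p i" for i
    proof (cases i)
      case 0
      have "(\<lambda>j. - z0 * coeff (s j) 0 + poly (q j) z0) \<longlonglongrightarrow> - z0 * coeff p 0 + W z0"
        using p(2) z0 by (intro tendsto_intros Suc.prems(3)) auto
      moreover have "coeff (q j) 0 = - z0 * coeff (s j) 0 + poly (q j) z0" for j by (subst q) simp
      ultimately show ?thesis using 0 by simp
    next
      case (Suc k)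
      thus ?thesis using p(2) by (auto simp: cq intro!: tendsto_intros)
    qed
    moreover have "coeff ?p i = 0" if "i \<ge> Suc K" for i using that p(1) by (cases i) auto
    ultimately show ?case by blast
  qed
  thus ?thesis using that by blast
qed

lemma uniform_poly_convergence:
  fixes q :: "nat \<Rightarrow> complex poly"
  assumes deg: "\<And>j i. i \<ge> K \<Longrightarrow> coeff (q j) i = 0" "\<And>i. i \<ge> K \<Longrightarrow> coeff p i = 0"
    and lim: "\<And>i. (\<lambda>j. coeff (q j) i) \<longlonglongrightarrow> coeff p i"
  obtains e where "e \<longlonglongrightarrow> 0" "\<And>j z. norm z \<le> M \<Longrightarrow> norm (poly (q j) z - poly p z) \<le> e j"
proof (rule that[of "\<lambda>j. \<Sum>i<K. norm (coeff (q j) i - coeff p i) * M ^ i"])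
  have "(\<lambda>j. \<Sum>i<K. norm (coeff (q j) i - coeff p i) * M ^ i) \<longlonglongrightarrow> (\<Sum>i<K. norm (coeff p i - coeff p i) * M ^ i)"
    by (intro tendsto_intros lim)
  thus "(\<lambda>j. \<Sum>i<K. norm (coeff (q j) i - coeff p i) * M ^ i) \<longlonglongrightarrow> 0" by simp
  fix j z assume z: "norm (z::complex) \<le> M"
  have P: "poly r z = (\<Sum>i<K. coeff r i * z ^ i)" if "\<And>i. i \<ge> K \<Longrightarrow> coeff r i = 0" for r :: "complex poly"
  proof -
    have "poly r z = (\<Sum>i\<le>degree r. coeff r i * z ^ i)" by (rule poly_altdef)
    also have "\<dots> = (\<Sum>i<K. coeff r i * z ^ i)"
    proof (rule sum.mono_neutral_cong)
      show "coeff r i * z ^ i = 0" if "i \<in> {..degree r} - {..<K}" for i using that \<open>\<And>i. i \<ge> K \<Longrightarrow> coeff r i = 0\<close> by auto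
      show "coeff r i * z ^ i = 0" if "i \<in> {..<K} - {..degree r}" for i using that by (auto intro: coeff_eq_0)
    qed auto
    finally show ?thesis .
  qed
  have "poly (q j) z - poly p z = (\<Sum>i<K. (coeff (q j) i - coeff p i) * z ^ i)"
    by (subst (1 2) P) (use deg in \<open>auto simp: sum_subtractf algebra_simps\<close>)
  also have "norm \<dots> \<le> (\<Sum>i<K. norm (coeff (q j) i - coeff p i) * M ^ i)"
    by (intro sum_norm_le) (auto simp: norm_mult norm_power intro!: mult_left_mono power_mono z)
  finally show "norm (poly (q j) z - poly p z) \<le> (\<Sum>i<K. norm (coeff (q j) i - coeff p i) * M ^ i)" .
qed

text \<open>
  An infinite product along the net of finite subsets; the finitely many factors in \<open>F\<close> may vanish and are
  split off before taking logarithms.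
\<close>

lemma tendsto_prod_exp_net:
  fixes g :: "'a \<Rightarrow> complex"
  assumes F: "finite F" and g: "\<And>x. x \<in> A - F \<Longrightarrow> g x = exp (t x)" and t: "t summable_on (A - F)"
  shows "\<exists>L. ((\<lambda>X. \<Prod>x\<in>X. g x) \<longlongrightarrow> L) (finite_subsets_at_top A)"
proof -
  have "(sum t \<longlongrightarrow> infsum t (A - F)) (finite_subsets_at_top (A - F))"
    using has_sum_infsum[OF t] by (simp add: has_sum_def)
  moreover have "filterlim (\<lambda>X. X - F) (finite_subsets_at_top (A - F)) (finite_subsets_at_top A)"
    unfolding filterlim_finite_subsets_at_top
  proof safe
    fix X assume "finite X" "X \<subseteq> A - F"
    thus "\<forall>\<^sub>F y in finite_subsets_at_top A. finite (y - F) \<and> X \<subseteq> y - F \<and> y - F \<subseteq> A - F"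
      unfolding eventually_finite_subsets_at_top by (intro exI[of _ X]) auto
  qed
  ultimately have "((\<lambda>X. sum t (X - F)) \<longlongrightarrow> infsum t (A - F)) (finite_subsets_at_top A)"
    by (rule filterlim_compose)
  hence "((\<lambda>X. prod g (A \<inter> F) * exp (sum t (X - F))) \<longlongrightarrow> prod g (A \<inter> F) * exp (infsum t (A - F))) (finite_subsets_at_top A)"
    by (intro tendsto_intros)
  moreover have "eventually (\<lambda>X. prod g (A \<inter> F) * exp (sum t (X - F)) = prod g X) (finite_subsets_at_top A)"
    unfolding eventually_finite_subsets_at_top
  proof (intro exI[of _ "A \<inter> F"] conjI allI impI)
    fix X assume X: "finite X \<and> A \<inter> F \<subseteq> X \<and> X \<subseteq> A"
    have "exp (sum t (X - F)) = prod g (X - F)"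
      using X g by (subst exp_sum) (auto intro!: prod.cong)
    moreover have "prod g X = prod g (X - (A \<inter> F)) * prod g (A \<inter> F)"
      using X by (intro prod.subset_diff) auto
    moreover have "X - (A \<inter> F) = X - F" using X by auto
    ultimately show "prod g (A \<inter> F) * exp (sum t (X - F)) = prod g X" by (simp add: mult.commute)
  qed (use F in auto)
  ultimately show ?thesis using Lim_transform_eventually by blast
qed

lemma geometric_remainder:
  fixes w z :: complex
  assumes "w * z \<noteq> 1"
  shows "w / (1 - w * z) - (\<Sum>j<K. w ^ (j + 1) * z ^ j) = w ^ (K + 1) * z ^ K / (1 - w * z)"
proof -
  have "(\<Sum>j<K. w ^ (j + 1) * z ^ j) = w * (\<Sum>j<K. (w * z) ^ j)"
    by (simp add: sum_distrib_left power_mult_distrib mult_ac)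
  also have "\<dots> = w * ((1 - (w * z) ^ K) / (1 - w * z))"
    using assms by (subst sum_gp_strict) simp
  finally have "w / (1 - w * z) - (\<Sum>j<K. w ^ (j + 1) * z ^ j) = w / (1 - w * z) - w * ((1 - (w * z) ^ K) / (1 - w * z))"
    by (simp only:)
  also have "\<dots> = (w - w * (1 - (w * z) ^ K)) / (1 - w * z)"
    by (simp only: times_divide_eq_right diff_divide_distrib[of w])
  also have "w - w * (1 - (w * z) ^ K) = w ^ (K + 1) * z ^ K" by (simp add: algebra_simps power_mult_distrib)
  finally show ?thesis .
qed

lemma poly_antiderivative:
  fixes q :: "complex poly"
  obtains Q where "pderiv Q = q" "poly Q 0 = c"
proof
  define Q where "Q = pCons c (\<Sum>n\<le>degree q. monom (coeff q n / of_nat (Suc n)) n)"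
  have cQ: "coeff Q (Suc n) = coeff q n / of_nat (Suc n)" for n
    by (auto simp: Q_def coeff_sum coeff_eq_0)
  show "pderiv Q = q" by (rule poly_eqI) (simp add: coeff_pderiv cQ del: of_nat_Suc)
  show "poly Q 0 = c" by (simp add: Q_def)
qed

section \<open>The Hadamard factorization\<close>

locale finite_order_fun = mero_fun +
  assumes finite_order: "growth_order f < \<infinity>"
begin

text \<open>
  The zeros and poles over which the canonical product runs.
\<close>

abbreviation "D0 \<equiv> divisor_supp f - {0}"

text \<open>
  The index of the elementary factors.  Truncated subtraction gives 0 for convergence exponent 0, where the
  elementary factors are the plain \<open>1 - z\<close>; hence \<open>Suc prim_genus\<close> is the maximum of 1 and the convergence
  exponent.
\<close>

definition prim_genus :: nat where "prim_genus = conv_exponent f - 1"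

lemma divisor_summable:
  assumes "k \<ge> conv_exponent f"
  shows "(\<lambda>\<rho>. real_of_int \<bar>zorder f \<rho>\<bar> / norm \<rho> ^ k) summable_on D0"
proof -
  have "(\<lambda>\<rho>. real_of_int \<bar>zorder f \<rho>\<bar> / norm \<rho> ^ conv_exponent f) summable_on D0"
    unfolding conv_exponent_def by (rule LeastI_ex[OF divisor_summable_of_growth[OF finite_order]])
  hence "(\<lambda>\<rho>. norm (real_of_int \<bar>zorder f \<rho>\<bar> / norm \<rho> ^ k)) summable_on D0"
  proof (rule abs_summable_on_cofinite_comparison)
    show "finite (divisor_disc 1)" by (rule finite_divisor_disc)
    fix \<rho> assume "\<rho> \<in> D0 - divisor_disc 1"
    hence \<rho>: "norm \<rho> \<ge> 1" by (auto simp: divisor_disc_def)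
    have "0 < norm \<rho> ^ m" for m using \<rho> by (intro zero_less_power) linarith
    thus "norm (real_of_int \<bar>zorder f \<rho>\<bar> / norm \<rho> ^ k) \<le> real_of_int \<bar>zorder f \<rho>\<bar> / norm \<rho> ^ conv_exponent f"
      using assms \<rho> by (simp add: norm_divide norm_power divide_left_mono power_increasing mult_pos_pos)
  qed
  thus ?thesis by simp
qed

lemma divisor_summable_prim_genus:
  "(\<lambda>\<rho>. real_of_int \<bar>zorder f \<rho>\<bar> / norm \<rho> ^ Suc prim_genus) summable_on D0"
  by (rule divisor_summable) (simp add: prim_genus_def)

lemma filterlim_divisor_disc:
  assumes "filterlim rs at_top F"
  shows "filterlim (\<lambda>j. divisor_disc (rs j)) (finite_subsets_at_top D0) F"
  unfolding filterlim_finite_subsets_at_top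
proof safe
  fix X assume X: "finite X" "X \<subseteq> D0"
  define M where "M = Max (insert 0 (norm ` X))"
  have M: "norm \<rho> \<le> M" if "\<rho> \<in> X" for \<rho> unfolding M_def using X that by (intro Max_ge) auto
  have "eventually (\<lambda>j. rs j \<ge> M) F" using assms by (simp add: filterlim_at_top)
  thus "\<forall>\<^sub>F y in F. finite (divisor_disc (rs y)) \<and> X \<subseteq> divisor_disc (rs y) \<and> divisor_disc (rs y) \<subseteq> D0"
  proof eventually_elim
    case (elim j)
    have "norm \<rho> \<le> rs j" if "\<rho> \<in> X" for \<rho> using M[OF that] elim by linarith
    thus ?case using X finite_divisor_disc by (auto simp: divisor_disc_def)
  qed
qed

text \<open>
  The logarithmic derivative of \<open>(E (z / \<rho>)) ^ n\<close>, where \<open>E\<close> is the elementary factor and \<open>n\<close> the multiplicity.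
\<close>

definition logderiv_term :: "complex \<Rightarrow> complex \<Rightarrow> complex" where
  "logderiv_term z \<rho> = of_int (zorder f \<rho>) * (z / \<rho>) ^ prim_genus / (z - \<rho>)"

lemma logderiv_term_eq:
  assumes "\<rho> \<noteq> 0" "z \<noteq> \<rho>"
  shows "logderiv_term z \<rho> = of_int (zorder f \<rho>) / (z - \<rho>) +
           of_int (zorder f \<rho>) * (\<Sum>j<prim_genus. z ^ j / \<rho> ^ (j + 1))"
proof -
  have "(1 / \<rho>) / (1 - (1 / \<rho>) * z) - (\<Sum>j<prim_genus. (1 / \<rho>) ^ (j + 1) * z ^ j) =
      (1 / \<rho>) ^ (prim_genus + 1) * z ^ prim_genus / (1 - (1 / \<rho>) * z)"
    by (rule geometric_remainder) (use assms in auto)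
  moreover have "(1 / \<rho>) / (1 - (1 / \<rho>) * z) = - (1 / (z - \<rho>))"
  proof -
    have "1 - (1 / \<rho>) * z = - ((z - \<rho>) / \<rho>)" using assms by (simp add: field_simps)
    thus ?thesis using assms by simp
  qed
  moreover have "(1 / \<rho>) ^ (prim_genus + 1) * z ^ prim_genus / (1 - (1 / \<rho>) * z) = - ((z / \<rho>) ^ prim_genus / (z - \<rho>))"
  proof -
    have "1 - (1 / \<rho>) * z = - ((z - \<rho>) / \<rho>)" using assms by (simp add: field_simps)
    thus ?thesis using assms by (simp add: power_divide)
  qed
  moreover have "(\<Sum>j<prim_genus. (1 / \<rho>) ^ (j + 1) * z ^ j) = (\<Sum>j<prim_genus. z ^ j / \<rho> ^ (j + 1))"
    by (simp add: power_one_over)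
  moreover have "b = a + s" if "x - s' = y" "x = - a" "y = - b" "s' = s" for a b s s' x y :: complex
    using that by (simp add: algebra_simps)
  ultimately have "(z / \<rho>) ^ prim_genus / (z - \<rho>) = 1 / (z - \<rho>) + (\<Sum>j<prim_genus. z ^ j / \<rho> ^ (j + 1))"
    by blast
  hence "of_int (zorder f \<rho>) * ((z / \<rho>) ^ prim_genus / (z - \<rho>)) =
      of_int (zorder f \<rho>) * (1 / (z - \<rho>) + (\<Sum>j<prim_genus. z ^ j / \<rho> ^ (j + 1)))" by simp
  thus ?thesis unfolding logderiv_term_def by (simp add: distrib_left)
qed

text \<open>
  For \<open>\<bar>\<rho>\<bar> > 2 \<bar>z\<bar>\<close> the term is at most \<open>2 \<bar>z\<bar> ^ p \<bar>n\<bar> / \<bar>\<rho>\<bar> ^ (p + 1)\<close>, which the convergence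
  exponent makes summable.
\<close>

lemma logderiv_term_summable:
  shows "(\<lambda>\<rho>. norm (logderiv_term z \<rho>)) summable_on D0"
proof (rule abs_summable_on_cofinite_comparison)
  show "(\<lambda>\<rho>. 2 * norm z ^ prim_genus * (real_of_int \<bar>zorder f \<rho>\<bar> / norm \<rho> ^ Suc prim_genus)) summable_on D0"
    by (intro summable_on_cmult_right divisor_summable_prim_genus)
  show "finite (divisor_disc (2 * norm z))" by (rule finite_divisor_disc)
  fix \<rho> assume \<rho>: "\<rho> \<in> D0 - divisor_disc (2 * norm z)"
  hence "norm \<rho> > 2 * norm z" "\<rho> \<noteq> 0" by (auto simp: divisor_disc_def)
  hence d: "norm (z - \<rho>) \<ge> norm \<rho> / 2" using norm_triangle_ineq2[of \<rho> z] by (simp add: norm_minus_commute)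
  have "norm (logderiv_term z \<rho>) = \<bar>zorder f \<rho>\<bar> * norm z ^ prim_genus / norm \<rho> ^ prim_genus / norm (z - \<rho>)"
    by (simp add: logderiv_term_def norm_mult norm_divide norm_power power_divide)
  also have "\<dots> \<le> \<bar>zorder f \<rho>\<bar> * norm z ^ prim_genus / norm \<rho> ^ prim_genus / (norm \<rho> / 2)"
    using d \<open>\<rho> \<noteq> 0\<close> by (intro divide_left_mono divide_nonneg_nonneg mult_nonneg_nonneg mult_pos_pos) auto
  also have "\<dots> = 2 * norm z ^ prim_genus * (real_of_int \<bar>zorder f \<rho>\<bar> / norm \<rho> ^ Suc prim_genus)"
    using \<open>\<rho> \<noteq> 0\<close> by (simp add: field_simps)
  finally show "norm (logderiv_term z \<rho>) \<le> \<dots>" .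
qed

text \<open>
  By \<open>blaschke_log\<close>, \<open>h' / h\<close> is the derivative of a function whose real part on the circle is \<open>ln \<bar>f\<bar>\<close>,
  plus a sum of poles at the reflected points outside the circle.  Both have Taylor coefficients of index
  \<open>k\<close> of order \<open>r ^ (A - k - 1)\<close>, so beyond index \<open>A\<close> they are negligible for large \<open>r\<close>.
\<close>

lemma zero_free_logderiv_approx:
  obtains K :: nat and C r0 where "K \<ge> prim_genus" "C \<ge> 0" "r0 \<ge> 1"
    "\<And>r R h. r \<ge> r0 \<Longrightarrow> divisor_supp f \<inter> sphere 0 r = {} \<Longrightarrow> zero_free_part r R h \<Longrightarrow>
       \<exists>q. (\<forall>i\<ge>K. coeff q i = 0) \<and> (\<forall>z. norm z \<le> r / 2 \<longrightarrow> norm (deriv h z / h z - poly q z) \<le> C / r * norm z ^ K)"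
proof -
  obtain A :: nat and B r0 where A: "A \<ge> 1" "r0 \<ge> 1" "B \<ge> 0"
    "\<And>r. r \<ge> r0 \<Longrightarrow> divisor_supp f \<inter> sphere 0 r = {} \<Longrightarrow> circle_log_abs r \<le> B * r ^ A"
    "\<And>r. r \<ge> r0 \<Longrightarrow> (\<Sum>\<rho>\<in>divisor_disc r. \<bar>real_of_int (zorder f \<rho>)\<bar>) \<le> B * r ^ A"
    by (rule growth_estimates[OF finite_order]) (rule that)
  (* At least \<open>A\<close>, so that the growth \<open>r ^ A\<close> is absorbed; at least \<open>prim_genus\<close>, so that the polynomials
     completing the partial fractions also have degree below \<open>K\<close>. *)
  define K where "K = A + prim_genus"
  obtain C0 where C0: "C0 \<ge> 0"
    "\<And>g R r. \<lbrakk>g holomorphic_on ball 0 R; 0 < r; r < R\<rbrakk> \<Longrightarrow>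
       \<exists>q. (\<forall>i\<ge>K. coeff q i = 0) \<and>
         (\<forall>z. norm z \<le> r / 2 \<longrightarrow> norm (deriv g z - poly q z) \<le>
            C0 * integral {0..2*pi} (\<lambda>\<theta>. \<bar>Re (g (of_real r * cis \<theta>))\<bar>) / r ^ (K + 1) * norm z ^ K)"
    by (rule deriv_approx_poly_real_part_bound) (rule that)
  show ?thesis
  proof (rule that[of K "C0 * B + 2 * B" r0])
    fix r R h assume r: "r \<ge> r0" and sph: "divisor_supp f \<inter> sphere 0 r = {}" and h: "zero_free_part r R h"
    have r1: "r \<ge> 1" and r_pos: "r > 0" using r A by linarith+
    let ?D = "divisor_disc r"
    obtain R' g where R': "R' > r" and g: "g holomorphic_on ball 0 R'"
      "\<And>z. norm z = r \<Longrightarrow> Re (g z) = ln (norm (f z))"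
      "\<And>z. z \<in> ball 0 r \<Longrightarrow> deriv h z / h z = deriv g z +
        (\<Sum>\<rho>\<in>divisor_disc r. of_int (zorder f \<rho>) * (cnj \<rho> / (of_real r ^ 2 - cnj \<rho> * z)))"
      by (rule blaschke_log[OF r_pos sph h]) (rule that)
    have "integral {0..2*pi} (\<lambda>\<theta>. \<bar>Re (g (of_real r * cis \<theta>))\<bar>) = circle_log_abs r"
      unfolding circle_log_abs_def using g(2) r_pos by (simp add: norm_mult)
    with C0(2)[OF g(1) r_pos R'] obtain q1 where q1: "\<And>i. i \<ge> K \<Longrightarrow> coeff q1 i = 0"
      "\<And>z. norm z \<le> r / 2 \<Longrightarrow> norm (deriv g z - poly q1 z) \<le> C0 * circle_log_abs r / r ^ (K + 1) * norm z ^ K"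
      by auto
    (* The inverse of the reflected point; \<open>q2\<close> is the Taylor polynomial of the sum of poles there. *)
    define w where "w \<rho> = cnj \<rho> / of_real r ^ 2" for \<rho>
    obtain q2 where q2: "\<And>z. poly q2 z = (\<Sum>j<K. (\<Sum>\<rho>\<in>?D. of_int (zorder f \<rho>) * w \<rho> ^ (j + 1)) * z ^ j)"
      "\<And>i. i \<ge> K \<Longrightarrow> coeff q2 i = 0"
      using poly_of_coeffs[where K = K and a = "\<lambda>j. \<Sum>\<rho>\<in>?D. of_int (zorder f \<rho>) * w \<rho> ^ (j + 1)"] by blast
    have "norm (deriv h z / h z - poly (q1 + q2) z) \<le> (C0 * B + 2 * B) / r * norm z ^ K" if z: "norm z \<le> r / 2" for z
    proof -
      have rK: "B * r ^ A / r ^ (K + 1) \<le> B / r"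
      proof -
        have "r ^ A \<le> r ^ K" using r1 by (intro power_increasing) (auto simp: K_def)
        hence "B * r ^ A / r ^ (K + 1) \<le> B * r ^ K / r ^ (K + 1)" using A r_pos by (intro divide_right_mono mult_left_mono) auto
        thus ?thesis using r_pos by simp
      qed
      have w: "norm (w \<rho>) \<le> 1 / r" "norm (w \<rho> * z) \<le> 1 / 2" if "\<rho> \<in> ?D" for \<rho>
      proof -
        have "norm \<rho> \<le> r" using that by (simp add: divisor_disc_def)
        hence "norm \<rho> / r ^ 2 \<le> r / r ^ 2" by (rule divide_right_mono) simp
        thus 1: "norm (w \<rho>) \<le> 1 / r" using r_pos by (simp add: w_def norm_divide norm_mult power2_eq_square)
        have "norm (w \<rho> * z) \<le> 1 / r * (r / 2)" unfolding norm_mult using 1 z r_pos by (intro mult_mono) auto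
        thus "norm (w \<rho> * z) \<le> 1 / 2" using r_pos by simp
      qed
      have zr: "z \<in> ball 0 r" using z r_pos by simp
      have "deriv h z / h z - poly (q1 + q2) z = (deriv g z - poly q1 z) +
         (\<Sum>\<rho>\<in>?D. of_int (zorder f \<rho>) * (w \<rho> ^ (K + 1) * z ^ K / (1 - w \<rho> * z)))"
      proof -
        have "poly q2 z = (\<Sum>j<K. \<Sum>\<rho>\<in>?D. of_int (zorder f \<rho>) * (w \<rho> ^ (j + 1) * z ^ j))"
          unfolding q2 by (simp add: sum_distrib_right mult.assoc)
        also have "\<dots> = (\<Sum>\<rho>\<in>?D. of_int (zorder f \<rho>) * (\<Sum>j<K. w \<rho> ^ (j + 1) * z ^ j))"
          by (subst sum.swap) (simp add: sum_distrib_left)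
        finally have "(\<Sum>\<rho>\<in>?D. of_int (zorder f \<rho>) * (cnj \<rho> / (of_real r ^ 2 - cnj \<rho> * z))) - poly q2 z =
           (\<Sum>\<rho>\<in>?D. of_int (zorder f \<rho>) * (cnj \<rho> / (of_real r ^ 2 - cnj \<rho> * z) - (\<Sum>j<K. w \<rho> ^ (j + 1) * z ^ j)))"
          by (simp add: sum_subtractf right_diff_distrib)
        also have "\<dots> = (\<Sum>\<rho>\<in>?D. of_int (zorder f \<rho>) * (w \<rho> ^ (K + 1) * z ^ K / (1 - w \<rho> * z)))"
        proof (rule sum.cong[OF refl])
          fix \<rho> assume \<rho>: "\<rho> \<in> ?D"
          have ne: "w \<rho> * z \<noteq> 1" using w(2)[OF \<rho>] by auto
          have "cnj \<rho> / (of_real r ^ 2 - cnj \<rho> * z) = w \<rho> / (1 - w \<rho> * z)"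
          proof -
            have "1 - w \<rho> * z = (of_real r ^ 2 - cnj \<rho> * z) / of_real r ^ 2"
              using r_pos by (simp add: w_def diff_divide_distrib)
            thus ?thesis using r_pos by (simp add: w_def)
          qed
          thus "of_int (zorder f \<rho>) * (cnj \<rho> / (of_real r ^ 2 - cnj \<rho> * z) - (\<Sum>j<K. w \<rho> ^ (j + 1) * z ^ j))
             = of_int (zorder f \<rho>) * (w \<rho> ^ (K + 1) * z ^ K / (1 - w \<rho> * z))"
            using geometric_remainder[OF ne, of K] by simp
        qed
        finally show ?thesis using g(3)[OF zr] by (simp add: algebra_simps)
      qed
      also have "norm \<dots> \<le> C0 * circle_log_abs r / r ^ (K + 1) * norm z ^ K +
          (\<Sum>\<rho>\<in>?D. \<bar>real_of_int (zorder f \<rho>)\<bar> * (2 * (1 / r) ^ (K + 1) * norm z ^ K))"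
      proof (rule norm_triangle_mono[OF q1(2)[OF z] sum_norm_le])
        fix \<rho> assume \<rho>: "\<rho> \<in> ?D"
        have "norm (1 - w \<rho> * z) \<ge> 1 / 2" using w(2)[OF \<rho>] norm_triangle_ineq2[of 1 "w \<rho> * z"] by simp
        hence "norm (w \<rho> ^ (K + 1) * z ^ K / (1 - w \<rho> * z)) \<le> (1 / r) ^ (K + 1) * norm z ^ K / (1 / 2)"
          unfolding norm_divide norm_mult norm_power using w(1)[OF \<rho>]
          by (intro frac_le mult_right_mono power_mono) (use r_pos in auto)
        also have "(1 / r) ^ (K + 1) * norm z ^ K / (1 / 2) = 2 * (1 / r) ^ (K + 1) * norm z ^ K" by simp
        finally show "norm (of_int (zorder f \<rho>) * (w \<rho> ^ (K + 1) * z ^ K / (1 - w \<rho> * z))) \<le>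
             \<bar>real_of_int (zorder f \<rho>)\<bar> * (2 * (1 / r) ^ (K + 1) * norm z ^ K)"
          unfolding norm_mult norm_of_int by (intro mult_left_mono) auto
      qed
      also have "\<dots> = (C0 * (circle_log_abs r / r ^ (K + 1)) +
           2 * ((\<Sum>\<rho>\<in>?D. \<bar>real_of_int (zorder f \<rho>)\<bar>) / r ^ (K + 1))) * norm z ^ K"
        unfolding sum_distrib_right[symmetric] by (simp add: power_one_over field_simps)
      also have "\<dots> \<le> (C0 * (B / r) + 2 * (B / r)) * norm z ^ K"
      proof (intro mult_right_mono add_mono mult_left_mono)
        show "circle_log_abs r / r ^ (K + 1) \<le> B / r"
          by (rule order_trans[OF divide_right_mono[OF A(4)[OF r sph]] rK]) (use r_pos in simp)
        show "(\<Sum>\<rho>\<in>?D. \<bar>real_of_int (zorder f \<rho>)\<bar>) / r ^ (K + 1) \<le> B / r"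
          by (rule order_trans[OF divide_right_mono[OF A(5)[OF r]] rK]) (use r_pos in simp)
      qed (use C0 in auto)
      also have "\<dots> = (C0 * B + 2 * B) / r * norm z ^ K" by (simp add: add_divide_distrib)
      finally show ?thesis .
    qed
    moreover have "coeff (q1 + q2) i = 0" if "i \<ge> K" for i using q1(1) q2(2) that by simp
    ultimately show "\<exists>q. (\<forall>i\<ge>K. coeff q i = 0) \<and>
        (\<forall>z. norm z \<le> r / 2 \<longrightarrow> norm (deriv h z / h z - poly q z) \<le> (C0 * B + 2 * B) / r * norm z ^ K)"
      by (intro exI[of _ "q1 + q2"]) auto
  qed (use A C0 in \<open>auto simp: K_def\<close>)
qed

text \<open>
  The Hadamard factorization may be differentiated logarithmically factor by factor; \<open>q\<close> stands for the
  derivative of its polynomial.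
\<close>

definition logderiv_expansion :: "complex poly \<Rightarrow> bool" where
  "logderiv_expansion q \<longleftrightarrow> (\<forall>z. z \<notin> divisor_supp f \<longrightarrow> z \<noteq> 0 \<longrightarrow>
     (logderiv_term z has_sum deriv f z / f z - of_int (zorder f 0) / z - poly q z) D0)"

lemma logderiv_expansionD:
  "logderiv_expansion q \<Longrightarrow> z \<notin> divisor_supp f \<Longrightarrow> z \<noteq> 0 \<Longrightarrow>
     (logderiv_term z has_sum deriv f z / f z - of_int (zorder f 0) / z - poly q z) D0"
  by (simp add: logderiv_expansion_def)

text \<open>
  The difference of \<open>f' / f\<close> and its expansion restricted to the disc of radius \<open>r\<close>, written so that it is
  visibly holomorphic in that disc.
\<close>

definition partial_logderiv :: "real \<Rightarrow> (complex \<Rightarrow> complex) \<Rightarrow> complex \<Rightarrow> complex" where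
  "partial_logderiv r h z = deriv h z / h z -
     (\<Sum>\<rho>\<in>divisor_disc r. of_int (zorder f \<rho>) * (\<Sum>j<prim_genus. z ^ j / \<rho> ^ (j + 1)))"

lemma partial_logderiv_eq:
  assumes h: "zero_free_part r R h" and z: "z \<in> ball 0 R" "z \<notin> divisor_supp f" "z \<noteq> 0"
  shows "partial_logderiv r h z = deriv f z / f z - of_int (zorder f 0) / z - (\<Sum>\<rho>\<in>divisor_disc r. logderiv_term z \<rho>)"
proof -
  have "(\<Sum>\<rho>\<in>divisor_disc r. logderiv_term z \<rho>) = (\<Sum>\<rho>\<in>divisor_disc r. of_int (zorder f \<rho>) / (z - \<rho>) +
           of_int (zorder f \<rho>) * (\<Sum>j<prim_genus. z ^ j / \<rho> ^ (j + 1)))"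
    using z by (intro sum.cong refl logderiv_term_eq) (auto simp: divisor_disc_def)
  thus ?thesis
    unfolding partial_logderiv_def logderiv_eq_zero_free_part[OF assms] by (simp add: sum.distrib)
qed

lemma zero_free_part_exhaustion:
  obtains rs Rs hs where "filterlim rs at_top sequentially" "\<And>j. rs j > real j"
    "\<And>j. divisor_supp f \<inter> sphere 0 (rs j) = {}" "\<And>j. zero_free_part (rs j) (Rs j) (hs j)"
proof -
  have "\<exists>r. real j < r \<and> divisor_supp f \<inter> sphere 0 r = {}" for j :: nat
    using divisor_free_radius[of "real j" "real j + 1"] by auto
  then obtain rs where rs: "\<And>j. real j < rs j" "\<And>j. divisor_supp f \<inter> sphere 0 (rs j) = {}"
    by metis
  have "\<exists>x. zero_free_part (rs j) (fst x) (snd x)" for j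
  proof -
    have "rs j > 0" using rs(1)[of j] by (meson le_less_trans of_nat_0_le_iff)
    then obtain R h where "zero_free_part (rs j) R h" by (rule zero_free_part_exists)
    thus ?thesis by (intro exI[of _ "(R, h)"]) simp
  qed
  then obtain x where x: "\<And>j. zero_free_part (rs j) (fst (x j)) (snd (x j))" by metis
  have lim: "filterlim rs at_top sequentially"
    by (rule filterlim_at_top_mono[OF filterlim_real_sequentially]) (intro always_eventually allI less_imp_le rs(1))
  show ?thesis by (rule that[OF lim rs x])
qed

lemma infinite_off_divisor: "infinite (ball 0 1 - divisor_supp f - {0})"
proof
  assume "finite (ball 0 1 - divisor_supp f - {0})"
  hence "finite ((ball 0 1 - divisor_supp f - {0}) \<union> (divisor_supp f \<inter> cball 0 1) \<union> {0})"
    using finite_divisor by simp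
  hence "finite (ball (0::complex) 1)" by (rule finite_subset[rotated]) auto
  thus False using finite_imp_not_open[of "ball (0::complex) 1"] by simp
qed

text \<open>
  For each radius the function is within \<open>O (1 / r)\<close> of a polynomial of degree below a fixed \<open>K\<close>, and off the
  divisor it converges pointwise, because the partial fractions are summable.  So the polynomials converge
  pointwise at infinitely many points, hence coefficientwise, and their limit is the polynomial part.
\<close>

lemma partial_logderiv_limit:
  assumes rs: "filterlim rs at_top sequentially" "\<And>j. divisor_supp f \<inter> sphere 0 (rs j) = {}"
    and hs: "\<And>j. zero_free_part (rs j) (Rs j) (hs j)"
  obtains q where
    "\<And>M. \<exists>e. e \<longlonglongrightarrow> 0 \<and> eventually (\<lambda>j. \<forall>z. norm z \<le> M \<longrightarrow> norm (partial_logderiv (rs j) (hs j) z - poly q z) \<le> e j) sequentially"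
    "logderiv_expansion q"
proof -
  obtain K :: nat and C r0 where K: "K \<ge> prim_genus" "C \<ge> 0" "r0 \<ge> 1"
    "\<And>r R h. r \<ge> r0 \<Longrightarrow> divisor_supp f \<inter> sphere 0 r = {} \<Longrightarrow> zero_free_part r R h \<Longrightarrow>
       \<exists>q. (\<forall>i\<ge>K. coeff q i = 0) \<and> (\<forall>z. norm z \<le> r / 2 \<longrightarrow> norm (deriv h z / h z - poly q z) \<le> C / r * norm z ^ K)"
    by (rule zero_free_logderiv_approx) (rule that)
  let ?P = "\<lambda>j. partial_logderiv (rs j) (hs j)"
  have "\<exists>q. (\<forall>i\<ge>K. coeff q i = 0) \<and> (rs j \<ge> r0 \<longrightarrow> (\<forall>z. norm z \<le> rs j / 2 \<longrightarrow> norm (?P j z - poly q z) \<le> C / rs j * norm z ^ K))" for j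
  proof (cases "rs j \<ge> r0")
    case True
    obtain q where q: "\<And>i. i \<ge> K \<Longrightarrow> coeff q i = 0"
      "\<And>z. norm z \<le> rs j / 2 \<Longrightarrow> norm (deriv (hs j) z / hs j z - poly q z) \<le> C / rs j * norm z ^ K"
      using K(4)[OF True rs(2) hs] by blast
    obtain s where s: "\<And>z. poly s z = (\<Sum>i<prim_genus. (\<Sum>\<rho>\<in>divisor_disc (rs j). of_int (zorder f \<rho>) / \<rho> ^ (i + 1)) * z ^ i)"
      "\<And>i. i \<ge> prim_genus \<Longrightarrow> coeff s i = 0"
      using poly_of_coeffs[where K = prim_genus and a = "\<lambda>i. \<Sum>\<rho>\<in>divisor_disc (rs j). of_int (zorder f \<rho>) / \<rho> ^ (i + 1)"] by blast
    have "(\<Sum>\<rho>\<in>divisor_disc (rs j). of_int (zorder f \<rho>) * (\<Sum>i<prim_genus. z ^ i / \<rho> ^ (i + 1))) = poly s z" for z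
      unfolding s sum_distrib_left sum_distrib_right by (subst sum.swap) (simp add: mult_ac)
    hence D: "?P j z - poly (q - s) z = deriv (hs j) z / hs j z - poly q z" for z
      by (simp add: partial_logderiv_def)
    show ?thesis
    proof (intro exI[of _ "q - s"] conjI allI impI)
      show "norm (?P j z - poly (q - s) z) \<le> C / rs j * norm z ^ K" if "norm z \<le> rs j / 2" for z
        unfolding D by (rule q(2)[OF that])
    qed (use q(1) s(2) K(1) in simp)
  qed (auto intro!: exI[of _ 0])
  then obtain q where q: "\<And>j i. i \<ge> K \<Longrightarrow> coeff (q j) i = 0"
    "\<And>j z. rs j \<ge> r0 \<Longrightarrow> norm z \<le> rs j / 2 \<Longrightarrow> norm (?P j z - poly (q j) z) \<le> C / rs j * norm z ^ K"
    by metis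
  have ev: "eventually (\<lambda>j. rs j \<ge> m) sequentially" for m using rs(1) by (simp add: filterlim_at_top)
  have err: "(\<lambda>j. C / rs j * m) \<longlonglongrightarrow> 0" for m
    using tendsto_mult_left_zero[OF tendsto_divide_0[OF tendsto_const filterlim_at_top_imp_at_infinity[OF rs(1)]]] .
  define W where "W z = deriv f z / f z - of_int (zorder f 0) / z - infsum (logderiv_term z) D0" for z
  have P_lim: "(\<lambda>j. ?P j z) \<longlonglongrightarrow> W z" if z: "z \<notin> divisor_supp f" "z \<noteq> 0" for z
  proof -
    have "(sum (logderiv_term z) \<longlongrightarrow> infsum (logderiv_term z) D0) (finite_subsets_at_top D0)"
      using has_sum_infsum[OF abs_summable_summable[OF logderiv_term_summable]] by (simp add: has_sum_def)
    hence "(\<lambda>j. sum (logderiv_term z) (divisor_disc (rs j))) \<longlonglongrightarrow> infsum (logderiv_term z) D0"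
      by (rule filterlim_compose[OF _ filterlim_divisor_disc[OF rs(1)]])
    hence "(\<lambda>j. deriv f z / f z - of_int (zorder f 0) / z - sum (logderiv_term z) (divisor_disc (rs j))) \<longlonglongrightarrow> W z"
      unfolding W_def by (intro tendsto_intros)
    moreover have "eventually (\<lambda>j. deriv f z / f z - of_int (zorder f 0) / z - sum (logderiv_term z) (divisor_disc (rs j)) = ?P j z) sequentially"
      using ev[of "norm z + 1"]
    proof eventually_elim
      case (elim j)
      have "z \<in> ball 0 (Rs j)" using hs[of j] elim by (auto simp: zero_free_part_def)
      thus ?case using partial_logderiv_eq[OF hs[of j]] z by simp
    qed
    ultimately show ?thesis by (rule Lim_transform_eventually)
  qed
  have q_lim: "(\<lambda>j. poly (q j) z) \<longlonglongrightarrow> W z" if z: "z \<notin> divisor_supp f" "z \<noteq> 0" for z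
  proof -
    have "eventually (\<lambda>j. norm (?P j z - poly (q j) z) \<le> C / rs j * norm z ^ K) sequentially"
      using ev[of r0] ev[of "2 * norm z"] by eventually_elim (rule q(2), auto)
    hence "(\<lambda>j. ?P j z - poly (q j) z) \<longlonglongrightarrow> 0" by (rule Lim_null_comparison[OF _ err])
    from tendsto_diff[OF P_lim[OF z] this] show ?thesis by simp
  qed
  obtain p where p: "\<And>i. i \<ge> K \<Longrightarrow> coeff p i = 0" "\<And>i. (\<lambda>j. coeff (q j) i) \<longlonglongrightarrow> coeff p i"
    using tendsto_poly_of_tendsto_coeffs[of K q, OF q(1) infinite_off_divisor q_lim] by auto
  show ?thesis
  proof (rule that[of p])
    fix M :: real
    obtain e where e: "e \<longlonglongrightarrow> 0" "\<And>j z. norm z \<le> M \<Longrightarrow> norm (poly (q j) z - poly p z) \<le> e j"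
      by (rule uniform_poly_convergence[of K q p M, OF q(1) p]) (assumption | rule that)+
    have "(\<lambda>j. C / rs j * M ^ K + e j) \<longlonglongrightarrow> 0" using tendsto_add[OF err e(1)] by simp
    moreover have "eventually (\<lambda>j. \<forall>z. norm z \<le> M \<longrightarrow> norm (?P j z - poly p z) \<le> C / rs j * M ^ K + e j) sequentially"
      using ev[of r0] ev[of "2 * M"]
    proof eventually_elim
      case (elim j)
      show ?case
      proof (intro allI impI)
        fix z :: complex assume z: "norm z \<le> M"
        have "norm (?P j z - poly (q j) z) \<le> C / rs j * norm z ^ K" using elim z by (intro q(2)) auto
        also have "\<dots> \<le> C / rs j * M ^ K"
          using K(2,3) elim z by (intro mult_left_mono power_mono divide_nonneg_nonneg) auto
        finally have "norm ((?P j z - poly (q j) z) + (poly (q j) z - poly p z)) \<le> C / rs j * M ^ K + e j"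
          by (rule norm_triangle_mono[OF _ e(2)[OF z]])
        thus "norm (?P j z - poly p z) \<le> C / rs j * M ^ K + e j" by simp
      qed
    qed
    ultimately show "\<exists>e. e \<longlonglongrightarrow> 0 \<and> eventually (\<lambda>j. \<forall>z. norm z \<le> M \<longrightarrow> norm (?P j z - poly p z) \<le> e j) sequentially"
      by blast
  next
    show "logderiv_expansion p"
      unfolding logderiv_expansion_def
    proof (intro allI impI)
      fix z assume z: "z \<notin> divisor_supp f" "z \<noteq> 0"
      obtain e where e: "e \<longlonglongrightarrow> 0" "\<And>j w. norm w \<le> norm z \<Longrightarrow> norm (poly (q j) w - poly p w) \<le> e j"
        by (rule uniform_poly_convergence[of K q p "norm z", OF q(1) p]) (assumption | rule that)+
      have "(\<lambda>j. poly (q j) z - poly p z) \<longlonglongrightarrow> 0"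
        by (rule Lim_null_comparison[OF _ e(1)]) (use e(2) in auto)
      from LIMSEQ_unique[OF this tendsto_diff[OF q_lim[OF z] tendsto_const]] have "poly p z = W z" by simp
      thus "(logderiv_term z has_sum deriv f z / f z - of_int (zorder f 0) / z - poly p z) D0"
        using has_sum_infsum[OF abs_summable_summable[OF logderiv_term_summable[of z]]] by (simp add: W_def)
    qed
  qed
qed

text \<open>
  Far from \<open>s\<close> the elementary factors satisfy \<open>\<bar>E (s / \<rho>) - 1\<bar> \<le> 3 \<bar>s / \<rho>\<bar> ^ (p + 1)\<close>, so their logarithms
  are summable against the multiplicities.
\<close>

lemma canonical_product_converges:
  "\<exists>L. ((\<lambda>X. \<Prod>\<rho>\<in>X. weierstrass_factor prim_genus (s / \<rho>) powi zorder f \<rho>) \<longlongrightarrow> L) (finite_subsets_at_top D0)"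
proof (rule tendsto_prod_exp_net)
  let ?E = "\<lambda>\<rho>. weierstrass_factor prim_genus (s / \<rho>)"
  (* For \<open>\<bar>s / \<rho>\<bar> < 1 / 8\<close> the factor is within \<open>3 / 8 < 1 / 2\<close> of 1, in the domain of the estimate for \<open>Ln\<close>. *)
  let ?F = "divisor_disc (8 * norm s)"
  let ?t = "\<lambda>\<rho>. of_int (zorder f \<rho>) * Ln (?E \<rho>)"
  show "finite ?F" by (rule finite_divisor_disc)
  have w: "norm (s / \<rho>) < 1 / 8 \<and> \<rho> \<noteq> 0 \<and> norm (?E \<rho> - 1) \<le> 3 * norm (s / \<rho>) ^ Suc prim_genus \<and> norm (?E \<rho> - 1) < 1 / 2"
    if \<rho>: "\<rho> \<in> D0 - ?F" for \<rho>
  proof -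
    have 0: "\<rho> \<noteq> 0" "norm \<rho> > 8 * norm s" using \<rho> by (auto simp: divisor_disc_def)
    hence 1: "norm (s / \<rho>) < 1 / 8" by (simp add: norm_divide field_simps)
    have 2: "norm (?E \<rho> - 1) \<le> 3 * norm (s / \<rho>) ^ Suc prim_genus"
      by (rule weierstrass_factor_bound) (use 1 in simp)
    have "norm (s / \<rho>) ^ Suc prim_genus \<le> norm (s / \<rho>) ^ 1"
      using 1 by (intro power_decreasing) auto
    thus ?thesis using 0 1 2 by simp
  qed
  show "?E \<rho> powi zorder f \<rho> = exp (?t \<rho>)" if \<rho>: "\<rho> \<in> D0 - ?F" for \<rho>
  proof -
    have "?E \<rho> \<noteq> 0" using w[OF \<rho>] by auto
    thus ?thesis using exp_power_int[of "Ln (?E \<rho>)" "zorder f \<rho>"] by simp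
  qed
  have "(\<lambda>\<rho>. norm (?t \<rho>)) summable_on (D0 - ?F)"
  proof (rule Infinite_Sum.abs_summable_on_comparison_test')
    show "(\<lambda>\<rho>. 6 * norm s ^ Suc prim_genus * (real_of_int \<bar>zorder f \<rho>\<bar> / norm \<rho> ^ Suc prim_genus)) summable_on (D0 - ?F)"
      by (intro summable_on_cmult_right summable_on_cofin_subset divisor_summable_prim_genus finite_divisor_disc)
    fix \<rho> assume \<rho>: "\<rho> \<in> D0 - ?F"
    have "norm (Ln (1 + (?E \<rho> - 1))) \<le> 2 * norm (?E \<rho> - 1)" by (rule norm_Ln_le) (use w[OF \<rho>] in simp)
    also have "\<dots> \<le> 2 * (3 * norm (s / \<rho>) ^ Suc prim_genus)" using w[OF \<rho>] by (intro mult_left_mono) auto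
    finally have "norm (Ln (?E \<rho>)) \<le> 6 * norm (s / \<rho>) ^ Suc prim_genus" by simp
    hence "norm (?t \<rho>) \<le> \<bar>zorder f \<rho>\<bar> * (6 * norm (s / \<rho>) ^ Suc prim_genus)"
      unfolding norm_mult norm_of_int of_int_abs by (intro mult_left_mono) auto
    also have "\<dots> = 6 * norm s ^ Suc prim_genus * (real_of_int \<bar>zorder f \<rho>\<bar> / norm \<rho> ^ Suc prim_genus)"
      by (simp only: norm_divide power_divide times_divide_eq_right mult_ac)
    finally show "norm (?t \<rho>) \<le> \<dots>" .
  qed
  thus "?t summable_on (D0 - ?F)" by (rule abs_summable_summable)
qed

text \<open>
  Take \<open>Q\<close> a primitive of the polynomial part \<open>q\<close>.  The quotient \<open>y j\<close> of \<open>f\<close> by the factorization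
  truncated to the disc of radius \<open>rs j\<close> has logarithmic derivative tending to 0 uniformly on compact sets, and value 1 at 0, so it
  tends to 1.
\<close>

lemma hadamard_factorization_exists:
  obtains Q where "hadamard_factorization f Q"
    "logderiv_expansion (pderiv Q)"
proof -
  obtain rs Rs hs where rs: "filterlim rs at_top sequentially" "\<And>j. rs j > real j"
    "\<And>j. divisor_supp f \<inter> sphere 0 (rs j) = {}" and hs: "\<And>j. zero_free_part (rs j) (Rs j) (hs j)"
    by (rule zero_free_part_exhaustion) (rule that)
  let ?P = "\<lambda>j. partial_logderiv (rs j) (hs j)"
  obtain q where q: "\<And>M. \<exists>e. e \<longlonglongrightarrow> 0 \<and> eventually (\<lambda>j. \<forall>z. norm z \<le> M \<longrightarrow> norm (?P j z - poly q z) \<le> e j) sequentially"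
    "logderiv_expansion q"
    by (rule partial_logderiv_limit[OF rs(1,3) hs]) (rule that)
  obtain Q where Q: "pderiv Q = q" "poly Q 0 = Ln leading_coeff0" by (rule poly_antiderivative)
  have ev: "eventually (\<lambda>j. rs j \<ge> m) sequentially" for m using rs(1) by (simp add: filterlim_at_top)
  have rs_pos: "rs j > 0" for j using rs(2)[of j] by (meson le_less_trans of_nat_0_le_iff)
  let ?E = "\<lambda>z \<rho>. weierstrass_factor prim_genus (z / \<rho>) powi zorder f \<rho>"
  (* The exponents of the elementary factors in the disc of radius \<open>rs j\<close>, added up. *)
  define S where "S j z = (\<Sum>\<rho>\<in>divisor_disc (rs j). of_int (zorder f \<rho>) * (\<Sum>k=1..prim_genus. (z / \<rho>) ^ k / of_nat k))" for j z
  define y where "y j z = hs j z * exp (- poly Q z) * exp (- S j z)" for j z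
  have S_deriv: "(S j has_field_derivative (\<Sum>\<rho>\<in>divisor_disc (rs j). of_int (zorder f \<rho>) * (\<Sum>i<prim_genus. z ^ i / \<rho> ^ (i + 1)))) (at z)" for j z
  proof -
    have one: "((\<lambda>z. \<Sum>k=1..prim_genus. (z / \<rho>) ^ k / of_nat k) has_field_derivative (\<Sum>i<prim_genus. z ^ i / \<rho> ^ (i + 1))) (at z)" for \<rho>
    proof -
      have "((\<lambda>z. \<Sum>i<prim_genus. (z / \<rho>) ^ Suc i / of_nat (Suc i)) has_field_derivative (\<Sum>i<prim_genus. z ^ i / \<rho> ^ (i + 1))) (at z)"
      proof (rule DERIV_sum)
        fix i
        have "((\<lambda>z. (z / \<rho>) ^ Suc i / of_nat (Suc i)) has_field_derivative (of_nat (Suc i) * ((1 / \<rho>) * (z / \<rho>) ^ i)) / of_nat (Suc i)) (at z)"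
          by (rule DERIV_cdivide[OF DERIV_cong[OF DERIV_power_Suc[OF DERIV_cdivide[OF DERIV_ident]]]]) simp
        moreover have "(of_nat (Suc i) * ((1 / \<rho>) * (z / \<rho>) ^ i)) / of_nat (Suc i) = z ^ i / \<rho> ^ (i + 1)"
          by (simp add: power_divide del: of_nat_Suc)
        ultimately show "((\<lambda>z. (z / \<rho>) ^ Suc i / of_nat (Suc i)) has_field_derivative z ^ i / \<rho> ^ (i + 1)) (at z)" by simp
      qed
      moreover have "(\<Sum>k=1..prim_genus. (z / \<rho>) ^ k / of_nat k) = (\<Sum>i<prim_genus. (z / \<rho>) ^ Suc i / of_nat (Suc i))" for z :: complex
        by (rule sum.reindex_bij_witness[of _ Suc "\<lambda>k. k - 1"]) auto
      ultimately show ?thesis by simp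
    qed
    show ?thesis unfolding S_def[abs_def] by (intro DERIV_sum DERIV_cmult one)
  qed
  have y_deriv: "(y j has_field_derivative y j z * (?P j z - poly q z)) (at z)" if z: "norm z < rs j" for j z
  proof -
    have R: "z \<in> ball 0 (Rs j)" "hs j holomorphic_on ball 0 (Rs j)" "hs j z \<noteq> 0"
      using hs[of j] z by (auto simp: zero_free_part_def)
    note H = holomorphic_derivI[OF R(2) open_ball R(1)]
    have Qd: "((\<lambda>z. poly Q z) has_field_derivative poly q z) (at z)" using poly_DERIV[of Q z] Q by simp
    show ?thesis
      unfolding y_def[abs_def]
      by (rule derivative_eq_intros H Qd S_deriv refl)+ (use R(3) in \<open>simp add: partial_logderiv_def field_simps\<close>)
  qed
  have y0: "y j 0 = 1" for j
  proof -
    have "S j 0 = 0" by (simp add: S_def power_0_left)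
    moreover have "hs j 0 = leading_coeff0" by (rule zero_free_part_at_0[OF rs_pos hs])
    ultimately show ?thesis using leading_coeff0_nonzero Q(2) by (simp add: y_def exp_minus)
  qed
  have y_lim: "(\<lambda>j. y j z) \<longlonglongrightarrow> 1" for z
  proof -
    obtain e where e: "e \<longlonglongrightarrow> 0" "eventually (\<lambda>j. \<forall>w. norm w \<le> norm z \<longrightarrow> norm (?P j w - poly q w) \<le> e j) sequentially"
      using q(1)[of "norm z"] by blast
    (* A logarithm of \<open>y j\<close> has derivative at most \<open>e j\<close> in the disc of radius \<open>\<bar>z\<bar>\<close>. *)
    have "eventually (\<lambda>j. \<exists>l. y j z = exp l \<and> norm l \<le> e j * norm z) sequentially"
      using e(2) ev[of "norm z + 1"]
    proof eventually_elim
      case (elim j)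
      have nz: "y j w \<noteq> 0" if "w \<in> ball 0 (rs j)" for w
        using hs[of j] that by (auto simp: y_def zero_free_part_def)
      have hol: "y j holomorphic_on ball 0 (rs j)"
        unfolding holomorphic_on_open[OF open_ball] by (intro ballI exI, rule y_deriv) simp
      obtain l where l: "l holomorphic_on ball 0 (rs j)" "\<And>w. w \<in> ball 0 (rs j) \<Longrightarrow> y j w = exp (l w)"
        by (rule contractible_imp_holomorphic_log[OF hol convex_imp_contractible[OF convex_ball] nz]) (assumption | rule that)+
      have ld: "(l has_field_derivative (?P j w - poly q w)) (at w)" if w: "w \<in> ball 0 (rs j)" for w
      proof -
        have d: "(l has_field_derivative deriv l w) (at w)" using holomorphic_derivI[OF l(1) open_ball w] .
        have "((\<lambda>w. exp (l w)) has_field_derivative exp (l w) * deriv l w) (at w)" by (rule DERIV_fun_exp[OF d])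
        moreover have "eventually (\<lambda>w. w \<in> ball 0 (rs j)) (nhds w)" using w by (intro eventually_nhds_in_open) auto
        hence "eventually (\<lambda>w. exp (l w) = y j w) (nhds w)" by eventually_elim (use l(2) in simp)
        ultimately have "(y j has_field_derivative y j w * deriv l w) (at w)"
          using DERIV_cong_ev[OF refl] l(2)[OF w] by force
        moreover have "(y j has_field_derivative y j w * (?P j w - poly q w)) (at w)" using w by (intro y_deriv) simp
        ultimately have "y j w * deriv l w = y j w * (?P j w - poly q w)" by (rule DERIV_unique)
        thus ?thesis using nz[OF w] d by simp
      qed
      have zin: "z \<in> ball 0 (rs j)" "0 \<in> ball 0 (rs j)" using elim rs_pos by auto
      have "norm (l z - l 0) \<le> e j * norm (z - 0)"
      proof (rule field_differentiable_bound[of "cball 0 (norm z)"])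
        fix w :: complex assume "w \<in> cball 0 (norm z)"
        thus "(l has_field_derivative ?P j w - poly q w) (at w within cball 0 (norm z))" "norm (?P j w - poly q w) \<le> e j"
          using elim by (auto intro!: DERIV_subset[OF ld])
      qed auto
      moreover have "y j z = exp (l z - l 0)"
        using l(2)[OF zin(1)] l(2)[OF zin(2)] y0[of j] by (simp add: exp_diff)
      ultimately show ?case by (intro exI[of _ "l z - l 0"]) simp
    qed
    then obtain l where l: "eventually (\<lambda>j. y j z = exp (l j) \<and> norm (l j) \<le> e j * norm z) sequentially"
      unfolding eventually_sequentially by metis
    have "(\<lambda>j. e j * norm z) \<longlonglongrightarrow> 0" using tendsto_mult_left_zero[OF e(1)] .
    moreover have "eventually (\<lambda>j. norm (l j) \<le> e j * norm z) sequentially" using l by eventually_elim simp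
    ultimately have "l \<longlonglongrightarrow> 0" by (metis Lim_null_comparison)
    hence "(\<lambda>j. exp (l j)) \<longlonglongrightarrow> exp 0" by (intro tendsto_intros)
    moreover have "eventually (\<lambda>j. exp (l j) = y j z) sequentially" using l by eventually_elim simp
    ultimately show ?thesis using Lim_transform_eventually by fastforce
  qed
  have "hadamard_factorization f Q"
    unfolding hadamard_factorization_def prim_genus_def[symmetric]
  proof
    fix s
    let ?A = "s powi zorder f 0 * exp (poly Q s)"
    obtain L where L: "((\<lambda>X. \<Prod>\<rho>\<in>X. ?E s \<rho>) \<longlongrightarrow> L) (finite_subsets_at_top D0)"
      using canonical_product_converges by blast
    have "(\<lambda>j. ?A * (\<Prod>\<rho>\<in>divisor_disc (rs j). ?E s \<rho>)) \<longlonglongrightarrow> ?A * L"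
      by (intro tendsto_mult tendsto_const filterlim_compose[OF L filterlim_divisor_disc[OF rs(1)]])
    hence "(\<lambda>j. ?A * (\<Prod>\<rho>\<in>divisor_disc (rs j). ?E s \<rho>) * y j s) \<longlonglongrightarrow> ?A * L * 1"
      by (rule tendsto_mult[OF _ y_lim])
    moreover have "eventually (\<lambda>j. ?A * (\<Prod>\<rho>\<in>divisor_disc (rs j). ?E s \<rho>) * y j s = f s) sequentially"
      using ev[of "norm s"]
    proof eventually_elim
      case (elim j)
      have sR: "s \<in> ball 0 (Rs j)" using hs[of j] elim by (auto simp: zero_free_part_def)
      have "(\<Prod>\<rho>\<in>divisor_disc (rs j). ?E s \<rho>) =
          (\<Prod>\<rho>\<in>divisor_disc (rs j). (1 - s / \<rho>) powi zorder f \<rho> *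
             exp (of_int (zorder f \<rho>) * (\<Sum>k=1..prim_genus. (s / \<rho>) ^ k / of_nat k)))"
        unfolding weierstrass_factor_def power_int_mult_distrib by (simp add: exp_power_int mult.commute)
      also have "\<dots> = (\<Prod>\<rho>\<in>divisor_disc (rs j). (1 - s / \<rho>) powi zorder f \<rho>) * exp (S j s)"
        unfolding S_def by (simp add: prod.distrib exp_sum finite_divisor_disc)
      finally have "?A * (\<Prod>\<rho>\<in>divisor_disc (rs j). ?E s \<rho>) * y j s =
          (s powi zorder f 0 * hs j s * (\<Prod>\<rho>\<in>divisor_disc (rs j). (1 - s / \<rho>) powi zorder f \<rho>)) *
          (exp (poly Q s) * exp (- poly Q s)) * (exp (S j s) * exp (- S j s))"
        unfolding y_def by (simp only: mult_ac)
      also have "\<dots> = f s"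
        using hs[of j] sR by (simp add: zero_free_part_def exp_minus)
      finally show ?case .
    qed
    ultimately have "(\<lambda>j. f s) \<longlonglongrightarrow> ?A * L * 1" by (rule Lim_transform_eventually)
    hence "f s = ?A * L * 1" by (rule LIMSEQ_unique[OF tendsto_const])
    thus "((\<lambda>X. ?A * (\<Prod>\<rho>\<in>X. ?E s \<rho>)) \<longlongrightarrow> f s) (finite_subsets_at_top D0)"
      using tendsto_mult[OF tendsto_const L] by simp
  qed
  thus ?thesis using that q(2) Q(1) by blast
qed

text \<open>
  Two such polynomials have \<open>exp (Q1 - Q2) = 1\<close> off the divisor, so \<open>Q1 - Q2\<close> is constant.
\<close>

lemma hadamard_factorization_unique_degree:
  assumes "hadamard_factorization f Q1" "hadamard_factorization f Q2"
  shows "degree Q1 = degree Q2"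
proof -
  let ?U = "ball 0 1 - (divisor_supp f \<inter> cball 0 1)"
  define P where "P = Q1 - Q2"
  have eq: "exp (poly P s) = 1" if s: "s \<in> ?U" for s
  proof -
    define A where "A X = s powi zorder f 0 * (\<Prod>\<rho>\<in>X. weierstrass_factor (conv_exponent f - 1) (s / \<rho>) powi zorder f \<rho>)" for X
    have lim: "((\<lambda>X. exp (poly Q s) * A X) \<longlongrightarrow> f s) (finite_subsets_at_top D0)" if "hadamard_factorization f Q" for Q
      using that unfolding hadamard_factorization_def A_def by (simp add: mult_ac)
    have "((\<lambda>X. exp (poly P s) * (exp (poly Q2 s) * A X)) \<longlongrightarrow> exp (poly P s) * f s) (finite_subsets_at_top D0)"
      by (rule tendsto_mult[OF tendsto_const lim[OF assms(2)]])
    moreover have "(\<lambda>X. exp (poly P s) * (exp (poly Q2 s) * A X)) = (\<lambda>X. exp (poly Q1 s) * A X)"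
      by (simp add: P_def exp_diff)
    ultimately have "exp (poly P s) * f s = f s"
      by (intro tendsto_unique[OF finite_subsets_at_top_neq_bot _ lim[OF assms(1)]]) (simp only:)
    moreover have "f s \<noteq> 0" using s by (auto simp: divisor_supp_eq)
    ultimately show ?thesis by simp
  qed
  have "pderiv P = 0"
  proof (rule ccontr)
    assume "pderiv P \<noteq> 0"
    hence fin: "finite {s. poly (pderiv P) s = 0}" by (rule poly_roots_finite)
    have opn: "open ?U" by (intro open_Diff open_ball finite_imp_closed finite_divisor)
    have "poly (pderiv P) s = 0" if s: "s \<in> ?U" for s
    proof -
      have "((\<lambda>s. exp (poly P s)) has_field_derivative exp (poly P s) * poly (pderiv P) s) (at s)"
        by (rule DERIV_fun_exp[OF poly_DERIV])
      moreover have "eventually (\<lambda>s. s \<in> ?U) (nhds s)" using s opn by (intro eventually_nhds_in_open)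
      hence "eventually (\<lambda>s. exp (poly P s) = 1) (nhds s)" by eventually_elim (rule eq)
      ultimately have "((\<lambda>s. 1) has_field_derivative exp (poly P s) * poly (pderiv P) s) (at s)"
        using DERIV_cong_ev[OF refl] by force
      hence "exp (poly P s) * poly (pderiv P) s = 0" using DERIV_unique DERIV_const by blast
      thus ?thesis by simp
    qed
    hence "ball 0 1 - divisor_supp f - {0} \<subseteq> {s. poly (pderiv P) s = 0}" by auto
    thus False using infinite_off_divisor finite_subset[OF _ fin] by blast
  qed
  hence "pderiv Q1 = pderiv Q2" by (simp add: P_def pderiv_diff)
  hence "degree Q1 = 0 \<longleftrightarrow> degree Q2 = 0" "degree Q1 - 1 = degree Q2 - 1"
    using pderiv_eq_0_iff[of Q1] pderiv_eq_0_iff[of Q2] degree_pderiv[of Q1] degree_pderiv[of Q2] by simp_all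
  thus ?thesis by linarith
qed

lemma weierstrass_genus_eq:
  assumes "hadamard_factorization f Q"
  shows "weierstrass_genus f = int (degree Q)"
  unfolding weierstrass_genus_def
proof (rule the_equality)
  fix g assume "\<exists>Q. hadamard_factorization f Q \<and> g = int (degree Q)"
  then obtain Q' where Q': "hadamard_factorization f Q'" "g = int (degree Q')" by blast
  thus "g = int (degree Q)" using hadamard_factorization_unique_degree[OF Q'(1) assms] by simp
qed (use assms in blast)

end

section \<open>Test functions and Fourier inversion\<close>

abbreviation iter_deriv :: "nat \<Rightarrow> (real \<Rightarrow> complex) \<Rightarrow> real \<Rightarrow> complex" where
  "iter_deriv n \<equiv> vderiv ^^ n"

lemma test_function_has_vderiv:
  assumes "test_function \<phi>"
  shows "(\<phi> has_vector_derivative vderiv \<phi> t) (at t)"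
proof -
  have "(vderiv ^^ 0) \<phi> differentiable (at t)" using assms unfolding test_function_def by blast
  thus ?thesis by (simp add: vderiv_def vector_derivative_works)
qed

lemma test_function_continuous: "test_function \<phi> \<Longrightarrow> continuous_on A \<phi>"
  by (meson continuous_at_imp_continuous_on has_vector_derivative_continuous test_function_has_vderiv)

lemma test_function_support:
  assumes "test_function \<phi>"
  obtains M where "M > 0" "\<And>t. \<bar>t\<bar> > M \<Longrightarrow> \<phi> t = 0"
proof -
  obtain K where K: "compact K" "\<And>t. t \<notin> K \<Longrightarrow> \<phi> t = 0" using assms by (auto simp: test_function_def)
  obtain B where B: "\<And>t. t \<in> K \<Longrightarrow> norm t \<le> B" using compact_imp_bounded[OF K(1)] by (auto simp: bounded_iff)
  show ?thesis
  proof (rule that[of "max B 1"])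
    show "\<phi> t = 0" if "\<bar>t\<bar> > max B 1" for t using B[of t] that by (intro K(2)) auto
  qed auto
qed

lemma vderiv_zero_outside:
  assumes "\<And>t. \<bar>t\<bar> > M \<Longrightarrow> \<phi> t = 0" "\<bar>t\<bar> > M"
  shows "vderiv \<phi> t = 0"
proof -
  have "open {t::real. \<bar>t\<bar> > M}" by (intro open_Collect_less continuous_intros)
  hence "eventually (\<lambda>u. u \<in> {t. \<bar>t\<bar> > M}) (nhds t)" using assms(2) by (intro eventually_nhds_in_open) auto
  hence "eventually (\<lambda>u. \<phi> u = 0) (nhds t)" by eventually_elim (use assms(1) in auto)
  hence "(\<phi> has_vector_derivative 0) (at t) \<longleftrightarrow> ((\<lambda>_. 0) has_vector_derivative (0::complex)) (at t)"
    by (intro has_vector_derivative_cong_ev) (auto intro: eventually_mono dest: eventually_nhds_x_imp_x simp: eventually_at_filter)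
  hence "(\<phi> has_vector_derivative 0) (at t)" by simp
  thus ?thesis unfolding vderiv_def by (rule vector_derivative_at)
qed

lemma test_function_vderiv:
  assumes "test_function \<phi>"
  shows "test_function (vderiv \<phi>)"
  unfolding test_function_def
proof (intro conjI allI)
  fix n t
  have "(vderiv ^^ Suc n) \<phi> differentiable (at t)" using assms unfolding test_function_def by blast
  thus "(vderiv ^^ n) (vderiv \<phi>) differentiable (at t)" by (simp only: funpow_Suc_right o_apply)
next
  obtain M where M: "M > 0" "\<And>t. \<bar>t\<bar> > M \<Longrightarrow> \<phi> t = 0" by (rule test_function_support[OF assms]) (rule that)
  show "\<exists>K. compact K \<and> (\<forall>t. t \<notin> K \<longrightarrow> vderiv \<phi> t = 0)"
  proof (intro exI[of _ "{-M..M}"] conjI allI impI)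
    show "vderiv \<phi> t = 0" if "t \<notin> {-M..M}" for t
      by (rule vderiv_zero_outside[OF M(2)]) (use that in auto)
  qed auto
qed

lemma test_function_iter_deriv: "test_function \<phi> \<Longrightarrow> test_function (iter_deriv n \<phi>)"
  by (induction n) (auto intro: test_function_vderiv)

lemma integrable_continuous_compact_support:
  fixes h :: "real \<Rightarrow> complex"
  assumes "continuous_on UNIV h" "\<And>t. \<bar>t\<bar> > M \<Longrightarrow> h t = 0"
  shows "integrable lborel h"
proof -
  have "integrable lborel (\<lambda>x. indicator {-M..M} x *\<^sub>R h x)"
    by (rule borel_integrable_compact) (auto intro: continuous_on_subset[OF assms(1)])
  moreover have "(\<lambda>x. indicator {-M..M} x *\<^sub>R h x) = h"
    using assms(2) by (auto simp: indicator_def fun_eq_iff)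
  ultimately show ?thesis by simp
qed

lemma integrable_mult_test_function:
  assumes "continuous_on UNIV g" "test_function \<phi>"
  shows "integrable lborel (\<lambda>t. g t * \<phi> t)"
proof -
  obtain M where M: "M > 0" "\<And>t. \<bar>t\<bar> > M \<Longrightarrow> \<phi> t = 0" by (rule test_function_support[OF assms(2)]) (rule that)
  show ?thesis
    by (rule integrable_continuous_compact_support[of _ M])
       (use M in \<open>auto intro!: continuous_intros assms(1) test_function_continuous[OF assms(2)]\<close>)
qed

lemma integral_derivative_compact_support:
  fixes F :: "real \<Rightarrow> complex"
  assumes F: "\<And>t. (F has_vector_derivative f t) (at t)" and c: "continuous_on UNIV f"
    and z: "\<And>t. \<bar>t\<bar> > M \<Longrightarrow> F t = 0" "\<And>t. \<bar>t\<bar> > M \<Longrightarrow> f t = 0"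
  shows "(LINT t|lborel. f t) = 0"
proof -
  define N where "N = max M 0 + 1"
  have N: "N > 0" "N > M" by (auto simp: N_def)
  have "(LINT t|lborel. indicator {-N..N} t *\<^sub>R f t) = F N - F (-N)"
    by (rule integral_FTC_Icc) (use N in \<open>auto intro: has_vector_derivative_at_within F continuous_on_subset[OF c]\<close>)
  also have "\<dots> = 0" using N z(1)[of N] z(1)[of "-N"] by simp
  also have "(\<lambda>t. indicator {-N..N} t *\<^sub>R f t) = f"
    using z(2) N by (auto simp: indicator_def fun_eq_iff)
  finally show ?thesis by simp
qed

lemma integration_by_parts_test_function:
  assumes g: "\<And>t. (g has_vector_derivative g' t) (at t)" and c: "continuous_on UNIV g'" and \<phi>: "test_function \<phi>"
  shows "(LINT t|lborel. g t * vderiv \<phi> t) = - (LINT t|lborel. g' t * \<phi> t)"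
proof -
  have cg: "continuous_on UNIV g"
    by (meson continuous_at_imp_continuous_on g has_vector_derivative_continuous)
  obtain M where M: "M > 0" "\<And>t. \<bar>t\<bar> > M \<Longrightarrow> \<phi> t = 0" by (rule test_function_support[OF \<phi>]) (rule that)
  have "(LINT t|lborel. g t * vderiv \<phi> t + g' t * \<phi> t) = 0"
  proof (rule integral_derivative_compact_support[where F = "\<lambda>t. g t * \<phi> t" and M = M])
    show "((\<lambda>t. g t * \<phi> t) has_vector_derivative g t * vderiv \<phi> t + g' t * \<phi> t) (at t)" for t
      by (rule has_vector_derivative_mult[OF g test_function_has_vderiv[OF \<phi>]])
    show "continuous_on UNIV (\<lambda>t. g t * vderiv \<phi> t + g' t * \<phi> t)"
      by (intro continuous_intros cg c test_function_continuous test_function_vderiv \<phi>)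
    show "g t * vderiv \<phi> t + g' t * \<phi> t = 0" if "\<bar>t\<bar> > M" for t
      using vderiv_zero_outside[of M \<phi>, OF M(2) that] M(2)[OF that] by simp
  qed (use M in auto)
  moreover have "(LINT t|lborel. g t * vderiv \<phi> t + g' t * \<phi> t) = (LINT t|lborel. g t * vderiv \<phi> t) + (LINT t|lborel. g' t * \<phi> t)"
    by (intro Bochner_Integration.integral_add integrable_mult_test_function cg c \<phi> test_function_vderiv)
  ultimately show ?thesis by (simp add: add_eq_0_iff2)
qed

text \<open>
  The two-sided Laplace transform of \<open>\<phi>\<close> at \<open>- s\<close>; on the line \<open>Re s = c\<close> it is the Fourier transform of
  \<open>exp (c t) \<phi> t\<close>.
\<close>

definition exp_transform :: "(real \<Rightarrow> complex) \<Rightarrow> complex \<Rightarrow> complex" where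
  "exp_transform \<phi> s = (LINT t|lborel. exp (s * of_real t) * \<phi> t)"

lemma exp_has_vector_derivative:
  "((\<lambda>t. exp (s * complex_of_real t)) has_vector_derivative s * exp (s * of_real t)) (at t)"
  using exp_scaleR_has_vector_derivative_right[of s t UNIV] by (simp add: scaleR_conv_of_real mult.commute)

lemma exp_transform_vderiv:
  assumes "test_function \<phi>"
  shows "exp_transform (vderiv \<phi>) s = - s * exp_transform \<phi> s"
proof -
  have "exp_transform (vderiv \<phi>) s = - (LINT t|lborel. s * exp (s * of_real t) * \<phi> t)"
    unfolding exp_transform_def
    by (rule integration_by_parts_test_function[OF exp_has_vector_derivative _ assms]) (intro continuous_intros)
  thus ?thesis by (simp add: exp_transform_def mult.assoc)
qed

lemma exp_transform_iter_deriv: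
  assumes "test_function \<phi>"
  shows "exp_transform (iter_deriv n \<phi>) s = (- s) ^ n * exp_transform \<phi> s"
  by (induction n) (simp_all add: exp_transform_vderiv test_function_iter_deriv assms)

lemma norm_exp_transform_le:
  assumes "test_function \<phi>"
  shows "norm (exp_transform \<phi> s) \<le> (LINT t|lborel. exp (Re s * t) * norm (\<phi> t))"
proof -
  have "norm (exp_transform \<phi> s) \<le> (LINT t|lborel. norm (exp (s * of_real t) * \<phi> t))"
    unfolding exp_transform_def by (rule integral_norm_bound)
  thus ?thesis by (simp add: norm_mult)
qed

lemma exp_transform_Complex:
  "exp_transform \<phi> (Complex c u) = (LINT t|lborel. iexp (u * t) * (exp (of_real (c * t)) * \<phi> t))"
proof -
  have "exp (Complex c u * of_real t) = iexp (u * t) * exp (of_real (c * t))" for t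
    by (simp add: Complex_eq algebra_simps flip: exp_add)
  thus ?thesis unfolding exp_transform_def by (simp add: mult.assoc)
qed

lemma integrable_exp_mult_test_function:
  "test_function \<phi> \<Longrightarrow> integrable lborel (\<lambda>t. exp (of_real (c * t)) * \<phi> t)"
  by (intro integrable_mult_test_function continuous_intros)

lemma measurable_exp_transform [measurable]:
  assumes "test_function \<phi>"
  shows "(\<lambda>u. exp_transform \<phi> (Complex c u)) \<in> borel_measurable borel"
proof -
  have [measurable]: "\<phi> \<in> borel_measurable borel"
    by (rule borel_measurable_continuous_onI[OF test_function_continuous[OF assms]])
  show ?thesis unfolding exp_transform_Complex by measurable
qed

lemma integrable_inverse_sum_squares:
  assumes "c > 0"
  shows "integrable lborel (\<lambda>u::real. 1 / (c\<^sup>2 + u\<^sup>2))"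
proof -
  have "integrable lborel (\<lambda>x::real. inverse (1 + x^2))"
    using integrable_inverse_1_plus_square by (simp add: set_integrable_def)
  hence "integrable lborel (\<lambda>x::real. inverse (1 + (0 + (1 / c) * x)^2))"
    by (subst lborel_integrable_real_affine_iff) (use assms in auto)
  hence "integrable lborel (\<lambda>x::real. (1 / c\<^sup>2) * inverse (1 + (0 + (1 / c) * x)^2))"
    by (rule integrable_mult_right)
  moreover have "(1 / c\<^sup>2) * inverse (1 + (0 + (1 / c) * x)^2) = 1 / (c\<^sup>2 + x\<^sup>2)" for x
  proof -
    have "1 + (0 + (1 / c) * x)^2 = (c\<^sup>2 + x\<^sup>2) / c\<^sup>2" using assms by (simp add: power_divide field_simps)
    thus ?thesis using assms by simp
  qed
  ultimately show ?thesis by simp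
qed

lemma norm_Complex_sq: "norm (Complex c u) ^ 2 = c\<^sup>2 + u\<^sup>2"
  by (simp add: cmod_power2)

text \<open>
  Integration by parts \<open>k + 2\<close> times.
\<close>

lemma exp_transform_decay:
  assumes \<phi>: "test_function \<phi>" and c: "c > 0"
  obtains C where "C \<ge> 0" "\<And>u. norm (Complex c u) ^ k * norm (exp_transform \<phi> (Complex c u)) \<le> C / (c\<^sup>2 + u\<^sup>2)"
proof
  let ?C = "LINT t|lborel. exp (c * t) * norm (iter_deriv (k + 2) \<phi> t)"
  show "?C \<ge> 0" by (intro Bochner_Integration.integral_nonneg) auto
  fix u
  have "norm (exp_transform (iter_deriv (k + 2) \<phi>) (Complex c u)) \<le> ?C"
    using norm_exp_transform_le[OF test_function_iter_deriv[OF \<phi>], of "k + 2" "Complex c u"] by simp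
  hence "norm (Complex c u) ^ (k + 2) * norm (exp_transform \<phi> (Complex c u)) \<le> ?C"
    by (simp only: exp_transform_iter_deriv[OF \<phi>] norm_mult norm_power norm_minus_cancel)
  hence "(c\<^sup>2 + u\<^sup>2) * (norm (Complex c u) ^ k * norm (exp_transform \<phi> (Complex c u))) \<le> ?C"
    by (simp only: power_add norm_Complex_sq mult_ac)
  moreover have "c\<^sup>2 + u\<^sup>2 > 0" using c by (simp add: sum_power2_gt_zero_iff)
  ultimately show "norm (Complex c u) ^ k * norm (exp_transform \<phi> (Complex c u)) \<le> ?C / (c\<^sup>2 + u\<^sup>2)"
    by (simp add: pos_le_divide_eq mult.commute)
qed

lemma integrable_exp_transform_bounded:
  assumes \<phi>: "test_function \<phi>" and c: "c > 0" and F [measurable]: "F \<in> borel_measurable borel"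
    and bd: "\<And>u. norm (F u) \<le> B * norm (Complex c u) ^ k"
  shows "integrable lborel (\<lambda>u. F u * exp_transform \<phi> (Complex c u))"
proof -
  obtain C where C: "C \<ge> 0" "\<And>u. norm (Complex c u) ^ k * norm (exp_transform \<phi> (Complex c u)) \<le> C / (c\<^sup>2 + u\<^sup>2)"
    by (rule exp_transform_decay[OF \<phi> c]) (rule that)
  have [measurable]: "(\<lambda>u. exp_transform \<phi> (Complex c u)) \<in> borel_measurable borel"
    by (rule measurable_exp_transform[OF \<phi>])
  show ?thesis
  proof (rule Bochner_Integration.integrable_bound)
    show "integrable lborel (\<lambda>u. \<bar>B\<bar> * C * (1 / (c\<^sup>2 + u\<^sup>2)))"
      by (intro integrable_mult_right integrable_inverse_sum_squares c)
    show "AE u in lborel. norm (F u * exp_transform \<phi> (Complex c u)) \<le> norm (\<bar>B\<bar> * C * (1 / (c\<^sup>2 + u\<^sup>2)))"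
    proof (intro AE_I2)
      fix u
      have "norm (F u) \<le> \<bar>B\<bar> * norm (Complex c u) ^ k"
        by (rule order_trans[OF bd]) (intro mult_right_mono, auto)
      hence "norm (F u * exp_transform \<phi> (Complex c u)) \<le> \<bar>B\<bar> * norm (Complex c u) ^ k * norm (exp_transform \<phi> (Complex c u))"
        unfolding norm_mult by (rule mult_right_mono) simp
      also have "\<dots> \<le> \<bar>B\<bar> * (C / (c\<^sup>2 + u\<^sup>2))"
        unfolding mult.assoc by (intro mult_left_mono C) auto
      finally show "norm (F u * exp_transform \<phi> (Complex c u)) \<le> norm (\<bar>B\<bar> * C * (1 / (c\<^sup>2 + u\<^sup>2)))"
        using C(1) by (simp add: abs_mult)
    qed
  qed simp
qed

text \<open>
  A bounded kernel between two integrable functions leaves the double integral absolutely convergent.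
\<close>

lemma Fubini_bounded_kernel:
  fixes a b :: "real \<Rightarrow> complex"
  assumes a: "integrable lborel a" and b: "integrable lborel b"
    and [measurable]: "case_prod K \<in> borel_measurable (lborel \<Otimes>\<^sub>M lborel)" and K: "\<And>u t. norm (K u t) \<le> 1"
  shows "(LINT t|lborel. (LINT u|lborel. a u * K u t) * b t) = (LINT u|lborel. a u * (LINT t|lborel. K u t * b t))"
proof -
  have [measurable]: "a \<in> borel_measurable borel" "b \<in> borel_measurable borel" using a b by auto
  have Km [measurable]: "K u \<in> borel_measurable borel" for u by measurable
  have Kb: "integrable lborel (\<lambda>t. K u t * b t)" for u
    by (rule Bochner_Integration.integrable_bound[OF b]) (auto simp: norm_mult K intro!: mult_left_le_one_le)
  have int: "integrable (lborel \<Otimes>\<^sub>M lborel) (\<lambda>(u, t). a u * K u t * b t)"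
  proof (rule lborel_pair.Fubini_integrable)
    show "(\<lambda>(u, t). a u * K u t * b t) \<in> borel_measurable (lborel \<Otimes>\<^sub>M lborel)" by measurable
    show "integrable lborel (\<lambda>x. LINT y|lborel. norm (case (x, y) of (u, t) \<Rightarrow> a u * K u t * b t))"
    proof (rule Bochner_Integration.integrable_bound)
      show "integrable lborel (\<lambda>u. norm (a u) * (LINT t|lborel. norm (b t)))" using a by (intro integrable_mult_left integrable_norm)
      show "AE u in lborel. norm (LINT y|lborel. norm (case (u, y) of (u, t) \<Rightarrow> a u * K u t * b t)) \<le> norm (norm (a u) * (LINT t|lborel. norm (b t)))"
      proof (intro AE_I2)
        fix u
        have "(LINT y|lborel. norm (a u * K u y * b y)) = norm (a u) * (LINT y|lborel. norm (K u y * b y))"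
          by (simp add: norm_mult mult.assoc)
        also have "\<dots> \<le> norm (a u) * (LINT t|lborel. norm (b t))"
          using Kb[of u] b by (intro mult_left_mono integral_mono integrable_norm) (auto simp: norm_mult K intro!: mult_left_le_one_le)
        finally show "norm (LINT y|lborel. norm (case (u, y) of (u, t) \<Rightarrow> a u * K u t * b t)) \<le> norm (norm (a u) * (LINT t|lborel. norm (b t)))"
          by (simp add: abs_mult)
      qed
    qed measurable
    show "AE x in lborel. integrable lborel (\<lambda>y. case (x, y) of (u, t) \<Rightarrow> a u * K u t * b t)"
    proof (intro AE_I2)
      fix u
      have "integrable lborel (\<lambda>t. a u * (K u t * b t))" by (intro integrable_mult_right Kb)
      thus "integrable lborel (\<lambda>y. case (u, y) of (u, t) \<Rightarrow> a u * K u t * b t)" by (simp add: mult.assoc)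
    qed
  qed
  have "(LINT t|lborel. LINT u|lborel. a u * K u t * b t) = (LINT u|lborel. LINT t|lborel. a u * K u t * b t)"
    by (rule lborel_pair.Fubini_integral[OF int])
  thus ?thesis by (simp add: mult.assoc flip: integral_mult_left_zero)
qed

lemma Fubini_oscillating:
  fixes a b :: "real \<Rightarrow> complex"
  assumes a: "integrable lborel a" and b: "integrable lborel b"
  shows "(LINT t|lborel. (LINT u|lborel. a u * iexp (u * t)) * b t) = (LINT u|lborel. a u * (LINT t|lborel. iexp (u * t) * b t))"
  by (rule Fubini_bounded_kernel[OF a b]) simp_all

text \<open>
  The characteristic function of the normal distribution, rescaled.
\<close>

lemma gaussian_fourier:
  assumes "\<epsilon> > 0"
  shows "(LINT u|lborel. of_real (exp (- (\<epsilon> * u)\<^sup>2 / 2)) * iexp (u * \<tau>)) = of_real (sqrt (2 * pi) / \<epsilon> * exp (- (\<tau> / \<epsilon>)\<^sup>2 / 2))"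
proof -
  have "(LINT v|lborel. std_normal_density v *\<^sub>R iexp (\<tau> / \<epsilon> * v)) = char std_normal_distribution (\<tau> / \<epsilon>)"
    unfolding char_def by (subst integral_density) auto
  also have "\<dots> = of_real (exp (- (\<tau> / \<epsilon>)\<^sup>2 / 2))" by (simp add: char_std_normal_distribution)
  finally have 1: "(LINT v|lborel. std_normal_density v *\<^sub>R iexp (\<tau> / \<epsilon> * v)) = of_real (exp (- (\<tau> / \<epsilon>)\<^sup>2 / 2))" .
  have "(LINT u|lborel. of_real (exp (- (\<epsilon> * u)\<^sup>2 / 2)) * iexp (u * \<tau>)) =
     \<bar>1 / \<epsilon>\<bar> *\<^sub>R (LINT v|lborel. of_real (exp (- (\<epsilon> * (0 + (1 / \<epsilon>) * v))\<^sup>2 / 2)) * iexp ((0 + (1 / \<epsilon>) * v) * \<tau>))"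
    by (rule lborel_integral_real_affine) (use assms in simp)
  also have "(\<lambda>v. of_real (exp (- (\<epsilon> * (0 + (1 / \<epsilon>) * v))\<^sup>2 / 2)) * iexp ((0 + (1 / \<epsilon>) * v) * \<tau>)) =
     (\<lambda>v. of_real (sqrt (2 * pi)) * (std_normal_density v *\<^sub>R iexp (\<tau> / \<epsilon> * v)))"
    using assms by (auto simp: std_normal_density_def fun_eq_iff scaleR_conv_of_real mult_ac)
  also have "(LINT v|lborel. of_real (sqrt (2 * pi)) * (std_normal_density v *\<^sub>R iexp (\<tau> / \<epsilon> * v))) =
       of_real (sqrt (2 * pi)) * of_real (exp (- (\<tau> / \<epsilon>)\<^sup>2 / 2))"
    by (simp only: integral_mult_right_zero 1)
  finally show ?thesis using assms by (simp add: scaleR_conv_of_real)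
qed

text \<open>
  Inserting the factor \<open>exp (- (\<epsilon> u)\<^sup>2 / 2)\<close> makes Fubini applicable and turns the double integral into the
  convolution of \<open>b\<close> with a normal density of width \<open>\<epsilon>\<close>; then \<open>\<epsilon> \<rightarrow> 0\<close> on both sides.
\<close>

lemma fourier_inversion:
  fixes b :: "real \<Rightarrow> complex"
  assumes cont: "continuous_on UNIV b" and supp: "\<And>t. \<bar>t\<bar> > M \<Longrightarrow> b t = 0"
    and int: "integrable lborel (\<lambda>u. LINT t|lborel. iexp (u * t) * b t)"
  shows "(LINT u|lborel. iexp (- (u * x)) * (LINT t|lborel. iexp (u * t) * b t)) = 2 * of_real pi * b x"
proof -
  define B where "B u = (LINT t|lborel. iexp (u * t) * b t)" for u
  have intb: "integrable lborel b" by (rule integrable_continuous_compact_support[OF cont supp])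
  have [measurable]: "b \<in> borel_measurable borel" by (rule borel_measurable_continuous_onI[OF cont])
  have [measurable]: "B \<in> borel_measurable borel" using int by (auto simp: B_def[abs_def])
  obtain C where C: "\<And>t. norm (b t) \<le> C"
  proof -
    have "compact (b ` {-M..M})" by (intro compact_continuous_image continuous_on_subset[OF cont]) auto
    then obtain C where C: "\<And>y. y \<in> b ` {-M..M} \<Longrightarrow> norm y \<le> C" using compact_imp_bounded[of "b ` {-M..M}"] unfolding bounded_iff by blast
    have "norm (b t) \<le> max C 0" for t
    proof (cases "\<bar>t\<bar> > M")
      case True
      thus ?thesis using supp by simp
    next
      case False
      hence "b t \<in> b ` {-M..M}" by (intro imageI) auto
      from C[OF this] show ?thesis by (rule max.coboundedI1)
    qed
    thus ?thesis by (rule that)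
  qed
  define \<epsilon> where "\<epsilon> n = 1 / real (Suc n)" for n
  have \<epsilon>: "\<epsilon> n > 0" for n by (simp add: \<epsilon>_def)
  have \<epsilon>0: "\<epsilon> \<longlonglongrightarrow> 0" unfolding \<epsilon>_def[abs_def] using LIMSEQ_inverse_real_of_nat by (simp add: inverse_eq_divide)
  (* The substitution \<open>t = x + \<epsilon> y\<close> makes the normal density independent of \<open>\<epsilon>\<close>. *)
  have reg: "(LINT u|lborel. of_real (exp (- (\<epsilon> n * u)\<^sup>2 / 2)) * (iexp (- (u * x)) * B u)) =
       2 * of_real pi * (LINT y|lborel. std_normal_density y *\<^sub>R b (x + \<epsilon> n * y))" for n
  proof -
    let ?e = "\<epsilon> n"
    have inta: "integrable lborel (\<lambda>u. of_real (exp (- (?e * u)\<^sup>2 / 2)) * iexp (- (u * x)))"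
    proof -
      have "integrable lborel (\<lambda>u. sqrt (2 * pi) / ?e * normal_density 0 (1 / ?e) u)"
        by (intro integrable_mult_right integrable_normal_density) (use \<epsilon>[of n] in simp)
      hence "integrable lborel (\<lambda>u. exp (- (?e * u)\<^sup>2 / 2))"
        using \<epsilon>[of n] by (simp add: normal_density_def power_divide power_mult_distrib real_sqrt_divide real_sqrt_mult mult_ac)
      thus ?thesis by (rule Bochner_Integration.integrable_bound) (auto simp: norm_mult)
    qed
    have "(LINT u|lborel. of_real (exp (- (?e * u)\<^sup>2 / 2)) * (iexp (- (u * x)) * B u)) =
       (LINT u|lborel. (of_real (exp (- (?e * u)\<^sup>2 / 2)) * iexp (- (u * x))) * (LINT t|lborel. iexp (u * t) * b t))"
      by (simp add: B_def mult.assoc)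
    also have "\<dots> = (LINT t|lborel. (LINT u|lborel. of_real (exp (- (?e * u)\<^sup>2 / 2)) * iexp (- (u * x)) * iexp (u * t)) * b t)"
      by (rule Fubini_oscillating[OF inta intb, symmetric])
    also have "\<dots> = (LINT t|lborel. of_real (sqrt (2 * pi) / ?e * exp (- ((t - x) / ?e)\<^sup>2 / 2)) * b t)"
    proof (intro Bochner_Integration.integral_cong refl arg_cong2[where f = "(*)"])
      fix t
      have "of_real (exp (- (?e * u)\<^sup>2 / 2)) * iexp (- (u * x)) * iexp (u * t) = of_real (exp (- (?e * u)\<^sup>2 / 2)) * iexp (u * (t - x))" for u
        by (simp add: algebra_simps mult_exp_exp)
      thus "(LINT u|lborel. of_real (exp (- (?e * u)\<^sup>2 / 2)) * iexp (- (u * x)) * iexp (u * t)) =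
          of_real (sqrt (2 * pi) / ?e * exp (- ((t - x) / ?e)\<^sup>2 / 2))"
        by (simp only: gaussian_fourier[OF \<epsilon>])
    qed
    also have "\<dots> = \<bar>?e\<bar> *\<^sub>R (LINT y|lborel. of_real (sqrt (2 * pi) / ?e * exp (- ((x + ?e * y - x) / ?e)\<^sup>2 / 2)) * b (x + ?e * y))"
      by (rule lborel_integral_real_affine) (use \<epsilon>[of n] in simp)
    also have "\<dots> = (LINT y|lborel. (2 * of_real pi) * (std_normal_density y *\<^sub>R b (x + ?e * y)))"
    proof -
      have *: "?e *\<^sub>R (of_real (sqrt (2 * pi) / ?e * exp (- ((x + ?e * y - x) / ?e)\<^sup>2 / 2)) * b (x + ?e * y)) =
         (2 * of_real pi) * (std_normal_density y *\<^sub>R b (x + ?e * y))" for y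
      proof -
        have "2 * pi * std_normal_density y = (2 * pi / sqrt (2 * pi)) * exp (- y\<^sup>2 / 2)"
          by (simp add: std_normal_density_def)
        also have "2 * pi / sqrt (2 * pi) = sqrt (2 * pi)" by (rule real_div_sqrt) simp
        finally have "?e * (sqrt (2 * pi) / ?e * exp (- ((x + ?e * y - x) / ?e)\<^sup>2 / 2)) = 2 * pi * std_normal_density y"
          using \<epsilon>[of n] by simp
        hence "complex_of_real (?e * (sqrt (2 * pi) / ?e * exp (- ((x + ?e * y - x) / ?e)\<^sup>2 / 2))) = of_real (2 * pi * std_normal_density y)"
          by (simp only:)
        thus ?thesis by (simp only: scaleR_conv_of_real mult.assoc[symmetric] of_real_mult of_real_numeral)
      qed
      show ?thesis using \<epsilon>[of n] by (simp only: * abs_of_pos flip: integral_scaleR_right)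
    qed
    also have "\<dots> = 2 * of_real pi * (LINT y|lborel. std_normal_density y *\<^sub>R b (x + ?e * y))"
      by (rule integral_mult_right_zero)
    finally show ?thesis .
  qed
  have lim1: "(\<lambda>n. LINT u|lborel. of_real (exp (- (\<epsilon> n * u)\<^sup>2 / 2)) * (iexp (- (u * x)) * B u))
      \<longlonglongrightarrow> (LINT u|lborel. iexp (- (u * x)) * B u)"
  proof (rule integral_dominated_convergence[where w = "\<lambda>u. norm (B u)"])
    show "AE u in lborel. (\<lambda>n. of_real (exp (- (\<epsilon> n * u)\<^sup>2 / 2)) * (iexp (- (u * x)) * B u)) \<longlonglongrightarrow> iexp (- (u * x)) * B u"
    proof (intro AE_I2)
      fix u
      have "(\<lambda>n. of_real (exp (- (\<epsilon> n * u)\<^sup>2 / 2)) * (iexp (- (u * x)) * B u)) \<longlonglongrightarrow> of_real (exp (- (0 * u)\<^sup>2 / 2)) * (iexp (- (u * x)) * B u)"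
        by (intro tendsto_intros \<epsilon>0) auto
      thus "(\<lambda>n. of_real (exp (- (\<epsilon> n * u)\<^sup>2 / 2)) * (iexp (- (u * x)) * B u)) \<longlonglongrightarrow> iexp (- (u * x)) * B u" by simp
    qed
    show "AE u in lborel. norm (of_real (exp (- (\<epsilon> n * u)\<^sup>2 / 2)) * (iexp (- (u * x)) * B u)) \<le> norm (B u)" for n
      by (intro AE_I2) (simp add: norm_mult mult_left_le_one_le)
    show "integrable lborel (\<lambda>u. norm (B u))" using int by (simp add: B_def[abs_def] integrable_norm)
  qed auto
  have lim2: "(\<lambda>n. LINT y|lborel. std_normal_density y *\<^sub>R b (x + \<epsilon> n * y)) \<longlonglongrightarrow> (LINT y|lborel. std_normal_density y *\<^sub>R b x)"
  proof (rule integral_dominated_convergence[where w = "\<lambda>y. std_normal_density y * C"])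
    show "AE y in lborel. (\<lambda>n. std_normal_density y *\<^sub>R b (x + \<epsilon> n * y)) \<longlonglongrightarrow> std_normal_density y *\<^sub>R b x"
    proof (intro AE_I2)
      fix y
      have "isCont b x" using cont by (simp add: continuous_on_eq_continuous_at)
      moreover have "(\<lambda>n. x + \<epsilon> n * y) \<longlonglongrightarrow> x + 0 * y" by (intro tendsto_intros \<epsilon>0)
      ultimately have "(\<lambda>n. b (x + \<epsilon> n * y)) \<longlonglongrightarrow> b x" using isCont_tendsto_compose by fastforce
      thus "(\<lambda>n. std_normal_density y *\<^sub>R b (x + \<epsilon> n * y)) \<longlonglongrightarrow> std_normal_density y *\<^sub>R b x" by (intro tendsto_intros)
    qed
    show "AE y in lborel. norm (std_normal_density y *\<^sub>R b (x + \<epsilon> n * y)) \<le> std_normal_density y * C" for n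
      by (intro AE_I2) (simp add: C mult_left_mono)
    show "integrable lborel (\<lambda>y. std_normal_density y * C)" by (intro integrable_mult_left integrable_normal_density) simp
  qed auto
  have "(LINT y|lborel. std_normal_density y *\<^sub>R b x) = b x"
    by (subst integral_scaleR_left) auto
  with lim2 have "(\<lambda>n. 2 * of_real pi * (LINT y|lborel. std_normal_density y *\<^sub>R b (x + \<epsilon> n * y))) \<longlonglongrightarrow> 2 * of_real pi * b x"
    by (intro tendsto_intros) auto
  hence "(\<lambda>n. LINT u|lborel. of_real (exp (- (\<epsilon> n * u)\<^sup>2 / 2)) * (iexp (- (u * x)) * B u)) \<longlonglongrightarrow> 2 * of_real pi * b x"
    by (simp only: reg)
  from LIMSEQ_unique[OF lim1 this] show ?thesis by (simp add: B_def)
qed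

lemma exp_transform_inversion:
  assumes \<phi>: "test_function \<phi>" and c: "c > 0"
  shows "(LINT u|lborel. exp (- (Complex c u * of_real x)) * exp_transform \<phi> (Complex c u)) = 2 * of_real pi * \<phi> x"
proof -
  obtain M where M: "M > 0" "\<And>t. \<bar>t\<bar> > M \<Longrightarrow> \<phi> t = 0" by (rule test_function_support[OF \<phi>]) (rule that)
  let ?b = "\<lambda>t. exp (of_real (c * t)) * \<phi> t"
  have int: "integrable lborel (\<lambda>u. 1 * exp_transform \<phi> (Complex c u))"
    by (rule integrable_exp_transform_bounded[OF \<phi> c, of _ 1 0]) auto
  have "(LINT u|lborel. iexp (- (u * x)) * (LINT t|lborel. iexp (u * t) * ?b t)) = 2 * of_real pi * ?b x"
    by (rule fourier_inversion[of _ M])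
       (use int M in \<open>auto intro!: continuous_intros test_function_continuous[OF \<phi>] simp: exp_transform_Complex\<close>)
  hence 1: "(LINT u|lborel. exp (- of_real (c * x)) * (iexp (- (u * x)) * exp_transform \<phi> (Complex c u))) = exp (- of_real (c * x)) * (2 * of_real pi * ?b x)"
    unfolding exp_transform_Complex by simp
  have 2: "exp (- of_real (c * x)) * (iexp (- (u * x)) * y) = exp (- (Complex c u * of_real x)) * y" for u y
  proof -
    have "exp (- of_real (c * x)) * iexp (- (u * x)) = exp (- (Complex c u * of_real x))"
      by (simp add: Complex_eq algebra_simps flip: exp_add)
    thus ?thesis by (simp only: mult.assoc[symmetric])
  qed
  have 3: "exp (- of_real (c * x)) * (2 * of_real pi * ?b x) = 2 * of_real pi * \<phi> x"
    by (simp add: exp_minus)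
  show ?thesis using 1 unfolding 2 3 .
qed

section \<open>The inverse Laplace transform as a pairing\<close>

lemma distr_deriv_iterate: "(distr_deriv ^^ n) T \<phi> = (-1) ^ n * T (iter_deriv n \<phi>)"
proof (induction n arbitrary: \<phi>)
  case (Suc n)
  have "(distr_deriv ^^ Suc n) T \<phi> = - (distr_deriv ^^ n) T (vderiv \<phi>)" by (simp add: distr_deriv_def)
  also have "\<dots> = (-1) ^ Suc n * T (iter_deriv (Suc n) \<phi>)" unfolding Suc.IH by (simp add: funpow_swap1)
  finally show ?case .
qed simp

lemma neg_one_power_cancel: "(-1) ^ n * ((-1) ^ n * x) = (x::complex)"
  by (cases "even n") auto

text \<open>
  The value that the inverse Laplace transform of \<open>F\<close>, taken along the line \<open>Re s = c\<close>, should have on \<open>\<phi>\<close>.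
  No division by a power of \<open>s\<close> and no distributional derivative appear, because the transform of \<open>\<phi>\<close> decays
  rapidly on the line.
\<close>

definition laplace_pairing :: "(complex \<Rightarrow> complex) \<Rightarrow> real \<Rightarrow> (real \<Rightarrow> complex) \<Rightarrow> complex" where
  "laplace_pairing F c \<phi> = 1 / (2 * of_real pi) * (LINT u|lborel. F (Complex c u) * exp_transform \<phi> (Complex c u))"

text \<open>
  By Fubini the distributional derivative of order \<open>n\<close> goes over to the test function, where it multiplies the
  transform by \<open>(- s) ^ n\<close> and cancels the denominator of the integrand.
\<close>

lemma inverse_laplace_eq_pairing:
  assumes "laplace_admissible F c0 n0"
  obtains c n where "laplace_admissible F c n" "\<And>\<phi>. test_function \<phi> \<Longrightarrow> inverse_laplace F \<phi> = laplace_pairing F c \<phi>"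
proof -
  obtain c n where cn: "(SOME (c, n). laplace_admissible F c n) = (c, n)" by fastforce
  have "case (SOME (c, n). laplace_admissible F c n) of (c, n) \<Rightarrow> laplace_admissible F c n"
    by (rule someI_ex[of "case_prod (laplace_admissible F)"]) (use assms in \<open>auto intro!: exI[of _ "(c0, n0)"]\<close>)
  hence adm: "laplace_admissible F c n" by (simp add: cn)
  have c: "c > 0" using adm by (auto simp: laplace_admissible_def)
  show ?thesis
  proof (rule that[OF adm])
    fix \<phi> assume \<phi>: "test_function \<phi>"
    let ?\<psi> = "iter_deriv n \<phi>"
    define a where "a u = F (Complex c u) / Complex c u ^ n" for u
    have int_a: "integrable lborel a"
    proof -
      have "integrable lborel (laplace_integrand F c n 0)" using adm by (auto simp: laplace_admissible_def)
      thus ?thesis by (simp add: laplace_integrand_def[abs_def] a_def[abs_def])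
    qed
    let ?b = "\<lambda>t. exp (of_real (c * t)) * ?\<psi> t"
    have int_b: "integrable lborel ?b" by (intro integrable_exp_mult_test_function test_function_iter_deriv \<phi>)
    have eq: "laplace_integrand F c n t u = a u * iexp (u * t) * exp (of_real (c * t))" for t u
    proof -
      have "exp (Complex c u * of_real t) = iexp (u * t) * exp (of_real (c * t))"
        by (simp add: Complex_eq algebra_simps flip: exp_add)
      thus ?thesis by (simp add: laplace_integrand_def a_def mult.assoc)
    qed
    have "inverse_laplace F \<phi> = 1 / (2 * of_real pi) * ((-1) ^ n * (LINT t|lborel. (LINT u|lborel. laplace_integrand F c n t u) * ?\<psi> t))"
      by (simp add: inverse_laplace_def cn distr_deriv_iterate distr_of_fun_def)
    also have "(LINT t|lborel. (LINT u|lborel. laplace_integrand F c n t u) * ?\<psi> t) = (LINT t|lborel. (LINT u|lborel. a u * iexp (u * t)) * ?b t)"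
      unfolding eq integral_mult_left_zero by (simp only: mult.assoc)
    also have "\<dots> = (LINT u|lborel. a u * (LINT t|lborel. iexp (u * t) * ?b t))"
      by (rule Fubini_oscillating[OF int_a int_b])
    also have "\<dots> = (LINT u|lborel. (-1) ^ n * (F (Complex c u) * exp_transform \<phi> (Complex c u)))"
    proof (intro Bochner_Integration.integral_cong refl)
      fix u
      have "Complex c u \<noteq> 0" using c by (auto simp: complex_eq_iff)
      moreover have "(LINT t|lborel. iexp (u * t) * ?b t) = (- Complex c u) ^ n * exp_transform \<phi> (Complex c u)"
        unfolding exp_transform_Complex[symmetric] exp_transform_iter_deriv[OF \<phi>] ..
      ultimately show "a u * (LINT t|lborel. iexp (u * t) * ?b t) = (-1) ^ n * (F (Complex c u) * exp_transform \<phi> (Complex c u))"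
        by (simp add: a_def power_minus[of "Complex c u"])
    qed
    also have "\<dots> = (-1) ^ n * (LINT u|lborel. F (Complex c u) * exp_transform \<phi> (Complex c u))"
      by (rule integral_mult_right_zero)
    finally show "inverse_laplace F \<phi> = laplace_pairing F c \<phi>"
      unfolding laplace_pairing_def neg_one_power_cancel .
  qed
qed

text \<open>
  The inverse Laplace transform of \<open>s ^ k\<close> is the \<open>k\<close>-th derivative of the Dirac mass at 0.
\<close>

lemma laplace_pairing_power:
  assumes \<phi>: "test_function \<phi>" and c: "c > 0"
  shows "laplace_pairing (\<lambda>s. s ^ k) c \<phi> = (-1) ^ k * iter_deriv k \<phi> 0"
proof -
  have "s ^ k * exp_transform \<phi> s = (-1) ^ k * exp_transform (iter_deriv k \<phi>) s" for s
    unfolding exp_transform_iter_deriv[OF \<phi>] power_minus[of s] mult.assoc neg_one_power_cancel ..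
  moreover have "(LINT u|lborel. exp_transform (iter_deriv k \<phi>) (Complex c u)) = 2 * of_real pi * iter_deriv k \<phi> 0"
    using exp_transform_inversion[OF test_function_iter_deriv[OF \<phi>, of k] c, of 0] by simp
  ultimately show ?thesis by (simp add: laplace_pairing_def)
qed

lemma laplace_exp_halfline:
  assumes w: "Re w > 0"
  shows "integrable lborel (\<lambda>t. indicator {0..} t *\<^sub>R exp (- (w * of_real t)))"
    and "(LINT t|lborel. indicator {0..} t *\<^sub>R exp (- (w * of_real t))) = 1 / w"
proof -
  let ?h = "\<lambda>t. indicator {0..} t *\<^sub>R exp (- (w * of_real t))"
  have "integrable lborel (\<lambda>x::real. exp (-x) * x ^ 0 * indicator {0..} x)"
    using has_bochner_integral_I0i_power_exp_m'[of 0] by (simp add: has_bochner_integral_iff)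
  hence "integrable lborel (\<lambda>x::real. exp (-(0 + Re w * x)) * indicator {0..} (0 + Re w * x))"
    by (subst lborel_integrable_real_affine_iff[where f = "\<lambda>x. exp (-x) * indicator {0..} x"]) (use w in auto)
  moreover have "exp (-(0 + Re w * x)) * indicator {0..} (0 + Re w * x) = norm (?h x)" for x :: real
    using w by (auto simp: indicator_def zero_le_mult_iff)
  ultimately have nh: "integrable lborel (\<lambda>t. norm (?h t))" by (simp only:)
  show int: "integrable lborel ?h" using nh by (subst (asm) integrable_norm_iff) auto
  have lim: "(\<lambda>n. LINT t|lborel. indicator {0..real n} t *\<^sub>R exp (- (w * of_real t))) \<longlonglongrightarrow> (LINT t|lborel. ?h t)"
  proof (rule integral_dominated_convergence[OF _ _ nh])
    show "AE t in lborel. (\<lambda>n. indicator {0..real n} t *\<^sub>R exp (- (w * of_real t))) \<longlonglongrightarrow> ?h t"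
    proof (intro AE_I2 tendsto_eventually)
      fix t :: real
      have "eventually (\<lambda>n. real n \<ge> t) sequentially"
        using filterlim_real_sequentially by (simp add: filterlim_at_top)
      thus "eventually (\<lambda>n. indicator {0..real n} t *\<^sub>R exp (- (w * of_real t)) = ?h t) sequentially"
        by eventually_elim (auto simp: indicator_def)
    qed
  qed (auto simp: indicator_def)
  moreover have "(LINT t|lborel. indicator {0..real n} t *\<^sub>R exp (- (w * of_real t))) = (1 - exp (- w) ^ n) / w" for n
  proof -
    have w0: "w \<noteq> 0" using w by auto
    have D: "((\<lambda>t. (- 1 / w) * exp (- w * of_real t)) has_vector_derivative exp (- (w * of_real t))) (at t within {0..real n})" for t
    proof -
      have "((\<lambda>t. (- 1 / w) * exp (- w * of_real t)) has_vector_derivative (- 1 / w) * (- w * exp (- w * of_real t))) (at t within {0..real n})"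
        by (rule has_vector_derivative_mult_right[OF has_vector_derivative_at_within[OF exp_has_vector_derivative]])
      moreover have "(- 1 / w) * (- w * exp (- w * of_real t)) = exp (- (w * of_real t))" using w0 by simp
      ultimately show ?thesis by (simp only:)
    qed
    have "(LINT t|lborel. indicator {0..real n} t *\<^sub>R exp (- (w * of_real t))) = (- 1 / w) * exp (- w * of_real (real n)) - (- 1 / w) * exp (- w * of_real 0)"
    proof (rule integral_FTC_Icc)
      show "continuous_on {0..real n} (\<lambda>t. exp (- (w * complex_of_real t)))" by (intro continuous_intros)
    qed (rule of_nat_0_le_iff, rule D)
    also have "exp (- w * of_real (real n)) = exp (- w) ^ n"
      using exp_of_nat_mult[of n "- w"] by (simp only: of_real_of_nat_eq mult.commute)
    finally show ?thesis by (simp add: diff_divide_distrib)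
  qed
  moreover have "(\<lambda>n. (1 - exp (- w) ^ n) / w) \<longlonglongrightarrow> (1 - 0) / w"
    using w by (intro tendsto_intros LIMSEQ_power_zero) auto
  ultimately have "(\<lambda>n. LINT t|lborel. indicator {0..real n} t *\<^sub>R exp (- (w * of_real t))) \<longlonglongrightarrow> 1 / w"
    by (simp only: diff_zero)
  from LIMSEQ_unique[OF lim this] show "(LINT t|lborel. ?h t) = 1 / w" .
qed

text \<open>
  The inverse Laplace transform of \<open>1 / (s - \<rho>)\<close> is the function \<open>exp (\<rho> t)\<close> on the half line: write the
  pole as the integral of \<open>exp (- (s - \<rho>) t)\<close> over \<open>t \<ge> 0\<close>, exchange the integrals, and use Fourier inversion.
\<close>

lemma laplace_pairing_pole:
  assumes \<phi>: "test_function \<phi>" and c: "c > 0" "Re \<rho> < c"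
  shows "laplace_pairing (\<lambda>s. 1 / (s - \<rho>)) c \<phi> = (LINT t|lborel. indicator {0..} t *\<^sub>R exp (\<rho> * of_real t) * \<phi> t)"
proof -
  let ?b = "\<lambda>t. indicator {0..} t *\<^sub>R exp (- ((of_real c - \<rho>) * of_real t))"
  have int_a: "integrable lborel (\<lambda>u. exp_transform \<phi> (Complex c u))"
    using integrable_exp_transform_bounded[OF \<phi> c(1), of "\<lambda>_. 1" 1 0] by simp
  have int_b: "integrable lborel ?b" by (rule laplace_exp_halfline) (use c in simp)
  have G: "(LINT t|lborel. iexp (- (u * t)) * ?b t) = 1 / (Complex c u - \<rho>)" for u
  proof -
    have eq: "iexp (- (u * t)) * ?b t = indicator {0..} t *\<^sub>R exp (- ((Complex c u - \<rho>) * of_real t))" for t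
      by (simp add: Complex_eq algebra_simps flip: exp_add)
    show ?thesis unfolding eq by (rule laplace_exp_halfline(2)) (use c in simp)
  qed
  have "(LINT u|lborel. 1 / (Complex c u - \<rho>) * exp_transform \<phi> (Complex c u)) =
      (LINT u|lborel. exp_transform \<phi> (Complex c u) * (LINT t|lborel. iexp (- (u * t)) * ?b t))"
    unfolding G by (simp add: mult.commute)
  also have "\<dots> = (LINT t|lborel. (LINT u|lborel. exp_transform \<phi> (Complex c u) * iexp (- (u * t))) * ?b t)"
    by (rule Fubini_bounded_kernel[OF int_a int_b, symmetric]) simp_all
  also have "\<dots> = (LINT t|lborel. (2 * of_real pi) * (indicator {0..} t *\<^sub>R exp (\<rho> * of_real t) * \<phi> t))"
  proof (intro Bochner_Integration.integral_cong refl)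
    fix t
    have "exp (- (Complex c u * of_real t)) = exp (- of_real (c * t)) * iexp (- (u * t))" for u
      by (simp add: Complex_eq algebra_simps flip: exp_add)
    hence "2 * of_real pi * \<phi> t = (LINT u|lborel. exp (- of_real (c * t)) * (exp_transform \<phi> (Complex c u) * iexp (- (u * t))))"
      using exp_transform_inversion[OF \<phi> c(1), of t] by (simp add: mult_ac)
    also have "\<dots> = exp (- of_real (c * t)) * (LINT u|lborel. exp_transform \<phi> (Complex c u) * iexp (- (u * t)))"
      by (rule integral_mult_right_zero)
    finally have "(LINT u|lborel. exp_transform \<phi> (Complex c u) * iexp (- (u * t))) = exp (of_real (c * t)) * (2 * of_real pi * \<phi> t)"
      by (simp add: exp_minus field_simps)
    moreover have "exp (of_real (c * t)) * exp (- ((of_real c - \<rho>) * of_real t)) = exp (\<rho> * of_real t)"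
      by (simp add: algebra_simps flip: exp_add)
    moreover have "(E * (2 * of_real pi * p)) * (i *\<^sub>R F) = (2 * of_real pi) * (i *\<^sub>R (E * F) * p)"
      for E F p :: complex and i :: real
      by (simp add: scaleR_conv_of_real mult_ac)
    ultimately show "(LINT u|lborel. exp_transform \<phi> (Complex c u) * iexp (- (u * t))) * ?b t =
        (2 * of_real pi) * (indicator {0..} t *\<^sub>R exp (\<rho> * of_real t) * \<phi> t)"
      by (simp only:)
  qed
  also have "\<dots> = (2 * of_real pi) * (LINT t|lborel. indicator {0..} t *\<^sub>R exp (\<rho> * of_real t) * \<phi> t)"
    by (rule integral_mult_right_zero)
  finally show ?thesis by (simp add: laplace_pairing_def)
qed

lemma laplace_pairing_add:
  assumes "integrable lborel (\<lambda>u. F (Complex c u) * exp_transform \<phi> (Complex c u))"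
    "integrable lborel (\<lambda>u. G (Complex c u) * exp_transform \<phi> (Complex c u))"
  shows "laplace_pairing (\<lambda>s. F s + G s) c \<phi> = laplace_pairing F c \<phi> + laplace_pairing G c \<phi>"
  unfolding laplace_pairing_def distrib_right
  by (subst Bochner_Integration.integral_add[OF assms]) (simp add: distrib_left)

lemma laplace_pairing_cmult: "laplace_pairing (\<lambda>s. a * F s) c \<phi> = a * laplace_pairing F c \<phi>"
  unfolding laplace_pairing_def mult.assoc integral_mult_right_zero by simp

lemma laplace_pairing_sum:
  assumes "\<And>x. x \<in> X \<Longrightarrow> integrable lborel (\<lambda>u. F x (Complex c u) * exp_transform \<phi> (Complex c u))"
  shows "laplace_pairing (\<lambda>s. \<Sum>x\<in>X. F x s) c \<phi> = (\<Sum>x\<in>X. laplace_pairing (F x) c \<phi>)"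
  unfolding laplace_pairing_def sum_distrib_right
  by (subst Bochner_Integration.integral_sum) (use assms in \<open>auto simp: sum_distrib_left\<close>)

lemma laplace_pairing_cong:
  assumes "\<And>u. F (Complex c u) = G (Complex c u)"
  shows "laplace_pairing F c \<phi> = laplace_pairing G c \<phi>"
  unfolding laplace_pairing_def assms ..

lemma continuous_on_vertical_line: "continuous_on A (\<lambda>u. Complex c u)"
  unfolding Complex_eq by (intro continuous_intros)

lemma borel_measurable_vertical_line:
  assumes "F holomorphic_on {s. \<sigma> < Re s}" "\<sigma> < c"
  shows "(\<lambda>u. F (Complex c u)) \<in> borel_measurable borel"
  by (intro borel_measurable_continuous_onI
      continuous_on_compose2[OF holomorphic_on_imp_continuous_on[OF assms(1)] continuous_on_vertical_line])
     (use assms(2) in auto)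

lemma norm_ge_Re_pos: "c \<le> Re s \<Longrightarrow> c \<le> norm s"
  using complex_Re_le_cmod[of s] by linarith

lemma integrable_pole_exp_transform:
  assumes "test_function \<phi>" "c > 0" "Re \<rho> < c"
  shows "integrable lborel (\<lambda>u. 1 / (Complex c u - \<rho>) * exp_transform \<phi> (Complex c u))"
proof (rule integrable_exp_transform_bounded[OF assms(1,2), where k = 0])
  have "(\<lambda>s. 1 / (s - \<rho>)) holomorphic_on {s. Re \<rho> < Re s}" by (intro holomorphic_intros) auto
  thus "(\<lambda>u. 1 / (Complex c u - \<rho>)) \<in> borel_measurable borel"
    using assms(3) by (rule borel_measurable_vertical_line)
  show "norm (1 / (Complex c u - \<rho>)) \<le> 1 / (c - Re \<rho>) * norm (Complex c u) ^ 0" for u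
    using norm_ge_Re_pos[of "c - Re \<rho>" "Complex c u - \<rho>"] assms(3) by (simp add: norm_divide frac_le)
qed

lemma integrable_poly_exp_transform:
  assumes "test_function \<phi>" "c > 0"
  shows "integrable lborel (\<lambda>u. Complex c u ^ k * exp_transform \<phi> (Complex c u))"
  by (rule integrable_exp_transform_bounded[OF assms, where k = k and B = 1])
     (auto simp: norm_power intro!: borel_measurable_continuous_onI continuous_intros continuous_on_vertical_line)

lemma integrable_halfline_mult_test_function:
  assumes "continuous_on UNIV g" "test_function \<phi>"
  shows "integrable lborel (\<lambda>t. indicator {0::real..} t *\<^sub>R g t * \<phi> t)"
proof -
  have "integrable lborel (\<lambda>t. indicator {0..} t *\<^sub>R (g t * \<phi> t))"
    by (intro integrable_mult_indicator integrable_mult_test_function assms) auto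
  thus ?thesis by simp
qed

lemma laplace_pairing_poly:
  assumes \<phi>: "test_function \<phi>" and c: "c > 0"
  shows "laplace_pairing (poly q) c \<phi> = (\<Sum>k\<le>degree q. coeff q k * ((-1) ^ k * iter_deriv k \<phi> 0))"
proof -
  have "laplace_pairing (poly q) c \<phi> = laplace_pairing (\<lambda>s. \<Sum>k\<le>degree q. coeff q k * s ^ k) c \<phi>"
    by (rule laplace_pairing_cong) (rule poly_altdef)
  also have "\<dots> = (\<Sum>k\<le>degree q. laplace_pairing (\<lambda>s. coeff q k * s ^ k) c \<phi>)"
    by (rule laplace_pairing_sum) (simp only: mult.assoc, intro integrable_mult_right integrable_poly_exp_transform \<phi> c)
  also have "\<dots> = (\<Sum>k\<le>degree q. coeff q k * ((-1) ^ k * iter_deriv k \<phi> 0))"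
    by (simp only: laplace_pairing_cmult laplace_pairing_power[OF \<phi> c])
  finally show ?thesis .
qed

lemma poly_norm_le_power:
  fixes q :: "complex poly"
  obtains C where "C \<ge> 0" "\<And>s. norm (poly q s) \<le> C * (1 + norm s) ^ degree q"
proof (rule that[of "\<Sum>k\<le>degree q. norm (coeff q k)"])
  fix s
  have "norm (poly q s) \<le> (\<Sum>k\<le>degree q. norm (coeff q k * s ^ k))"
    unfolding poly_altdef[of q s] by (rule norm_sum)
  also have "\<dots> \<le> (\<Sum>k\<le>degree q. norm (coeff q k) * (1 + norm s) ^ degree q)"
  proof (rule sum_mono)
    fix k assume "k \<in> {..degree q}"
    have "norm s ^ k \<le> (1 + norm s) ^ k" by (intro power_mono) auto
    also have "\<dots> \<le> (1 + norm s) ^ degree q" using \<open>k \<in> _\<close> by (intro power_increasing) auto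
    finally show "norm (coeff q k * s ^ k) \<le> norm (coeff q k) * (1 + norm s) ^ degree q"
      unfolding norm_mult norm_power by (intro mult_left_mono) auto
  qed
  finally show "norm (poly q s) \<le> (\<Sum>k\<le>degree q. norm (coeff q k)) * (1 + norm s) ^ degree q"
    by (simp only: sum_distrib_right)
qed (simp add: sum_nonneg)

section \<open>The logarithmic derivative as a distribution\<close>

locale lld_fun = finite_order_fun +
  assumes bounded_divisor: "bdd_above (Re ` divisor_supp f)"
begin

text \<open>
  The order of derivative carried by the function \<open>nc_fun\<close> below: 1 plus the index of the elementary factors.
\<close>

abbreviation "D \<equiv> Suc prim_genus"

text \<open>
  A continuous function whose \<open>D\<close>-th distributional derivative is the inverse Laplace transform of
  \<open>\<lambda>s. logderiv_term s \<rho>\<close>; subtracting 1 makes it continuous at 0, and \<open>max t 0\<close> makes it vanish for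
  \<open>t \<le> 0\<close>.
\<close>

definition nc_term :: "complex \<Rightarrow> real \<Rightarrow> complex" where
  "nc_term \<rho> t = of_int (zorder f \<rho>) / \<rho> ^ D * (exp (\<rho> * of_real (max t 0)) - 1)"

text \<open>
  The Newton-Cramer function of \<open>f\<close>.
\<close>

definition nc_fun :: "real \<Rightarrow> complex" where
  "nc_fun t = (\<Sum>\<^sub>\<infinity>\<rho>\<in>D0. nc_term \<rho> t)"

lemma continuous_nc_term: "continuous_on A (nc_term \<rho>)"
  unfolding nc_term_def[abs_def] by (intro continuous_intros)

lemma right_bound_exists:
  obtains \<sigma> where "\<sigma> > 0" "\<And>\<rho>. \<rho> \<in> divisor_supp f \<Longrightarrow> Re \<rho> \<le> \<sigma>"
proof -
  obtain b where b: "\<And>\<rho>. \<rho> \<in> divisor_supp f \<Longrightarrow> Re \<rho> \<le> b" using bounded_divisor by (auto simp: bdd_above_def)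
  show ?thesis
  proof (rule that[of "max b 1"])
    show "Re \<rho> \<le> max b 1" if "\<rho> \<in> divisor_supp f" for \<rho> using b[OF that] by simp
  qed simp
qed

text \<open>
  The common shape of the summable majorants for \<open>nc_term\<close> and \<open>logderiv_term\<close>.
\<close>

definition nc_bound :: "real \<Rightarrow> complex \<Rightarrow> real" where
  "nc_bound E \<rho> = real_of_int \<bar>zorder f \<rho>\<bar> / norm \<rho> ^ D * E"

lemma nc_bound_summable: "nc_bound E summable_on D0"
  unfolding nc_bound_def by (intro summable_on_cmult_left divisor_summable_prim_genus)

lemma nc_term_bound:
  assumes "\<rho> \<in> D0" "Re \<rho> \<le> \<sigma>" "\<sigma> > 0" "t \<le> M" "M \<ge> 0"
  shows "norm (nc_term \<rho> t) \<le> nc_bound (exp (\<sigma> * M) + 1) \<rho>"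
proof -
  have "Re \<rho> * max t 0 \<le> \<sigma> * M" using assms by (intro mult_mono) auto
  hence "norm (exp (\<rho> * of_real (max t 0)) - 1) \<le> exp (\<sigma> * M) + 1"
    by (intro order_trans[OF norm_triangle_ineq4]) simp
  thus ?thesis
    unfolding nc_term_def nc_bound_def norm_mult norm_divide norm_power norm_of_int of_int_abs
    by (intro mult_left_mono) auto
qed

lemma nc_fun_uniform_limit:
  assumes "M \<ge> 0"
  shows "uniform_limit {..M} (\<lambda>X t. \<Sum>\<rho>\<in>X. nc_term \<rho> t) nc_fun (finite_subsets_at_top D0)"
proof -
  obtain \<sigma> where \<sigma>: "\<sigma> > 0" "\<And>\<rho>. \<rho> \<in> divisor_supp f \<Longrightarrow> Re \<rho> \<le> \<sigma>" by (rule right_bound_exists) (rule that)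
  show ?thesis
    unfolding nc_fun_def[abs_def]
    by (rule Weierstrass_m_test_general[OF _ nc_bound_summable[of "exp (\<sigma> * M) + 1"]])
       (intro nc_term_bound, use \<sigma> assms in auto)
qed

lemma continuous_nc_fun: "continuous_on UNIV nc_fun"
proof -
  have c: "continuous_on {..M} nc_fun" if "M \<ge> 0" for M
    by (rule uniform_limit_theorem[OF _ nc_fun_uniform_limit[OF that]])
       (auto intro!: always_eventually continuous_on_sum continuous_nc_term)
  have "isCont nc_fun t" for t
  proof -
    have "continuous_on {..<\<bar>t\<bar> + 1} nc_fun"
      by (rule continuous_on_subset[OF c[of "\<bar>t\<bar> + 1"]]) auto
    thus ?thesis by (rule continuous_on_interior) (auto simp: interior_open)
  qed
  thus ?thesis by (simp add: continuous_at_imp_continuous_on)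
qed

text \<open>
  The term is \<open>s ^ D * (n / \<rho> ^ D) * (1 / (s - \<rho>) - 1 / s)\<close>: the power of \<open>s\<close> becomes \<open>D\<close> derivatives on the
  test function, and the two poles become the two exponentials in \<open>nc_term\<close>.
\<close>

lemma integrable_logderiv_term:
  assumes \<phi>: "test_function \<phi>" and c: "c > 0" "Re \<rho> < c" and \<rho>: "\<rho> \<noteq> 0"
  shows "integrable lborel (\<lambda>u. logderiv_term (Complex c u) \<rho> * exp_transform \<phi> (Complex c u))"
    and "laplace_pairing (\<lambda>s. logderiv_term s \<rho>) c \<phi> = (-1) ^ D * (LINT t|lborel. nc_term \<rho> t * iter_deriv D \<phi> t)"
proof -
  let ?\<psi> = "iter_deriv D \<phi>"
  let ?a = "(-1) ^ D * (of_int (zorder f \<rho>) / \<rho> ^ D)"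
  have \<psi>: "test_function ?\<psi>" by (rule test_function_iter_deriv[OF \<phi>])
  have eq: "logderiv_term s \<rho> * exp_transform \<phi> s = ?a * (1 / (s - \<rho>) * exp_transform ?\<psi> s + (- 1) * (1 / (s - 0) * exp_transform ?\<psi> s))"
    if "Re s = c" for s
  proof -
    have s: "s \<noteq> 0" "s \<noteq> \<rho>" using that c by auto
    have "s ^ D * (of_int (zorder f \<rho>) / \<rho> ^ D) * (1 / (s - \<rho>) - 1 / s) = logderiv_term s \<rho>"
    proof -
      have "1 / (s - \<rho>) - 1 / s = \<rho> / (s * (s - \<rho>))" using s by (simp add: diff_frac_eq mult.commute)
      thus ?thesis using s \<rho> by (simp add: logderiv_term_def power_divide)
    qed
    hence "logderiv_term s \<rho> * exp_transform \<phi> s = (of_int (zorder f \<rho>) / \<rho> ^ D) * (1 / (s - \<rho>) - 1 / s) * (s ^ D * exp_transform \<phi> s)"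
      by (simp only: mult_ac)
    also have "s ^ D * exp_transform \<phi> s = (-1) ^ D * exp_transform ?\<psi> s"
      unfolding exp_transform_iter_deriv[OF \<phi>] power_minus[of s] mult.assoc neg_one_power_cancel ..
    finally have "logderiv_term s \<rho> * exp_transform \<phi> s = (of_int (zorder f \<rho>) / \<rho> ^ D) * (1 / (s - \<rho>) - 1 / s) * ((-1) ^ D * exp_transform ?\<psi> s)" .
    moreover have "A * (x - y) * (m * E) = (m * A) * (x * E + (-1) * (y * E))" for A x y m E :: complex
      by (simp add: algebra_simps)
    ultimately show ?thesis by (simp only: diff_zero)
  qed
  have i1: "integrable lborel (\<lambda>u. 1 / (Complex c u - \<rho>) * exp_transform ?\<psi> (Complex c u))"
    by (rule integrable_pole_exp_transform[OF \<psi> c])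
  have i2: "integrable lborel (\<lambda>u. 1 / (Complex c u - 0) * exp_transform ?\<psi> (Complex c u))"
    by (rule integrable_pole_exp_transform[OF \<psi> c(1)]) (use c in simp)
  have "integrable lborel (\<lambda>u. ?a * (1 / (Complex c u - \<rho>) * exp_transform ?\<psi> (Complex c u) + (- 1) * (1 / (Complex c u - 0) * exp_transform ?\<psi> (Complex c u))))"
    by (intro integrable_mult_right Bochner_Integration.integrable_add i1 i2)
  thus "integrable lborel (\<lambda>u. logderiv_term (Complex c u) \<rho> * exp_transform \<phi> (Complex c u))"
    by (simp only: eq complex.sel)
  have "laplace_pairing (\<lambda>s. logderiv_term s \<rho>) c \<phi> = 1 / (2 * of_real pi) *
      (LINT u|lborel. ?a * (1 / (Complex c u - \<rho>) * exp_transform ?\<psi> (Complex c u) + (- 1) * (1 / (Complex c u - 0) * exp_transform ?\<psi> (Complex c u))))"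
    unfolding laplace_pairing_def by (simp only: eq complex.sel)
  also have "\<dots> = ?a * (laplace_pairing (\<lambda>s. 1 / (s - \<rho>)) c ?\<psi> + (- 1) * laplace_pairing (\<lambda>s. 1 / (s - 0)) c ?\<psi>)"
    unfolding laplace_pairing_def
    by (subst integral_mult_right_zero, subst Bochner_Integration.integral_add[OF i1 integrable_mult_right[OF i2]],
        subst integral_mult_right_zero) (simp add: algebra_simps)
  also have "\<dots> = ?a * ((LINT t|lborel. indicator {0..} t *\<^sub>R exp (\<rho> * of_real t) * ?\<psi> t) + (- 1) * (LINT t|lborel. indicator {0..} t *\<^sub>R exp (0 * of_real t) * ?\<psi> t))"
    using c by (simp only: laplace_pairing_pole[OF \<psi> c] laplace_pairing_pole[OF \<psi> c(1), of 0] zero_complex.sel)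
  also have "(LINT t|lborel. indicator {0..} t *\<^sub>R exp (\<rho> * of_real t) * ?\<psi> t) + (- 1) * (LINT t|lborel. indicator {0..} t *\<^sub>R exp (0 * of_real t) * ?\<psi> t)
     = (LINT t|lborel. (indicator {0..} t *\<^sub>R exp (\<rho> * of_real t) * ?\<psi> t) + (- 1) * (indicator {0..} t *\<^sub>R exp (0 * of_real t) * ?\<psi> t))"
    by (subst Bochner_Integration.integral_add)
       (intro integrable_mult_right integrable_halfline_mult_test_function continuous_intros \<psi> | simp only: integral_mult_right_zero)+
  also have "?a * \<dots> = (-1) ^ D * (LINT t|lborel. (of_int (zorder f \<rho>) / \<rho> ^ D) *
      ((indicator {0..} t *\<^sub>R exp (\<rho> * of_real t) * ?\<psi> t) + (- 1) * (indicator {0..} t *\<^sub>R exp (0 * of_real t) * ?\<psi> t)))"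
    by (simp only: integral_mult_right_zero mult.assoc)
  also have "(\<lambda>t. (of_int (zorder f \<rho>) / \<rho> ^ D) *
      ((indicator {0..} t *\<^sub>R exp (\<rho> * of_real t) * ?\<psi> t) + (- 1) * (indicator {0..} t *\<^sub>R exp (0 * of_real t) * ?\<psi> t))) =
      (\<lambda>t. nc_term \<rho> t * ?\<psi> t)"
  proof
    fix t :: real
    show "(of_int (zorder f \<rho>) / \<rho> ^ D) *
      ((indicator {0..} t *\<^sub>R exp (\<rho> * of_real t) * ?\<psi> t) + (- 1) * (indicator {0..} t *\<^sub>R exp (0 * of_real t) * ?\<psi> t)) = nc_term \<rho> t * ?\<psi> t"
    proof (cases "t \<ge> 0")
      case True
      hence t: "indicator {0..} t = (1::real)" "max t 0 = t" by auto
      have "A * (x * p + (- 1) * (1 * p)) = A * (x - 1) * p" for A x p :: complex by (simp add: algebra_simps)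
      thus ?thesis unfolding nc_term_def t scaleR_one mult_zero_left exp_zero .
    next
      case False
      thus ?thesis by (simp add: nc_term_def max_def)
    qed
  qed
  finally show "laplace_pairing (\<lambda>s. logderiv_term s \<rho>) c \<phi> = (-1) ^ D * (LINT t|lborel. nc_term \<rho> t * iter_deriv D \<phi> t)" .
qed

text \<open>
  On the line, \<open>\<bar>\<rho>\<bar> / \<bar>s - \<rho>\<bar> \<le> 1 + \<bar>s\<bar> / \<bar>s - \<rho>\<bar>\<close>, and both \<open>\<bar>s\<bar>\<close> and \<open>\<bar>s - \<rho>\<bar>\<close> are bounded
  below.
\<close>

lemma logderiv_term_bound:
  assumes \<rho>: "\<rho> \<in> D0" "Re \<rho> \<le> \<sigma>" and c: "c > 0" "\<sigma> < c" "c \<le> Re s"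
  shows "norm (logderiv_term s \<rho>) \<le> nc_bound ((1 / c + 1 / (c - \<sigma>)) * norm s ^ D) \<rho>"
proof -
  have s: "norm s \<ge> c" using c(3) by (rule norm_ge_Re_pos)
  have d: "norm (s - \<rho>) \<ge> c - \<sigma>" by (rule norm_ge_Re_pos) (use assms in simp)
  have dpos: "norm (s - \<rho>) > 0" using d c by linarith
  have "norm \<rho> \<le> norm (s - \<rho>) + norm s" using norm_triangle_ineq4[of s "s - \<rho>"] by simp
  hence "norm \<rho> / norm (s - \<rho>) \<le> (norm (s - \<rho>) + norm s) / norm (s - \<rho>)" by (intro divide_right_mono) auto
  also have "\<dots> = 1 + norm s / norm (s - \<rho>)" using dpos by (simp add: add_divide_distrib)
  also have "\<dots> \<le> norm s / c + norm s / (c - \<sigma>)"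
    using s d c dpos by (intro add_mono divide_left_mono mult_pos_pos) auto
  also have "\<dots> = (1 / c + 1 / (c - \<sigma>)) * norm s" by (simp add: algebra_simps)
  finally have r: "norm \<rho> / norm (s - \<rho>) \<le> (1 / c + 1 / (c - \<sigma>)) * norm s" .
  have "norm (logderiv_term s \<rho>) = real_of_int \<bar>zorder f \<rho>\<bar> / norm \<rho> ^ D * (norm s ^ prim_genus * (norm \<rho> / norm (s - \<rho>)))"
    using \<rho> by (simp add: logderiv_term_def norm_mult norm_divide norm_power power_divide)
  also have "\<dots> \<le> real_of_int \<bar>zorder f \<rho>\<bar> / norm \<rho> ^ D * (norm s ^ prim_genus * ((1 / c + 1 / (c - \<sigma>)) * norm s))"
    by (intro mult_left_mono r) auto
  finally show ?thesis by (simp add: nc_bound_def mult_ac)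
qed

text \<open>
  The inverse Laplace transform of the expansion of \<open>f' / f\<close> with polynomial part \<open>q\<close>, term by term: Dirac
  part, Heaviside part, and the \<open>D\<close>-th derivative of \<open>nc_fun\<close>.
\<close>

definition lld_distr :: "complex poly \<Rightarrow> (real \<Rightarrow> complex) \<Rightarrow> complex" where
  "lld_distr q \<phi> = (\<Sum>k\<le>degree q. coeff q k * ((-1) ^ k * iter_deriv k \<phi> 0))
     + of_int (zorder f 0) * (LINT t|lborel. indicator {0..} t *\<^sub>R \<phi> t)
     + (-1) ^ D * (LINT t|lborel. nc_fun t * iter_deriv D \<phi> t)"

lemma holomorphic_logderiv:
  assumes "\<And>\<rho>. \<rho> \<in> divisor_supp f \<Longrightarrow> Re \<rho> \<le> \<sigma>"
  shows "(\<lambda>s. deriv f s / f s) holomorphic_on {s. \<sigma> < Re s}"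
proof -
  have op: "open {s. \<sigma> < Re s}" by (rule open_halfspace_Re_gt)
  have "f analytic_on {s. \<sigma> < Re s}"
    using assms by (subst analytic_on_analytic_at) (force intro!: analytic_off_divisor)
  hence "f holomorphic_on {s. \<sigma> < Re s}" by (rule analytic_imp_holomorphic)
  moreover have "f s \<noteq> 0" if "s \<in> {s. \<sigma> < Re s}" for s
    using assms[of s] that by (auto simp: divisor_supp_eq)
  ultimately show ?thesis by (intro holomorphic_intros holomorphic_deriv op) auto
qed

definition logderiv_sum :: "complex \<Rightarrow> complex" where
  "logderiv_sum s = (\<Sum>\<^sub>\<infinity>\<rho>\<in>D0. logderiv_term s \<rho>)"

lemma logderiv_sum_tendsto:
  "(\<lambda>j. \<Sum>\<rho>\<in>divisor_disc (real j). logderiv_term s \<rho>) \<longlonglongrightarrow> logderiv_sum s"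
proof -
  have "(sum (logderiv_term s) \<longlongrightarrow> logderiv_sum s) (finite_subsets_at_top D0)"
    using has_sum_infsum[OF abs_summable_summable[OF logderiv_term_summable]] by (simp add: has_sum_def logderiv_sum_def)
  thus ?thesis by (rule filterlim_compose[OF _ filterlim_divisor_disc[OF filterlim_real_sequentially]])
qed

lemma partial_logderiv_sum_bound:
  assumes \<sigma>: "\<And>\<rho>. \<rho> \<in> divisor_supp f \<Longrightarrow> Re \<rho> \<le> \<sigma>" and c: "c > 0" "\<sigma> < c" "c \<le> Re s" and X: "finite X" "X \<subseteq> D0"
  shows "norm (\<Sum>\<rho>\<in>X. logderiv_term s \<rho>) \<le> (\<Sum>\<^sub>\<infinity>\<rho>\<in>D0. nc_bound 1 \<rho>) * (1 / c + 1 / (c - \<sigma>)) * norm s ^ D"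
proof -
  let ?E = "(1 / c + 1 / (c - \<sigma>)) * norm s ^ D"
  have E0: "?E \<ge> 0" using c by simp
  have "norm (\<Sum>\<rho>\<in>X. logderiv_term s \<rho>) \<le> (\<Sum>\<rho>\<in>X. nc_bound ?E \<rho>)"
    by (rule sum_norm_le) (rule logderiv_term_bound[OF _ \<sigma> c], use X in auto)
  also have "\<dots> = (\<Sum>\<rho>\<in>X. nc_bound 1 \<rho>) * ?E" by (simp add: nc_bound_def sum_distrib_right)
  also have "\<dots> \<le> (\<Sum>\<^sub>\<infinity>\<rho>\<in>D0. nc_bound 1 \<rho>) * ?E"
    by (intro mult_right_mono finite_sum_le_infsum nc_bound_summable X E0) (auto simp: nc_bound_def)
  finally show ?thesis by (simp only: mult.assoc)
qed

lemma logderiv_sum_bound: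
  assumes "\<And>\<rho>. \<rho> \<in> divisor_supp f \<Longrightarrow> Re \<rho> \<le> \<sigma>" and "c > 0" "\<sigma> < c" "c \<le> Re s"
  shows "norm (logderiv_sum s) \<le> (\<Sum>\<^sub>\<infinity>\<rho>\<in>D0. nc_bound 1 \<rho>) * (1 / c + 1 / (c - \<sigma>)) * norm s ^ D"
proof (rule LIMSEQ_le_const2[OF tendsto_norm[OF logderiv_sum_tendsto]], intro exI allI impI)
  fix j :: nat
  show "norm (\<Sum>\<rho>\<in>divisor_disc (real j). logderiv_term s \<rho>) \<le> (\<Sum>\<^sub>\<infinity>\<rho>\<in>D0. nc_bound 1 \<rho>) * (1 / c + 1 / (c - \<sigma>)) * norm s ^ D"
    by (rule partial_logderiv_sum_bound[OF assms finite_divisor_disc]) (auto simp: divisor_disc_def)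
qed

lemma nc_partial_sum_bound:
  assumes \<sigma>: "\<sigma> > 0" "\<And>\<rho>. \<rho> \<in> divisor_supp f \<Longrightarrow> Re \<rho> \<le> \<sigma>" and M: "t \<le> M" "M \<ge> 0" and X: "finite X" "X \<subseteq> D0"
  shows "norm (\<Sum>\<rho>\<in>X. nc_term \<rho> t) \<le> (\<Sum>\<^sub>\<infinity>\<rho>\<in>D0. nc_bound (exp (\<sigma> * M) + 1) \<rho>)"
proof -
  have "norm (\<Sum>\<rho>\<in>X. nc_term \<rho> t) \<le> (\<Sum>\<rho>\<in>X. nc_bound (exp (\<sigma> * M) + 1) \<rho>)"
    by (rule sum_norm_le) (rule nc_term_bound, use X \<sigma> M in auto)
  also have "\<dots> \<le> (\<Sum>\<^sub>\<infinity>\<rho>\<in>D0. nc_bound (exp (\<sigma> * M) + 1) \<rho>)"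
    by (intro finite_sum_le_infsum nc_bound_summable X) (auto simp: nc_bound_def)
  finally show ?thesis .
qed

text \<open>
  The partial sums are bounded on the support of the test function, so dominated convergence applies.
\<close>

lemma nc_fun_pairing_limit:
  assumes \<psi>: "test_function \<psi>"
  shows "(\<lambda>j. LINT t|lborel. (\<Sum>\<rho>\<in>divisor_disc (real j). nc_term \<rho> t) * \<psi> t) \<longlonglongrightarrow> (LINT t|lborel. nc_fun t * \<psi> t)"
proof -
  obtain \<sigma> where \<sigma>: "\<sigma> > 0" "\<And>\<rho>. \<rho> \<in> divisor_supp f \<Longrightarrow> Re \<rho> \<le> \<sigma>" by (rule right_bound_exists) (rule that)
  obtain M where M: "M > 0" "\<And>t. \<bar>t\<bar> > M \<Longrightarrow> \<psi> t = 0" by (rule test_function_support[OF \<psi>]) (rule that)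
  define B where "B = (\<Sum>\<^sub>\<infinity>\<rho>\<in>D0. nc_bound (exp (\<sigma> * M) + 1) \<rho>)"
  have c\<psi>: "continuous_on UNIV \<psi>" by (rule test_function_continuous[OF \<psi>])
  show ?thesis
  proof (rule integral_dominated_convergence[where w = "\<lambda>t. norm (B * \<psi> t)"])
    show "(\<lambda>t. nc_fun t * \<psi> t) \<in> borel_measurable lborel"
      using continuous_nc_fun c\<psi> by (auto intro!: borel_measurable_continuous_onI continuous_intros)
    show "(\<lambda>t. (\<Sum>\<rho>\<in>divisor_disc (real j). nc_term \<rho> t) * \<psi> t) \<in> borel_measurable lborel" for j
      using c\<psi> by (auto intro!: borel_measurable_continuous_onI continuous_intros continuous_nc_term)
    show "integrable lborel (\<lambda>t. norm (B * \<psi> t))"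
      by (intro integrable_norm integrable_mult_test_function \<psi> continuous_intros)
    show "AE t in lborel. (\<lambda>j. (\<Sum>\<rho>\<in>divisor_disc (real j). nc_term \<rho> t) * \<psi> t) \<longlonglongrightarrow> nc_fun t * \<psi> t"
    proof (intro AE_I2 tendsto_mult tendsto_const)
      fix t :: real
      have "((\<lambda>X. \<Sum>\<rho>\<in>X. nc_term \<rho> t) \<longlongrightarrow> nc_fun t) (finite_subsets_at_top D0)"
        by (rule tendsto_uniform_limitI[OF nc_fun_uniform_limit[of "\<bar>t\<bar>"]]) auto
      thus "(\<lambda>j. \<Sum>\<rho>\<in>divisor_disc (real j). nc_term \<rho> t) \<longlonglongrightarrow> nc_fun t"
        by (rule filterlim_compose[OF _ filterlim_divisor_disc[OF filterlim_real_sequentially]])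
    qed
    show "AE t in lborel. norm ((\<Sum>\<rho>\<in>divisor_disc (real j). nc_term \<rho> t) * \<psi> t) \<le> norm (B * \<psi> t)" for j
    proof (intro AE_I2)
      fix t :: real
      show "norm ((\<Sum>\<rho>\<in>divisor_disc (real j). nc_term \<rho> t) * \<psi> t) \<le> norm (B * \<psi> t)"
      proof (cases "\<bar>t\<bar> > M")
        case True
        thus ?thesis using M by simp
      next
        case False
        have "norm (\<Sum>\<rho>\<in>divisor_disc (real j). nc_term \<rho> t) \<le> B"
          unfolding B_def
          by (rule nc_partial_sum_bound[OF \<sigma> _ _ finite_divisor_disc]) (use False M in \<open>auto simp: divisor_disc_def\<close>)
        hence "norm (\<Sum>\<rho>\<in>divisor_disc (real j). nc_term \<rho> t) \<le> norm (complex_of_real B)" by simp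
        thus ?thesis unfolding norm_mult by (intro mult_right_mono) auto
      qed
    qed
  qed
qed

text \<open>
  In particular the pairing is the same for all \<open>c\<close> to the right of the divisor, without shifting contours.
  The passage from finite discs to the whole divisor is dominated convergence on both sides.
\<close>

lemma laplace_pairing_logderiv:
  assumes q: "logderiv_expansion q"
    and \<sigma>: "\<And>\<rho>. \<rho> \<in> divisor_supp f \<Longrightarrow> Re \<rho> \<le> \<sigma>" and c: "c > 0" "\<sigma> < c" and \<phi>: "test_function \<phi>"
  shows "laplace_pairing (\<lambda>s. deriv f s / f s) c \<phi> = lld_distr q \<phi>"
proof -
  let ?F = "\<lambda>s. deriv f s / f s" and ?n0 = "complex_of_int (zorder f 0)"
  have V: "logderiv_sum s = ?F s - ?n0 / s - poly q s" if "Re s = c" for s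
  proof -
    have "s \<notin> divisor_supp f" "s \<noteq> 0" using \<sigma>[of s] that c by auto
    from infsumI[OF logderiv_expansionD[OF q this]] show ?thesis unfolding logderiv_sum_def .
  qed
  have mF: "(\<lambda>u. ?F (Complex c u)) \<in> borel_measurable borel"
    by (rule borel_measurable_vertical_line[OF holomorphic_logderiv[OF \<sigma>] c(2)])
  have m0: "(\<lambda>u. ?n0 / Complex c u) \<in> borel_measurable borel"
  proof (rule borel_measurable_vertical_line[of "\<lambda>s. ?n0 / s" 0])
    show "(\<lambda>s. ?n0 / s) holomorphic_on {s. 0 < Re s}" by (intro holomorphic_intros) auto
  qed (rule c)
  have mq: "(\<lambda>u. poly q (Complex c u)) \<in> borel_measurable borel"
    by (intro borel_measurable_continuous_onI continuous_on_poly continuous_on_vertical_line)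
  have mV: "(\<lambda>u. logderiv_sum (Complex c u)) \<in> borel_measurable borel"
    by (simp only: V complex.sel) (intro borel_measurable_diff mF m0 mq)
  define B where "B = (\<Sum>\<^sub>\<infinity>\<rho>\<in>D0. nc_bound 1 \<rho>) * (1 / c + 1 / (c - \<sigma>))"
  have iV: "integrable lborel (\<lambda>u. logderiv_sum (Complex c u) * exp_transform \<phi> (Complex c u))"
    by (rule integrable_exp_transform_bounded[OF \<phi> c(1) mV, of B D])
       (unfold B_def, rule logderiv_sum_bound[OF \<sigma> c], simp_all)
  have iq: "integrable lborel (\<lambda>u. poly q (Complex c u) * exp_transform \<phi> (Complex c u))"
    unfolding poly_altdef sum_distrib_right mult.assoc
    by (intro Bochner_Integration.integrable_sum integrable_mult_right integrable_poly_exp_transform \<phi> c)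
  have i0: "integrable lborel (\<lambda>u. (?n0 * (1 / (Complex c u - 0))) * exp_transform \<phi> (Complex c u))"
    unfolding mult.assoc by (intro integrable_mult_right integrable_pole_exp_transform \<phi> c) (use c in simp)
  have i0V: "integrable lborel (\<lambda>u. (?n0 * (1 / (Complex c u - 0)) + logderiv_sum (Complex c u)) * exp_transform \<phi> (Complex c u))"
    unfolding distrib_right by (intro Bochner_Integration.integrable_add i0 iV)
  have tm: "integrable lborel (\<lambda>u. logderiv_term (Complex c u) \<rho> * exp_transform \<phi> (Complex c u))"
    "laplace_pairing (\<lambda>s. logderiv_term s \<rho>) c \<phi> = (-1) ^ D * (LINT t|lborel. nc_term \<rho> t * iter_deriv D \<phi> t)"
    if "\<rho> \<in> D0" for \<rho>
    using integrable_logderiv_term[OF \<phi> c(1), of \<rho>] \<sigma>[of \<rho>] that c by auto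
  have pV: "laplace_pairing logderiv_sum c \<phi> = (-1) ^ D * (LINT t|lborel. nc_fun t * iter_deriv D \<phi> t)"
  proof (rule LIMSEQ_unique)
    have "(\<lambda>j. LINT u|lborel. (\<Sum>\<rho>\<in>divisor_disc (real j). logderiv_term (Complex c u) \<rho>) * exp_transform \<phi> (Complex c u))
       \<longlonglongrightarrow> (LINT u|lborel. logderiv_sum (Complex c u) * exp_transform \<phi> (Complex c u))"
    proof (rule integral_dominated_convergence[where w = "\<lambda>u. norm (of_real B * (Complex c u ^ D * exp_transform \<phi> (Complex c u)))"])
      show "(\<lambda>u. (\<Sum>\<rho>\<in>divisor_disc (real j). logderiv_term (Complex c u) \<rho>) * exp_transform \<phi> (Complex c u)) \<in> borel_measurable lborel" for j
      proof -
        have "integrable lborel (\<lambda>u. (\<Sum>\<rho>\<in>divisor_disc (real j). logderiv_term (Complex c u) \<rho>) * exp_transform \<phi> (Complex c u))"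
          unfolding sum_distrib_right by (intro Bochner_Integration.integrable_sum tm) (auto simp: divisor_disc_def)
        thus ?thesis by (rule borel_measurable_integrable)
      qed
      show "integrable lborel (\<lambda>u. norm (of_real B * (Complex c u ^ D * exp_transform \<phi> (Complex c u))))"
        by (intro integrable_norm integrable_mult_right integrable_poly_exp_transform \<phi> c)
      show "AE u in lborel. (\<lambda>j. (\<Sum>\<rho>\<in>divisor_disc (real j). logderiv_term (Complex c u) \<rho>) * exp_transform \<phi> (Complex c u))
          \<longlonglongrightarrow> logderiv_sum (Complex c u) * exp_transform \<phi> (Complex c u)"
        by (intro AE_I2 tendsto_mult tendsto_const logderiv_sum_tendsto)
      show "AE u in lborel. norm ((\<Sum>\<rho>\<in>divisor_disc (real j). logderiv_term (Complex c u) \<rho>) * exp_transform \<phi> (Complex c u))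
          \<le> norm (of_real B * (Complex c u ^ D * exp_transform \<phi> (Complex c u)))" for j
      proof (intro AE_I2)
        fix u
        have "norm (\<Sum>\<rho>\<in>divisor_disc (real j). logderiv_term (Complex c u) \<rho>) \<le> B * norm (Complex c u) ^ D"
          unfolding B_def
          by (rule partial_logderiv_sum_bound[OF \<sigma> c _ finite_divisor_disc]) (auto simp: divisor_disc_def)
        also have "\<dots> \<le> \<bar>B\<bar> * norm (Complex c u) ^ D" by (intro mult_right_mono) auto
        finally show "norm ((\<Sum>\<rho>\<in>divisor_disc (real j). logderiv_term (Complex c u) \<rho>) * exp_transform \<phi> (Complex c u))
          \<le> norm (of_real B * (Complex c u ^ D * exp_transform \<phi> (Complex c u)))"
          unfolding norm_mult norm_power norm_of_real mult.assoc[symmetric] by (intro mult_right_mono) auto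
      qed
    qed (use iV in \<open>rule borel_measurable_integrable\<close>)
    thus "(\<lambda>j. laplace_pairing (\<lambda>s. \<Sum>\<rho>\<in>divisor_disc (real j). logderiv_term s \<rho>) c \<phi>) \<longlonglongrightarrow> laplace_pairing logderiv_sum c \<phi>"
      unfolding laplace_pairing_def by (rule tendsto_mult[OF tendsto_const])
    have "laplace_pairing (\<lambda>s. \<Sum>\<rho>\<in>divisor_disc (real j). logderiv_term s \<rho>) c \<phi> =
        (-1) ^ D * (LINT t|lborel. (\<Sum>\<rho>\<in>divisor_disc (real j). nc_term \<rho> t) * iter_deriv D \<phi> t)" for j
    proof -
      have "laplace_pairing (\<lambda>s. \<Sum>\<rho>\<in>divisor_disc (real j). logderiv_term s \<rho>) c \<phi> =
         (\<Sum>\<rho>\<in>divisor_disc (real j). laplace_pairing (\<lambda>s. logderiv_term s \<rho>) c \<phi>)"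
        by (rule laplace_pairing_sum) (rule tm, auto simp: divisor_disc_def)
      also have "\<dots> = (\<Sum>\<rho>\<in>divisor_disc (real j). (-1) ^ D * (LINT t|lborel. nc_term \<rho> t * iter_deriv D \<phi> t))"
        by (intro sum.cong refl tm) (auto simp: divisor_disc_def)
      also have "\<dots> = (-1) ^ D * (LINT t|lborel. (\<Sum>\<rho>\<in>divisor_disc (real j). nc_term \<rho> t * iter_deriv D \<phi> t))"
        by (subst Bochner_Integration.integral_sum)
           (intro integrable_mult_test_function continuous_nc_term test_function_iter_deriv \<phi> | simp only: sum_distrib_left)+
      finally show ?thesis by (simp only: sum_distrib_right)
    qed
    thus "(\<lambda>j. laplace_pairing (\<lambda>s. \<Sum>\<rho>\<in>divisor_disc (real j). logderiv_term s \<rho>) c \<phi>) \<longlonglongrightarrow>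
        (-1) ^ D * (LINT t|lborel. nc_fun t * iter_deriv D \<phi> t)"
      by (simp only:) (intro tendsto_mult tendsto_const nc_fun_pairing_limit test_function_iter_deriv \<phi>)
  qed
  have p0: "laplace_pairing (\<lambda>s. 1 / (s - 0)) c \<phi> = (LINT t|lborel. indicator {0..} t *\<^sub>R \<phi> t)"
    using laplace_pairing_pole[OF \<phi> c(1), of 0] c by simp
  have "laplace_pairing ?F c \<phi> = laplace_pairing (\<lambda>s. poly q s + (?n0 * (1 / (s - 0)) + logderiv_sum s)) c \<phi>"
    by (rule laplace_pairing_cong) (simp add: V)
  also have "\<dots> = laplace_pairing (poly q) c \<phi> + laplace_pairing (\<lambda>s. ?n0 * (1 / (s - 0)) + logderiv_sum s) c \<phi>"
    by (rule laplace_pairing_add[OF iq i0V])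
  also have "laplace_pairing (\<lambda>s. ?n0 * (1 / (s - 0)) + logderiv_sum s) c \<phi> =
      laplace_pairing (\<lambda>s. ?n0 * (1 / (s - 0))) c \<phi> + laplace_pairing logderiv_sum c \<phi>"
    by (rule laplace_pairing_add[OF i0 iV])
  finally show ?thesis
    unfolding lld_distr_def laplace_pairing_cmult p0 pV laplace_pairing_poly[OF \<phi> c(1)] by (simp only: add.assoc)
qed

lemma logderiv_polynomial_growth:
  assumes q: "logderiv_expansion q"
    and \<sigma>: "\<sigma> > 0" "\<And>\<rho>. \<rho> \<in> divisor_supp f \<Longrightarrow> Re \<rho> \<le> \<sigma>"
  obtains C N where "C \<ge> 0" "\<And>s. \<sigma> + 1 \<le> Re s \<Longrightarrow> norm (deriv f s / f s) \<le> C * (1 + norm s) ^ N"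
proof -
  obtain C0 where C0: "C0 \<ge> 0" "\<And>s. norm (poly q s) \<le> C0 * (1 + norm s) ^ degree q" by (rule poly_norm_le_power) (rule that)
  define B where "B = (\<Sum>\<^sub>\<infinity>\<rho>\<in>D0. nc_bound 1 \<rho>) * (1 / (\<sigma> + 1) + 1 / (\<sigma> + 1 - \<sigma>))"
  have B0: "B \<ge> 0" unfolding B_def using \<sigma>(1) by (intro mult_nonneg_nonneg infsum_nonneg) (auto simp: nc_bound_def)
  define N where "N = degree q + D"
  have "norm (deriv f s / f s) \<le> (C0 + \<bar>of_int (zorder f 0)\<bar> + B) * (1 + norm s) ^ N" if s: "\<sigma> + 1 \<le> Re s" for s
  proof -
    have "s \<notin> divisor_supp f" "s \<noteq> 0" using \<sigma>(2)[of s] s \<sigma>(1) by auto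
    from infsumI[OF logderiv_expansionD[OF q this]] have "deriv f s / f s = poly q s + of_int (zorder f 0) / s + logderiv_sum s"
      unfolding logderiv_sum_def by (simp add: algebra_simps)
    also have "norm \<dots> \<le> C0 * (1 + norm s) ^ N + \<bar>of_int (zorder f 0)\<bar> * (1 + norm s) ^ N + B * (1 + norm s) ^ N"
    proof (intro norm_triangle_mono)
      have "(1 + norm s) ^ degree q \<le> (1 + norm s) ^ N" by (intro power_increasing) (auto simp: N_def)
      thus "norm (poly q s) \<le> C0 * (1 + norm s) ^ N" using C0 by (meson mult_left_mono order_trans)
      have "norm s \<ge> 1" using norm_ge_Re_pos[OF s] \<sigma>(1) by linarith
      hence "norm (of_int (zorder f 0) / s) \<le> \<bar>of_int (zorder f 0)\<bar> * 1"
        by (simp add: norm_divide divide_le_eq mult_left_le_one_le mult_le_cancel_left1)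
      also have "\<dots> \<le> \<bar>of_int (zorder f 0)\<bar> * (1 + norm s) ^ N" by (intro mult_left_mono one_le_power) auto
      finally show "norm (of_int (zorder f 0) / s) \<le> \<bar>of_int (zorder f 0)\<bar> * (1 + norm s) ^ N" .
      have "norm (logderiv_sum s) \<le> B * norm s ^ D"
        unfolding B_def by (rule logderiv_sum_bound[OF \<sigma>(2)]) (use \<sigma>(1) s in auto)
      also have "\<dots> \<le> B * (1 + norm s) ^ N"
      proof (intro mult_left_mono B0)
        have "norm s ^ D \<le> (1 + norm s) ^ D" by (intro power_mono) auto
        also have "\<dots> \<le> (1 + norm s) ^ N" by (intro power_increasing) (auto simp: N_def)
        finally show "norm s ^ D \<le> (1 + norm s) ^ N" .
      qed
      finally show "norm (logderiv_sum s) \<le> B * (1 + norm s) ^ N" .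
    qed
    finally show ?thesis by (simp only: distrib_right)
  qed
  thus ?thesis using C0(1) B0 by (intro that[of "C0 + \<bar>of_int (zorder f 0)\<bar> + B" N]) auto
qed

text \<open>
  The expansion gives polynomial growth of \<open>f' / f\<close> to the right of the divisor; dividing by \<open>s\<close> to the power of
  the growth exponent plus 2 makes the integrand absolutely integrable.
\<close>

lemma laplace_admissible_exists:
  assumes q: "logderiv_expansion q"
  shows "\<exists>c n. laplace_admissible (\<lambda>s. deriv f s / f s) c n"
proof -
  let ?F = "\<lambda>s. deriv f s / f s"
  obtain \<sigma> where \<sigma>: "\<sigma> > 0" "\<And>\<rho>. \<rho> \<in> divisor_supp f \<Longrightarrow> Re \<rho> \<le> \<sigma>" by (rule right_bound_exists) (rule that)
  obtain C N where CN: "C \<ge> 0" "\<And>s. \<sigma> + 1 \<le> Re s \<Longrightarrow> norm (?F s) \<le> C * (1 + norm s) ^ N"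
    by (rule logderiv_polynomial_growth[OF q \<sigma>]) (assumption | rule that)+
  (* The bound on \<open>f' / f\<close> starts at \<open>\<sigma> + 1\<close>, and the abscissa has to lie strictly to the right of it. *)
  define c where "c = \<sigma> + 2"
  have c: "c > 0" using \<sigma>(1) by (simp add: c_def)
  have hol: "?F holomorphic_on {s. \<sigma> + 1 < Re s}"
    by (rule holomorphic_on_subset[OF holomorphic_logderiv[OF \<sigma>(2)]]) auto
  have int: "integrable lborel (laplace_integrand ?F c (N + 2) t)" for t
  proof (rule Bochner_Integration.integrable_bound)
    show "integrable lborel (\<lambda>u. C * 2 ^ N * exp (c * t) * (1 / (c\<^sup>2 + u\<^sup>2)))"
      by (intro integrable_mult_right integrable_inverse_sum_squares c)
    have "(\<lambda>s. ?F s / s ^ (N + 2) * exp (s * of_real t)) holomorphic_on {s. \<sigma> + 1 < Re s}"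
      by (intro holomorphic_intros hol) (use \<sigma>(1) in auto)
    hence "laplace_integrand ?F c (N + 2) t \<in> borel_measurable borel"
      unfolding laplace_integrand_def[abs_def] by (rule borel_measurable_vertical_line) (simp add: c_def)
    thus "laplace_integrand ?F c (N + 2) t \<in> borel_measurable lborel" by simp
    show "AE u in lborel. norm (laplace_integrand ?F c (N + 2) t u) \<le> norm (C * 2 ^ N * exp (c * t) * (1 / (c\<^sup>2 + u\<^sup>2)))"
    proof (intro AE_I2)
      fix u
      let ?s = "Complex c u"
      have s1: "norm ?s \<ge> 1" using norm_ge_Re_pos[of c ?s] \<sigma>(1) by (simp add: c_def)
      have "norm (?F ?s) \<le> C * (1 + norm ?s) ^ N" by (rule CN) (simp add: c_def)
      also have "\<dots> \<le> C * (2 * norm ?s) ^ N" using s1 CN(1) by (intro mult_left_mono power_mono) auto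
      finally have "norm (?F ?s) / norm ?s ^ (N + 2) * exp (c * t) \<le> C * (2 * norm ?s) ^ N / norm ?s ^ (N + 2) * exp (c * t)"
        by (intro mult_right_mono divide_right_mono) auto
      also have "\<dots> = C * 2 ^ N * exp (c * t) * (1 / norm ?s ^ 2)"
        using s1 by (simp add: power_mult_distrib power_add power2_eq_square)
      finally show "norm (laplace_integrand ?F c (N + 2) t u) \<le> norm (C * 2 ^ N * exp (c * t) * (1 / (c\<^sup>2 + u\<^sup>2)))"
        using CN(1) unfolding norm_Complex_sq by (simp add: laplace_integrand_def norm_mult norm_divide norm_power)
    qed
  qed
  have "polynomial_growth_on {s. \<sigma> + 1 < Re s} ?F"
    unfolding polynomial_growth_on_def using CN(2) by (intro exI[of _ C] exI[of _ N]) auto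
  hence "laplace_admissible ?F c (N + 2)"
    unfolding laplace_admissible_def using hol int \<sigma>(1) by (intro conjI exI[of _ "\<sigma> + 1"]) (auto simp: c_def)
  thus ?thesis by blast
qed

text \<open>
  At a zero or pole of \<open>f\<close> the quotient \<open>f' / f\<close> has a pole.  So a half plane on which it is holomorphic
  lies to the right of the divisor.
\<close>

lemma logderiv_pole_at_divisor:
  assumes \<rho>: "\<rho> \<in> divisor_supp f" and op: "open U" "\<rho> \<in> U"
  shows "\<not> (\<lambda>s. deriv f s / f s) holomorphic_on U"
proof
  assume hol: "(\<lambda>s. deriv f s / f s) holomorphic_on U"
  have zo: "zorder f \<rho> \<noteq> 0" using \<rho> zorder_eq_0_iff_not_divisor by auto
  have iso: "isolated_singularity_at f \<rho>" "not_essential f \<rho>"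
    using mero[of "{\<rho>}"] by (auto simp: meromorphic_at_iff)
  have "frequently (\<lambda>w. deriv f w * f w \<noteq> 0) (at \<rho>)"
  proof (rule ccontr)
    assume "\<not> frequently (\<lambda>w. deriv f w * f w \<noteq> 0) (at \<rho>)"
    hence "eventually (\<lambda>w. deriv f w * f w = 0) (at \<rho>)" by (simp add: frequently_def)
    hence "eventually (\<lambda>w. deriv f w = 0 \<and> f w \<noteq> 0) (at \<rho>)"
      using ev_nonzero[of \<rho>] by eventually_elim auto
    then obtain e where e: "e > 0" "\<And>w. w \<in> ball \<rho> e - {\<rho>} \<Longrightarrow> deriv f w = 0 \<and> f w \<noteq> 0"
      by (auto simp: eventually_at dist_commute)
    have "f constant_on (ball \<rho> e - {\<rho>})"
    proof -
      have conn: "connected (ball \<rho> e - {\<rho>})" by (rule connected_punctured_ball) simp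
      have opn: "open (ball \<rho> e - {\<rho>})" by auto
      have "\<exists>c. \<forall>w\<in>ball \<rho> e - {\<rho>}. f w = c"
      proof (rule has_field_derivative_0_imp_constant_on[OF _ conn opn, unfolded constant_on_def])
        fix w assume w: "w \<in> ball \<rho> e - {\<rho>}"
        hence "f analytic_on {w}" using e(2) by (intro analytic_off_divisor) (auto simp: divisor_supp_eq)
        hence "f field_differentiable at w" by (simp add: analytic_at_imp_isCont analytic_on_imp_differentiable_at)
        thus "(f has_field_derivative 0) (at w)" using e(2)[OF w] field_differentiable_derivI by fastforce
      qed
      thus ?thesis by (simp add: constant_on_def)
    qed
    then obtain c where c: "\<And>w. w \<in> ball \<rho> e - {\<rho>} \<Longrightarrow> f w = c" by (auto simp: constant_on_def)
    have "ball \<rho> e - {\<rho>} \<noteq> {}" using e(1) by (metis Diff_eq_empty_iff not_open_singleton open_ball subset_singletonD ball_eq_empty not_le)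
    then obtain w where w: "w \<in> ball \<rho> e - {\<rho>}" by blast
    have "c \<noteq> 0" using c[OF w] e(2)[OF w] by simp
    have "zorder f \<rho> = zorder (\<lambda>_. c) \<rho>"
    proof (rule zorder_cong[OF _ refl])
      have "eventually (\<lambda>w. w \<in> ball \<rho> e - {\<rho>}) (at \<rho>)" using e(1) by (intro eventually_at_in_open) auto
      thus "eventually (\<lambda>w. f w = c) (at \<rho>)" by eventually_elim (rule c)
    qed
    thus False using zo \<open>c \<noteq> 0\<close> by simp
  qed
  hence "is_pole (\<lambda>s. deriv f s / f s) \<rho>" by (rule deriv_divide_is_pole[OF iso _ zo])
  thus False using not_is_pole_holomorphic[OF op hol] by blast
qed

text \<open>
  The inverse Laplace transform is taken along some admissible line; by \<open>logderiv_pole_at_divisor\<close> that line is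
  to the right of the divisor, so the expansion applies on it.
\<close>

lemma inverse_laplace_logderiv:
  assumes q: "logderiv_expansion q"
    and \<phi>: "test_function \<phi>"
  shows "inverse_laplace (\<lambda>s. deriv f s / f s) \<phi> = lld_distr q \<phi>"
proof -
  let ?F = "\<lambda>s. deriv f s / f s"
  obtain c0 n0 where "laplace_admissible ?F c0 n0" using laplace_admissible_exists[OF q] by blast
  then obtain c n where cn: "laplace_admissible ?F c n" "\<And>\<phi>. test_function \<phi> \<Longrightarrow> inverse_laplace ?F \<phi> = laplace_pairing ?F c \<phi>"
    by (rule inverse_laplace_eq_pairing) (rule that)
  obtain \<sigma> where \<sigma>: "0 < \<sigma>" "\<sigma> < c" "?F holomorphic_on {s. \<sigma> < Re s}"
    using cn(1) unfolding laplace_admissible_def by blast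
  have "Re \<rho> \<le> \<sigma>" if "\<rho> \<in> divisor_supp f" for \<rho>
    using logderiv_pole_at_divisor[OF that open_halfspace_Re_gt[of \<sigma>]] \<sigma>(3) by force
  moreover have "c > 0" using \<sigma> by linarith
  ultimately have "laplace_pairing ?F c \<phi> = lld_distr q \<phi>"
    by (intro laplace_pairing_logderiv[OF q _ _ \<sigma>(2) \<phi>])
  thus ?thesis using cn(2)[OF \<phi>] by simp
qed

end

section \<open>Derivatives of continuous functions\<close>

text \<open>
  The condition minimized by the order of a distribution, with the derivatives moved to the test function.
\<close>

definition nth_derivative :: "nat \<Rightarrow> distr \<Rightarrow> bool" where
  "nth_derivative n T \<longleftrightarrow>
     (\<exists>g. continuous_on UNIV g \<and> (\<forall>\<phi>. test_function \<phi> \<longrightarrow> T \<phi> = (-1) ^ n * (LINT t|lborel. g t * iter_deriv n \<phi> t)))"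

lemma distr_order_eq_Least: "distr_order T = (LEAST n. nth_derivative n T)"
  by (simp add: distr_order_def nth_derivative_def distr_eq_def distr_deriv_iterate distr_of_fun_def)

lemma nth_derivative_cong:
  assumes "\<And>\<phi>. test_function \<phi> \<Longrightarrow> T \<phi> = S \<phi>"
  shows "nth_derivative n T \<longleftrightarrow> nth_derivative n S"
  by (simp add: nth_derivative_def assms)

lemma nth_derivativeI:
  assumes "continuous_on UNIV g" "\<And>\<phi>. test_function \<phi> \<Longrightarrow> T \<phi> = (-1) ^ n * (LINT t|lborel. g t * iter_deriv n \<phi> t)"
  shows "nth_derivative n T"
  unfolding nth_derivative_def using assms by (intro exI[of _ g]) auto

lemma nth_derivativeE:
  assumes "nth_derivative n T"
  obtains g where "continuous_on UNIV g" "\<And>\<phi>. test_function \<phi> \<Longrightarrow> T \<phi> = (-1) ^ n * (LINT t|lborel. g t * iter_deriv n \<phi> t)"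
  using assms unfolding nth_derivative_def by metis

lemma nth_derivative_add:
  assumes "nth_derivative n T" "nth_derivative n S"
  shows "nth_derivative n (\<lambda>\<phi>. T \<phi> + S \<phi>)"
proof -
  obtain g where g: "continuous_on UNIV g" "\<And>\<phi>. test_function \<phi> \<Longrightarrow> T \<phi> = (-1) ^ n * (LINT t|lborel. g t * iter_deriv n \<phi> t)"
    by (rule nth_derivativeE[OF assms(1)]) (rule that)
  obtain h where h: "continuous_on UNIV h" "\<And>\<phi>. test_function \<phi> \<Longrightarrow> S \<phi> = (-1) ^ n * (LINT t|lborel. h t * iter_deriv n \<phi> t)"
    by (rule nth_derivativeE[OF assms(2)]) (rule that)
  show ?thesis
  proof (rule nth_derivativeI[of "\<lambda>t. g t + h t"])
    fix \<phi> assume \<phi>: "test_function \<phi>"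
    show "T \<phi> + S \<phi> = (-1) ^ n * (LINT t|lborel. (g t + h t) * iter_deriv n \<phi> t)"
      unfolding g(2)[OF \<phi>] h(2)[OF \<phi>] distrib_right
      by (subst Bochner_Integration.integral_add) (intro integrable_mult_test_function g h test_function_iter_deriv \<phi> | simp only: distrib_left)+
  qed (intro continuous_intros g h)
qed

lemma nth_derivative_cmult:
  assumes "nth_derivative n T"
  shows "nth_derivative n (\<lambda>\<phi>. a * T \<phi>)"
proof -
  obtain g where g: "continuous_on UNIV g" "\<And>\<phi>. test_function \<phi> \<Longrightarrow> T \<phi> = (-1) ^ n * (LINT t|lborel. g t * iter_deriv n \<phi> t)"
    by (rule nth_derivativeE[OF assms]) (rule that)
  show ?thesis
  proof (rule nth_derivativeI[of "\<lambda>t. a * g t"])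
    fix \<phi> assume \<phi>: "test_function \<phi>"
    show "a * T \<phi> = (-1) ^ n * (LINT t|lborel. (a * g t) * iter_deriv n \<phi> t)"
      unfolding g(2)[OF \<phi>] mult.assoc integral_mult_right_zero by (simp only: mult.left_commute)
  qed (intro continuous_intros g)
qed

lemma nth_derivative_zero: "nth_derivative n (\<lambda>_. 0)"
  by (rule nth_derivativeI[of "\<lambda>_. 0"]) auto

lemma nth_derivative_diff:
  assumes "nth_derivative n T" "nth_derivative n S"
  shows "nth_derivative n (\<lambda>\<phi>. T \<phi> - S \<phi>)"
  using nth_derivative_add[OF assms(1) nth_derivative_cmult[OF assms(2), of "-1"]] by simp

lemma nth_derivative_sum:
  assumes "\<And>x. x \<in> X \<Longrightarrow> nth_derivative n (T x)"
  shows "nth_derivative n (\<lambda>\<phi>. \<Sum>x\<in>X. T x \<phi>)"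
  using assms by (induction X rule: infinite_finite_induct) (auto intro: nth_derivative_zero nth_derivative_add)

lemma continuous_antiderivative:
  fixes g :: "real \<Rightarrow> complex"
  assumes "continuous_on UNIV g"
  obtains G where "\<And>t. (G has_vector_derivative g t) (at t)"
proof
  fix t :: real
  define a where "a = \<bar>t\<bar> + 1"
  have "((\<lambda>u. LBINT y=ereal 0..ereal u. g y) has_vector_derivative g t) (at t within {-a..a})"
    by (rule interval_integral_FTC2) (auto simp: a_def intro: continuous_on_subset[OF assms])
  moreover have "at t within {-a..a} = at t"
    by (rule at_within_interior) (auto simp: a_def)
  ultimately show "((\<lambda>u. LBINT y=ereal 0..ereal u. g y) has_vector_derivative g t) (at t)" by simp
qed

text \<open>
  Integration by parts against an antiderivative.  Hence a distribution of order \<open>n\<close> is an \<open>m\<close>-th derivative of a continuous function for all \<open>m \<ge> n\<close>.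
\<close>

lemma nth_derivative_Suc:
  assumes "nth_derivative n T"
  shows "nth_derivative (Suc n) T"
proof -
  obtain g where g: "continuous_on UNIV g" "\<And>\<phi>. test_function \<phi> \<Longrightarrow> T \<phi> = (-1) ^ n * (LINT t|lborel. g t * iter_deriv n \<phi> t)"
    by (rule nth_derivativeE[OF assms]) (rule that)
  obtain G where G: "\<And>t. (G has_vector_derivative g t) (at t)" by (rule continuous_antiderivative[OF g(1)]) (rule that)
  show ?thesis
  proof (rule nth_derivativeI[of G])
    show "continuous_on UNIV G"
      by (meson continuous_at_imp_continuous_on G has_vector_derivative_continuous)
    fix \<phi> assume \<phi>: "test_function \<phi>"
    have "(LINT t|lborel. G t * iter_deriv (Suc n) \<phi> t) = - (LINT t|lborel. g t * iter_deriv n \<phi> t)"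
      using integration_by_parts_test_function[OF G g(1) test_function_iter_deriv[OF \<phi>, of n]] by simp
    thus "T \<phi> = (-1) ^ Suc n * (LINT t|lborel. G t * iter_deriv (Suc n) \<phi> t)" using g(2)[OF \<phi>] by simp
  qed
qed

lemma nth_derivative_mono:
  assumes "nth_derivative n T" "n \<le> m"
  shows "nth_derivative m T"
  using assms(2,1) by (induction rule: dec_induct) (auto intro: nth_derivative_Suc)

lemma halfline_integral_vderiv:
  assumes \<phi>: "test_function \<phi>"
  shows "(LINT t|lborel. indicator {0..} t *\<^sub>R vderiv \<phi> t) = - \<phi> 0"
proof -
  obtain M where M: "M > 0" "\<And>t. \<bar>t\<bar> > M \<Longrightarrow> \<phi> t = 0" by (rule test_function_support[OF \<phi>]) (rule that)
  have "(LINT t|lborel. indicator {0..M+1} t *\<^sub>R vderiv \<phi> t) = \<phi> (M + 1) - \<phi> 0"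
    by (rule integral_FTC_Icc[OF _ has_vector_derivative_at_within[OF test_function_has_vderiv[OF \<phi>]]])
       (use M test_function_continuous[OF test_function_vderiv[OF \<phi>]] in auto)
  also have "(\<lambda>t. indicator {0..M+1} t *\<^sub>R vderiv \<phi> t) = (\<lambda>t. indicator {0..} t *\<^sub>R vderiv \<phi> t)"
  proof
    fix t
    show "indicator {0..M+1} t *\<^sub>R vderiv \<phi> t = indicator {0..} t *\<^sub>R vderiv \<phi> t"
      using vderiv_zero_outside[of M \<phi> t, OF M(2)] M(1) by (cases "\<bar>t\<bar> > M") (auto simp: indicator_def)
  qed
  also have "\<phi> (M + 1) = 0" using M by auto
  finally show ?thesis by simp
qed

lemma ramp_integral_vderiv:
  assumes \<phi>: "test_function \<phi>"
  shows "(LINT t|lborel. of_real (max t 0) * vderiv \<phi> t) = - (LINT t|lborel. indicator {0..} t *\<^sub>R \<phi> t)"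
proof -
  obtain M where M: "M > 0" "\<And>t. \<bar>t\<bar> > M \<Longrightarrow> \<phi> t = 0" by (rule test_function_support[OF \<phi>]) (rule that)
  have c: "continuous_on A \<phi>" "continuous_on A (vderiv \<phi>)" for A
    by (intro test_function_continuous \<phi> test_function_vderiv)+
  have "(LINT t|lborel. indicator {0..M+1} t *\<^sub>R (of_real t * vderiv \<phi> t + 1 * \<phi> t)) = of_real (M + 1) * \<phi> (M + 1) - of_real 0 * \<phi> 0"
  proof (rule integral_FTC_Icc)
    fix t assume "0 \<le> t" "t \<le> M + 1"
    have "((\<lambda>t. complex_of_real t) has_vector_derivative 1) (at t)"
      using has_vector_derivative_of_real[OF DERIV_ident] by simp
    from has_vector_derivative_mult[OF this test_function_has_vderiv[OF \<phi>]]
    show "((\<lambda>t. of_real t * \<phi> t) has_vector_derivative of_real t * vderiv \<phi> t + 1 * \<phi> t) (at t within {0..M + 1})"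
      by (rule has_vector_derivative_at_within)
  qed (use M in \<open>auto intro!: continuous_intros c\<close>)
  also have "\<dots> = 0" using M by auto
  also have "(\<lambda>t. indicator {0..M+1} t *\<^sub>R (of_real t * vderiv \<phi> t + 1 * \<phi> t)) =
      (\<lambda>t. of_real (max t 0) * vderiv \<phi> t + indicator {0..} t *\<^sub>R \<phi> t)"
  proof
    fix t
    show "indicator {0..M+1} t *\<^sub>R (of_real t * vderiv \<phi> t + 1 * \<phi> t) = of_real (max t 0) * vderiv \<phi> t + indicator {0..} t *\<^sub>R \<phi> t"
      using vderiv_zero_outside[of M \<phi> t, OF M(2)] M(1,2) by (cases "\<bar>t\<bar> > M") (auto simp: indicator_def max_def)
  qed
  also have "(LINT t|lborel. of_real (max t 0) * vderiv \<phi> t + indicator {0..} t *\<^sub>R \<phi> t) =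
      (LINT t|lborel. of_real (max t 0) * vderiv \<phi> t) + (LINT t|lborel. indicator {0..} t *\<^sub>R \<phi> t)"
    using integrable_halfline_mult_test_function[of "\<lambda>_. 1", OF _ \<phi>]
    by (intro Bochner_Integration.integral_add integrable_mult_test_function continuous_intros test_function_vderiv \<phi>) auto
  finally show ?thesis by (simp add: add_eq_0_iff2)
qed

lemma nth_derivative_heaviside: "nth_derivative 1 (\<lambda>\<phi>. LINT t|lborel. indicator {0..} t *\<^sub>R \<phi> t)"
  by (rule nth_derivativeI[of "\<lambda>t. of_real (max t 0)"]) (auto intro!: continuous_intros simp: ramp_integral_vderiv)

text \<open>
  The Dirac mass is the second derivative of the ramp \<open>max t 0\<close>.
\<close>

lemma nth_derivative_delta: "nth_derivative (k + 2) (\<lambda>\<phi>. (-1) ^ k * iter_deriv k \<phi> 0)"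
proof (rule nth_derivativeI[of "\<lambda>t. of_real (max t 0)"])
  fix \<phi> assume \<phi>: "test_function \<phi>"
  have k: "test_function (iter_deriv k \<phi>)" by (rule test_function_iter_deriv[OF \<phi>])
  show "(-1) ^ k * iter_deriv k \<phi> 0 = (-1) ^ (k + 2) * (LINT t|lborel. of_real (max t 0) * iter_deriv (k + 2) \<phi> t)"
    using ramp_integral_vderiv[OF test_function_vderiv[OF k]] halfline_integral_vderiv[OF k] by simp
qed (intro continuous_intros)

lemma iter_deriv_affine:
  assumes \<phi>: "test_function \<phi>"
  shows "iter_deriv n (\<lambda>t. \<phi> (m * t + a)) = (\<lambda>t. of_real m ^ n * iter_deriv n \<phi> (m * t + a))"
    "((\<lambda>t. of_real m ^ n * iter_deriv n \<phi> (m * t + a)) has_vector_derivative of_real m ^ Suc n * iter_deriv (Suc n) \<phi> (m * t + a)) (at t)"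
proof -
  have D: "((\<lambda>t. of_real m ^ n * iter_deriv n \<phi> (m * t + a)) has_vector_derivative of_real m ^ Suc n * iter_deriv (Suc n) \<phi> (m * t + a)) (at t)" for n t
  proof -
    have lin: "((\<lambda>t. m * t + a) has_vector_derivative m) (at t)"
      by (auto intro!: derivative_eq_intros simp flip: has_real_derivative_iff_has_vector_derivative)
    have "(iter_deriv n \<phi> has_vector_derivative vderiv (iter_deriv n \<phi>) (m * t + a)) (at (m * t + a))"
      by (rule test_function_has_vderiv[OF test_function_iter_deriv[OF \<phi>]])
    from has_vector_derivative_mult_right[OF vector_diff_chain_at[OF lin this], of "of_real m ^ n"]
    show ?thesis by (simp add: o_def scaleR_conv_of_real mult_ac)
  qed
  show "((\<lambda>t. of_real m ^ n * iter_deriv n \<phi> (m * t + a)) has_vector_derivative of_real m ^ Suc n * iter_deriv (Suc n) \<phi> (m * t + a)) (at t)"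
    by (rule D)
  show "iter_deriv n (\<lambda>t. \<phi> (m * t + a)) = (\<lambda>t. of_real m ^ n * iter_deriv n \<phi> (m * t + a))"
  proof (induction n)
    case (Suc n)
    have "iter_deriv (Suc n) (\<lambda>t. \<phi> (m * t + a)) = vderiv (\<lambda>t. of_real m ^ n * iter_deriv n \<phi> (m * t + a))"
      using Suc.IH by simp
    also have "\<dots> = (\<lambda>t. of_real m ^ Suc n * iter_deriv (Suc n) \<phi> (m * t + a))"
      unfolding vderiv_def[of "\<lambda>t. of_real m ^ n * iter_deriv n \<phi> (m * t + a)"] using vector_derivative_at[OF D[of n]] by (intro ext)
    finally show ?case .
  qed simp
qed

lemma test_function_affine:
  assumes \<phi>: "test_function \<phi>" and m: "m \<noteq> 0"
  shows "test_function (\<lambda>t. \<phi> (m * t + a))"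
  unfolding test_function_def
proof (intro conjI allI)
  show "iter_deriv n (\<lambda>t. \<phi> (m * t + a)) differentiable at t" for n t
    unfolding iter_deriv_affine(1)[OF \<phi>] by (rule differentiableI_vector[OF iter_deriv_affine(2)[OF \<phi>]])
  obtain M where M: "M > 0" "\<And>t. \<bar>t\<bar> > M \<Longrightarrow> \<phi> t = 0" by (rule test_function_support[OF \<phi>]) (rule that)
  define B where "B = (M + \<bar>a\<bar>) / \<bar>m\<bar>"
  show "\<exists>K. compact K \<and> (\<forall>t. t \<notin> K \<longrightarrow> \<phi> (m * t + a) = 0)"
  proof (intro exI[of _ "{-B..B}"] conjI allI impI M(2))
    fix t assume "t \<notin> {-B..B}"
    hence "\<bar>t\<bar> > B" by auto
    hence "\<bar>m\<bar> * \<bar>t\<bar> > M + \<bar>a\<bar>" using m by (simp add: B_def field_simps)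
    thus "M < \<bar>m * t + a\<bar>" using abs_triangle_ineq2_sym[of a "m * t + a"] abs_triangle_ineq4[of "m * t + a" a] by (simp add: abs_mult)
  qed auto
qed

text \<open>
  Seen at scale \<open>1 / (j + 1)\<close>, a continuous function looks constant near 0.
\<close>

lemma shrinking_limit:
  assumes g: "continuous_on UNIV g" and \<psi>: "test_function \<psi>"
  shows "(\<lambda>j. LINT x|lborel. g (x / real (Suc j)) * \<psi> x) \<longlonglongrightarrow> g 0 * (LINT x|lborel. \<psi> x)"
proof -
  obtain M where M: "M > 0" "\<And>t. \<bar>t\<bar> > M \<Longrightarrow> \<psi> t = 0" by (rule test_function_support[OF \<psi>]) (rule that)
  have "compact (g ` {-M..M})" by (intro compact_continuous_image continuous_on_subset[OF g]) auto
  then obtain B where B: "\<And>y. y \<in> g ` {-M..M} \<Longrightarrow> norm y \<le> B"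
    using compact_imp_bounded[of "g ` {-M..M}"] unfolding bounded_iff by blast
  have c\<psi>: "continuous_on UNIV \<psi>" by (rule test_function_continuous[OF \<psi>])
  have cg: "continuous_on UNIV (\<lambda>x. g (x / real (Suc j)))" for j
    by (rule continuous_on_compose2[OF g]) (auto intro!: continuous_intros)
  have "(\<lambda>j. LINT x|lborel. g (x / real (Suc j)) * \<psi> x) \<longlonglongrightarrow> (LINT x|lborel. g 0 * \<psi> x)"
  proof (rule integral_dominated_convergence[where w = "\<lambda>x. norm (of_real B * \<psi> x)"])
    show "(\<lambda>x. g 0 * \<psi> x) \<in> borel_measurable lborel"
      by (simp, intro borel_measurable_continuous_onI continuous_intros c\<psi>)
    show "(\<lambda>x. g (x / real (Suc j)) * \<psi> x) \<in> borel_measurable lborel" for j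
      by (simp del: of_nat_Suc, intro borel_measurable_continuous_onI continuous_intros c\<psi> cg)
    show "integrable lborel (\<lambda>x. norm (of_real B * \<psi> x))"
      by (intro integrable_norm integrable_mult_test_function \<psi> continuous_intros)
    show "AE x in lborel. (\<lambda>j. g (x / real (Suc j)) * \<psi> x) \<longlonglongrightarrow> g 0 * \<psi> x"
    proof (intro AE_I2 tendsto_mult tendsto_const)
      fix x :: real
      have "(\<lambda>j. x * inverse (real (Suc j))) \<longlonglongrightarrow> x * 0" by (intro tendsto_intros LIMSEQ_inverse_real_of_nat)
      hence "(\<lambda>j. x / real (Suc j)) \<longlonglongrightarrow> 0" by (simp add: divide_inverse del: of_nat_Suc)
      moreover have "isCont g 0" using g by (simp add: continuous_on_eq_continuous_at)
      ultimately show "(\<lambda>j. g (x / real (Suc j))) \<longlonglongrightarrow> g 0" by (rule isCont_tendsto_compose[rotated])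
    qed
    show "AE x in lborel. norm (g (x / real (Suc j)) * \<psi> x) \<le> norm (of_real B * \<psi> x)" for j
    proof (intro AE_I2)
      fix x :: real
      show "norm (g (x / real (Suc j)) * \<psi> x) \<le> norm (of_real B * \<psi> x)"
      proof (cases "\<bar>x\<bar> > M")
        case False
        have "\<bar>x\<bar> / real (Suc j) \<le> \<bar>x\<bar> / 1" by (intro divide_left_mono) auto
        hence "\<bar>x / real (Suc j)\<bar> \<le> M" using False by (simp add: abs_divide del: of_nat_Suc)
        hence "x / real (Suc j) \<in> {-M..M}" unfolding atLeastAtMost_iff by linarith
        hence "norm (g (x / real (Suc j))) \<le> B" by (intro B imageI)
        hence "norm (g (x / real (Suc j))) \<le> norm (complex_of_real B)" by simp
        thus ?thesis unfolding norm_mult by (rule mult_right_mono) simp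
      qed (use M in auto)
    qed
  qed
  thus ?thesis by (simp only: integral_mult_right_zero)
qed

lemma integral_shrink:
  "(LINT t|lborel. h (real (Suc j) * t)) = (1 / of_nat (Suc j)) * (LINT x|lborel. h x :: complex)"
proof -
  have "(LINT x|lborel. h x) = \<bar>real (Suc j)\<bar> *\<^sub>R (LINT t|lborel. h (0 + real (Suc j) * t))"
    by (rule lborel_integral_real_affine) auto
  thus ?thesis by (simp add: scaleR_conv_of_real del: of_nat_Suc)
qed

lemma shrink_pairing:
  assumes "test_function \<phi>"
  shows "of_nat (Suc j) * (LINT t|lborel. g t * \<phi> (real (Suc j) * t)) = (LINT x|lborel. g (x / real (Suc j)) * \<phi> x)"
  using integral_shrink[of "\<lambda>x. g (x / real (Suc j)) * \<phi> x" j] by (simp del: of_nat_Suc)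

lemma integral_vderiv_eq_0:
  assumes "test_function \<phi>"
  shows "(LINT t|lborel. vderiv \<phi> t) = 0"
  using integration_by_parts_test_function[of "\<lambda>_. 1" "\<lambda>_. 0", OF _ _ assms] by simp

text \<open>
  If \<open>T\<close> is the derivative of order \<open>n + 1\<close> of \<open>g\<close>, scaling the test function by \<open>m = j + 1\<close> yields
  \<open>m ^ (n + 1)\<close> from the derivatives and \<open>1 / m\<close> from the change of variables.  What remains tends to \<open>g 0\<close>
  times the integral of a derivative of \<open>\<phi>\<close>, that is, to 0.  This is what makes lower bounds for orders of
  distributions possible.
\<close>

lemma nth_derivative_shrink_limit:
  assumes T: "nth_derivative (Suc n) T" and \<phi>: "test_function \<phi>"
  shows "(\<lambda>j. T (\<lambda>t. \<phi> (real (Suc j) * t)) / of_nat (Suc j) ^ n) \<longlonglongrightarrow> 0"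
proof -
  obtain g where g: "continuous_on UNIV g" "\<And>\<phi>. test_function \<phi> \<Longrightarrow> T \<phi> = (-1) ^ Suc n * (LINT t|lborel. g t * iter_deriv (Suc n) \<phi> t)"
    by (rule nth_derivativeE[OF T]) (rule that)
  let ?\<psi> = "iter_deriv (Suc n) \<phi>"
  have \<psi>: "test_function ?\<psi>" by (rule test_function_iter_deriv[OF \<phi>])
  have eq: "T (\<lambda>t. \<phi> (real (Suc j) * t)) / of_nat (Suc j) ^ n = (-1) ^ Suc n * (LINT x|lborel. g (x / real (Suc j)) * ?\<psi> x)" for j
  proof -
    have "test_function (\<lambda>t. \<phi> (real (Suc j) * t))" using test_function_affine[OF \<phi>, of "real (Suc j)" 0] by simp
    hence "T (\<lambda>t. \<phi> (real (Suc j) * t)) = (-1) ^ Suc n * (LINT t|lborel. g t * iter_deriv (Suc n) (\<lambda>t. \<phi> (real (Suc j) * t)) t)" by (rule g(2))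
    also have "iter_deriv (Suc n) (\<lambda>t. \<phi> (real (Suc j) * t)) = (\<lambda>t. of_nat (Suc j) ^ Suc n * ?\<psi> (real (Suc j) * t))"
      using iter_deriv_affine(1)[OF \<phi>, of "Suc n" "real (Suc j)" 0] by (simp only: add_0_right of_real_of_nat_eq)
    also have "(LINT t|lborel. g t * (of_nat (Suc j) ^ Suc n * ?\<psi> (real (Suc j) * t))) = of_nat (Suc j) ^ n * (of_nat (Suc j) * (LINT t|lborel. g t * ?\<psi> (real (Suc j) * t)))"
      by (simp only: mult.left_commute[of "g _"] integral_mult_right_zero power_Suc2 mult.assoc)
    also have "of_nat (Suc j) * (LINT t|lborel. g t * ?\<psi> (real (Suc j) * t)) = (LINT x|lborel. g (x / real (Suc j)) * ?\<psi> x)"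
      by (rule shrink_pairing[OF \<psi>])
    finally show ?thesis by (simp del: of_nat_Suc)
  qed
  have "(\<lambda>j. (-1) ^ Suc n * (LINT x|lborel. g (x / real (Suc j)) * ?\<psi> x)) \<longlonglongrightarrow> (-1) ^ Suc n * (g 0 * (LINT x|lborel. ?\<psi> x))"
    by (intro tendsto_mult tendsto_const shrinking_limit g \<psi>)
  moreover have "(LINT x|lborel. ?\<psi> x) = 0" using integral_vderiv_eq_0[OF test_function_iter_deriv[OF \<phi>, of n]] by simp
  ultimately show ?thesis by (simp only: eq mult_zero_right)
qed

section \<open>A smooth bump function\<close>

text \<open>
  Functions that vanish for \<open>x \<le> 0\<close> and are flat at 0, in a family closed under differentiation, which
  makes them smooth.
\<close>

definition flat_fun :: "real poly \<Rightarrow> real \<Rightarrow> real" where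
  "flat_fun p x = (if x > 0 then poly p (1 / x) * exp (- (1 / x)) else 0)"

lemma poly_exp_decay: "((\<lambda>y. poly p y * exp (- y)) \<longlongrightarrow> (0::real)) at_top"
proof -
  have "((\<lambda>y. \<Sum>i\<le>degree p. coeff p i * (y ^ i / exp y)) \<longlongrightarrow> (\<Sum>i\<le>degree p. coeff p i * 0)) at_top"
    by (intro tendsto_intros tendsto_power_div_exp_0)
  thus ?thesis by (simp add: poly_altdef sum_distrib_right exp_minus divide_inverse mult.assoc)
qed

lemma flat_fun_tendsto_0: "((flat_fun p) \<longlongrightarrow> 0) (at 0)"
proof (rule filterlim_split_at)
  have "((\<lambda>x. poly p (inverse x) * exp (- inverse x)) \<longlongrightarrow> 0) (at_right (0::real))"
    by (rule filterlim_compose[OF poly_exp_decay filterlim_inverse_at_top_right])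
  moreover have "eventually (\<lambda>x. poly p (inverse x) * exp (- inverse x) = flat_fun p x) (at_right (0::real))"
    using eventually_at_right_less[of 0] by eventually_elim (simp add: flat_fun_def inverse_eq_divide)
  ultimately show "filterlim (flat_fun p) (nhds 0) (at_right 0)" by (rule Lim_transform_eventually)
  have "eventually (\<lambda>x. 0 = flat_fun p x) (at_left (0::real))"
    by (auto simp: eventually_at_filter flat_fun_def)
  thus "filterlim (flat_fun p) (nhds 0) (at_left 0)" by (rule Lim_transform_eventually[OF tendsto_const])
qed

lemma flat_fun_has_derivative:
  "(flat_fun p has_real_derivative flat_fun ((p - pderiv p) * [:0, 0, 1:]) x) (at x)"
proof (cases x "0::real" rule: linorder_cases)
  case less
  have "eventually (\<lambda>y. y \<in> {..<0}) (nhds x)" using less by (intro eventually_nhds_in_open) auto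
  hence "eventually (\<lambda>y. flat_fun p y = 0) (nhds x)" by eventually_elim (simp add: flat_fun_def)
  from iffD2[OF DERIV_cong_ev[OF refl this refl] DERIV_const] have "(flat_fun p has_real_derivative 0) (at x)" .
  moreover have "flat_fun ((p - pderiv p) * [:0, 0, 1:]) x = 0" using less by (simp add: flat_fun_def)
  ultimately show ?thesis by (simp only:)
next
  case greater
  have "eventually (\<lambda>y. y \<in> {0<..}) (nhds x)" using greater by (intro eventually_nhds_in_open) auto
  hence ev: "eventually (\<lambda>y. flat_fun p y = poly p (1 / y) * exp (- (1 / y))) (nhds x)" by eventually_elim (simp add: flat_fun_def)
  have inv: "((\<lambda>y. 1 / y) has_real_derivative - (1 / x\<^sup>2)) (at x)"
    using greater by (auto intro!: derivative_eq_intros simp: power2_eq_square)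
  have "((\<lambda>y. poly p (1 / y) * exp (- (1 / y))) has_real_derivative
      (poly (pderiv p) (1 / x) * (- (1 / x\<^sup>2))) * exp (- (1 / x)) + (exp (- (1 / x)) * - (- (1 / x\<^sup>2))) * poly p (1 / x)) (at x)"
    by (intro DERIV_mult DERIV_fun_exp DERIV_minus inv DERIV_chain2[OF poly_DERIV inv])
  moreover have "(poly (pderiv p) (1 / x) * (- (1 / x\<^sup>2))) * exp (- (1 / x)) + (exp (- (1 / x)) * - (- (1 / x\<^sup>2))) * poly p (1 / x)
      = flat_fun ((p - pderiv p) * [:0, 0, 1:]) x"
    using greater by (simp add: flat_fun_def algebra_simps power2_eq_square)
  ultimately show ?thesis using DERIV_cong_ev[OF refl ev refl] by simp
next
  case equal
  have "((\<lambda>h. (flat_fun p (0 + h) - flat_fun p 0) / h) \<longlongrightarrow> 0) (at 0)"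
  proof (rule Lim_transform_eventually[OF flat_fun_tendsto_0[of "p * [:0, 1:]"]])
    show "eventually (\<lambda>h. flat_fun (p * [:0, 1:]) h = (flat_fun p (0 + h) - flat_fun p 0) / h) (at 0)"
      by (auto simp: eventually_at_filter flat_fun_def)
  qed
  thus ?thesis using equal by (simp add: DERIV_def flat_fun_def)
qed

text \<open>
  The span of products of a flat function at 0 and one at 1 is closed under differentiation, so its members
  are smooth; they are supported in the unit interval.
\<close>

inductive_set bump_span :: "(real \<Rightarrow> complex) set" where
  prod: "(\<lambda>x. of_real (flat_fun p x * flat_fun q (1 - x))) \<in> bump_span"
| add: "g \<in> bump_span \<Longrightarrow> h \<in> bump_span \<Longrightarrow> (\<lambda>x. g x + h x) \<in> bump_span"

lemma bump_span_derivative: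
  assumes "g \<in> bump_span"
  shows "\<exists>g'\<in>bump_span. \<forall>t. (g has_vector_derivative g' t) (at t)"
  using assms
proof induction
  case (prod p q)
  let ?d = "\<lambda>p. (p - pderiv p) * [:0, 0, 1:]"
  let ?g' = "\<lambda>x. complex_of_real (flat_fun (?d p) x * flat_fun q (1 - x)) + of_real (flat_fun (- p) x * flat_fun (?d q) (1 - x))"
  have "((\<lambda>x. complex_of_real (flat_fun p x * flat_fun q (1 - x))) has_vector_derivative ?g' t) (at t)" for t
  proof -
    have lin: "((\<lambda>x. 1 - x) has_real_derivative - 1) (at t)" by (auto intro!: derivative_eq_intros)
    have "((\<lambda>x. flat_fun p x * flat_fun q (1 - x)) has_real_derivative
        flat_fun (?d p) t * flat_fun q (1 - t) + (flat_fun (?d q) (1 - t) * - 1) * flat_fun p t) (at t)"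
      by (rule DERIV_mult[OF flat_fun_has_derivative DERIV_chain2[OF flat_fun_has_derivative lin]])
    moreover have "(flat_fun (?d q) (1 - t) * - 1) * flat_fun p t = flat_fun (- p) t * flat_fun (?d q) (1 - t)"
      by (simp add: flat_fun_def)
    ultimately show ?thesis by (simp only: of_real_add[symmetric] has_vector_derivative_of_real)
  qed
  moreover have "?g' \<in> bump_span" by (intro bump_span.add bump_span.prod)
  ultimately show ?case by (intro bexI[of _ ?g'] allI)
next
  case (add g h)
  obtain g' h' where g': "g' \<in> bump_span" "\<forall>t. (g has_vector_derivative g' t) (at t)"
    and h': "h' \<in> bump_span" "\<forall>t. (h has_vector_derivative h' t) (at t)"
    using add.IH by (elim bexE)
  show ?case
    using g'(2) h'(2)
    by (intro bexI[of _ "\<lambda>x. g' x + h' x"] allI has_vector_derivative_add bump_span.add g'(1) h'(1)) simp_all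
qed

lemma bump_span_iter_deriv: "g \<in> bump_span \<Longrightarrow> iter_deriv n g \<in> bump_span"
proof (induction n)
  case (Suc n)
  obtain g' where g': "g' \<in> bump_span" "\<And>t. (iter_deriv n g has_vector_derivative g' t) (at t)"
    using bump_span_derivative[OF Suc.IH[OF Suc.prems]] by blast
  have "iter_deriv (Suc n) g = g'" using vector_derivative_at[OF g'(2)] by (simp add: vderiv_def fun_eq_iff)
  thus ?case using g'(1) by simp
qed simp

definition bump :: "real \<Rightarrow> real" where
  "bump x = flat_fun 1 x * flat_fun 1 (1 - x)"

lemma bump_pos: "0 < x \<Longrightarrow> x < 1 \<Longrightarrow> bump x > 0"
  and bump_nonneg: "bump x \<ge> 0"
  and bump_zero: "x \<le> 0 \<or> x \<ge> 1 \<Longrightarrow> bump x = 0"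
  by (auto simp: bump_def flat_fun_def)

lemma test_function_bump: "test_function (\<lambda>x. of_real (bump x))"
  unfolding test_function_def
proof (intro conjI allI)
  fix n t
  have "iter_deriv n (\<lambda>x. of_real (bump x)) \<in> bump_span"
    unfolding bump_def by (intro bump_span_iter_deriv bump_span.prod)
  from bump_span_derivative[OF this] show "iter_deriv n (\<lambda>x. of_real (bump x)) differentiable at t"
    using differentiableI_vector by blast
  show "\<exists>K. compact K \<and> (\<forall>t. t \<notin> K \<longrightarrow> complex_of_real (bump t) = 0)"
    by (intro exI[of _ "{0..1}"]) (auto simp: bump_zero)
qed

lemma integral_bump_nonzero: "(LINT t|lborel. complex_of_real (bump t)) \<noteq> 0"
proof -
  have int: "integrable lborel bump"
  proof -
    have "integrable lborel (\<lambda>t. Re (1 * complex_of_real (bump t)))"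
      by (intro integrable_Re integrable_mult_test_function test_function_bump continuous_intros)
    thus ?thesis by simp
  qed
  have "(LINT t|lborel. bump t) \<noteq> 0"
  proof
    assume "(LINT t|lborel. bump t) = 0"
    hence "AE t in lborel. bump t = 0" using integral_nonneg_eq_0_iff_AE[OF int] bump_nonneg by simp
    moreover have "continuous_on UNIV bump"
    proof -
      have "continuous_on UNIV (\<lambda>t. Re (complex_of_real (bump t)))"
        by (intro continuous_intros test_function_continuous test_function_bump)
      thus ?thesis by simp
    qed
    ultimately have "emeasure lborel {t. bump t \<noteq> 0} = 0"
      by (subst (asm) AE_iff_measurable[OF _ refl]) (auto intro!: borel_open open_Collect_neq continuous_intros)
    moreover have "emeasure lborel {0<..<1::real} \<le> emeasure lborel {t. bump t \<noteq> 0}"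
    proof (rule emeasure_mono)
      show "{0<..<1} \<subseteq> {t. bump t \<noteq> 0}" using bump_pos by (force)
      show "{t. bump t \<noteq> 0} \<in> sets lborel"
        using \<open>continuous_on UNIV bump\<close> by (auto intro!: borel_open open_Collect_neq continuous_intros)
    qed
    ultimately show False by simp
  qed
  thus ?thesis by (simp add: integral_complex_of_real)
qed

lemma iter_deriv_zero_imp_zero:
  assumes "test_function \<phi>" "\<And>t. iter_deriv k \<phi> t = 0"
  shows "\<phi> t = 0"
  using assms
proof (induction k arbitrary: \<phi> t)
  case (Suc k)
  have z: "vderiv \<phi> t = 0" for t
    by (rule Suc.IH[OF test_function_vderiv[OF Suc.prems(1)]]) (use Suc.prems(2) in \<open>simp add: funpow_swap1\<close>)
  obtain M where M: "M > 0" "\<And>t. \<bar>t\<bar> > M \<Longrightarrow> \<phi> t = 0" by (rule test_function_support[OF Suc.prems(1)]) (rule that)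
  have "\<exists>c. \<forall>x\<in>UNIV. \<phi> x = c"
  proof (rule has_vector_derivative_zero_constant[OF convex_UNIV])
    show "(\<phi> has_vector_derivative 0) (at x within UNIV)" for x
      using test_function_has_vderiv[OF Suc.prems(1), of x] z by simp
  qed blast
  then obtain c where "\<And>x. \<phi> x = c" by blast
  moreover have "\<phi> (M + 1) = 0" using M by auto
  ultimately show ?case by simp
qed simp

text \<open>
  Some derivative value of the bump is nonzero, since a compactly supported function with vanishing \<open>k\<close>-th
  derivative vanishes; translate that point to 0.
\<close>

lemma test_function_with_nonzero_jet:
  obtains \<phi> where "test_function \<phi>" "iter_deriv k \<phi> 0 \<noteq> 0"
proof -
  let ?b = "\<lambda>x. complex_of_real (bump x)"
  have "bump (1 / 2) > 0" by (rule bump_pos) auto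
  hence "\<not> (\<forall>t. iter_deriv k ?b t = 0)"
    using iter_deriv_zero_imp_zero[OF test_function_bump, of k "1 / 2"] by auto
  then obtain a where a: "iter_deriv k ?b a \<noteq> 0" by blast
  have "iter_deriv k (\<lambda>t. ?b (1 * t + a)) 0 = iter_deriv k ?b a"
    unfolding iter_deriv_affine(1)[OF test_function_bump] by simp
  with a show ?thesis by (intro that[of "\<lambda>t. ?b (1 * t + a)"] test_function_affine test_function_bump) auto
qed

section \<open>The distributional vertical order\<close>

context lld_fun
begin

text \<open>
  Each part separately: the derivatives of the Dirac mass have order \<open>k + 2 \<le> degree Q + 1\<close>, the Heaviside
  function has order 1, and \<open>D \<le> degree Q + 1\<close> by the hypothesis on the convergence exponent.
\<close>

lemma lld_distr_nth_derivative:
  assumes "conv_exponent f \<le> degree Q"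
  shows "nth_derivative (Suc (degree Q)) (lld_distr (pderiv Q))"
proof -
  have d: "nth_derivative (Suc (degree Q)) (\<lambda>\<phi>. coeff (pderiv Q) k * ((-1) ^ k * iter_deriv k \<phi> 0))" if k: "k \<le> degree (pderiv Q)" for k
  proof (cases "degree Q = 0")
    case True
    hence "pderiv Q = 0" by (simp add: pderiv_eq_0_iff)
    thus ?thesis by (simp add: nth_derivative_zero)
  next
    case False
    hence "k + 2 \<le> Suc (degree Q)" using k degree_pderiv[of Q] by linarith
    thus ?thesis by (intro nth_derivative_cmult nth_derivative_mono[OF nth_derivative_delta])
  qed
  have h: "nth_derivative (Suc (degree Q)) (\<lambda>\<phi>. of_int (zorder f 0) * (LINT t|lborel. indicator {0..} t *\<^sub>R \<phi> t))"
    by (intro nth_derivative_cmult nth_derivative_mono[OF nth_derivative_heaviside]) simp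
  have w: "nth_derivative (Suc (degree Q)) (\<lambda>\<phi>. (-1) ^ D * (LINT t|lborel. nc_fun t * iter_deriv D \<phi> t))"
    by (rule nth_derivative_mono[OF nth_derivativeI[OF continuous_nc_fun refl]])
       (use assms in \<open>simp add: prim_genus_def\<close>)
  show ?thesis
    unfolding lld_distr_def[abs_def]
    by (intro nth_derivative_add nth_derivative_sum h w) (use d in auto)
qed

text \<open>
  The Dirac terms of index \<open>k < m\<close> have order \<open>k + 2 \<le> m + 1\<close>, and \<open>D \<le> m + 1\<close> because both 1 and the
  convergence exponent are at most \<open>degree Q\<close>.
\<close>

lemma lld_distr_principal_part:
  assumes "conv_exponent f \<le> degree Q" "degree Q = Suc m"
  shows "nth_derivative (Suc m) (\<lambda>\<phi>. lld_distr (pderiv Q) \<phi> - coeff (pderiv Q) m * ((-1) ^ m * iter_deriv m \<phi> 0))"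
proof -
  let ?q = "pderiv Q"
  have dq: "degree ?q = m" using assms(2) degree_pderiv[of Q] by simp
  have d: "nth_derivative (Suc m) (\<lambda>\<phi>. coeff ?q k * ((-1) ^ k * iter_deriv k \<phi> 0))" if k: "k < m" for k
    by (intro nth_derivative_cmult nth_derivative_mono[OF nth_derivative_delta]) (use k in simp)
  have h: "nth_derivative (Suc m) (\<lambda>\<phi>. of_int (zorder f 0) * (LINT t|lborel. indicator {0..} t *\<^sub>R \<phi> t))"
    by (intro nth_derivative_cmult nth_derivative_mono[OF nth_derivative_heaviside]) simp
  have w: "nth_derivative (Suc m) (\<lambda>\<phi>. (-1) ^ D * (LINT t|lborel. nc_fun t * iter_deriv D \<phi> t))"
    by (rule nth_derivative_mono[OF nth_derivativeI[OF continuous_nc_fun refl]])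
       (use assms in \<open>simp add: prim_genus_def\<close>)
  have "nth_derivative (Suc m) (\<lambda>\<phi>. (\<Sum>k\<in>{..<m}. coeff ?q k * ((-1) ^ k * iter_deriv k \<phi> 0))
     + of_int (zorder f 0) * (LINT t|lborel. indicator {0..} t *\<^sub>R \<phi> t)
     + (-1) ^ D * (LINT t|lborel. nc_fun t * iter_deriv D \<phi> t))"
    by (intro nth_derivative_add nth_derivative_sum h w) (use d in auto)
  moreover have "lld_distr ?q \<phi> - coeff ?q m * ((-1) ^ m * iter_deriv m \<phi> 0) = (\<Sum>k\<in>{..<m}. coeff ?q k * ((-1) ^ k * iter_deriv k \<phi> 0))
     + of_int (zorder f 0) * (LINT t|lborel. indicator {0..} t *\<^sub>R \<phi> t)
     + (-1) ^ D * (LINT t|lborel. nc_fun t * iter_deriv D \<phi> t)" for \<phi>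
    unfolding lld_distr_def dq lessThan_Suc_atMost[symmetric] sum.lessThan_Suc by (simp only: algebra_simps)
  ultimately show ?thesis by (simp only:)
qed

text \<open>
  Testing at small scale isolates the leading coefficient of \<open>Q'\<close>.
\<close>

lemma lld_distr_shrink_limit:
  assumes Q: "conv_exponent f \<le> degree Q" "degree Q = Suc m" and \<phi>: "test_function \<phi>"
  shows "(\<lambda>j. lld_distr (pderiv Q) (\<lambda>t. \<phi> (real (Suc j) * t)) / of_nat (Suc j) ^ m) \<longlonglongrightarrow> coeff (pderiv Q) m * ((-1) ^ m * iter_deriv m \<phi> 0)"
proof -
  let ?c = "coeff (pderiv Q) m"
  have "(\<lambda>j. (lld_distr (pderiv Q) (\<lambda>t. \<phi> (real (Suc j) * t)) - ?c * ((-1) ^ m * iter_deriv m (\<lambda>t. \<phi> (real (Suc j) * t)) 0)) / of_nat (Suc j) ^ m) \<longlonglongrightarrow> 0"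
    by (rule nth_derivative_shrink_limit[OF lld_distr_principal_part[OF Q] \<phi>])
  moreover have "iter_deriv m (\<lambda>t. \<phi> (real (Suc j) * t)) 0 = of_nat (Suc j) ^ m * iter_deriv m \<phi> 0" for j
    using fun_cong[OF iter_deriv_affine(1)[OF \<phi>, of m "real (Suc j)" 0], of 0] by (simp only: add_0_right mult_zero_right of_real_of_nat_eq)
  hence "(lld_distr (pderiv Q) (\<lambda>t. \<phi> (real (Suc j) * t)) - ?c * ((-1) ^ m * iter_deriv m (\<lambda>t. \<phi> (real (Suc j) * t)) 0)) / of_nat (Suc j) ^ m
     = lld_distr (pderiv Q) (\<lambda>t. \<phi> (real (Suc j) * t)) / of_nat (Suc j) ^ m - ?c * ((-1) ^ m * iter_deriv m \<phi> 0)" for j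
    by (simp add: diff_divide_distrib del: of_nat_Suc)
  ultimately have "(\<lambda>j. lld_distr (pderiv Q) (\<lambda>t. \<phi> (real (Suc j) * t)) / of_nat (Suc j) ^ m - ?c * ((-1) ^ m * iter_deriv m \<phi> 0)) \<longlonglongrightarrow> 0"
    by (simp only:)
  from tendsto_add[OF this tendsto_const[of "?c * ((-1) ^ m * iter_deriv m \<phi> 0)"]] show ?thesis by simp
qed

text \<open>
  Otherwise the limits of \<open>nth_derivative_shrink_limit\<close> and \<open>lld_distr_shrink_limit\<close> would agree and the leading
  coefficient of \<open>Q'\<close> would be 0.
\<close>

lemma lld_distr_not_lower_order:
  assumes Q: "conv_exponent f \<le> degree Q" "degree Q = Suc m"
  shows "\<not> nth_derivative (Suc m) (lld_distr (pderiv Q))"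
proof
  assume T: "nth_derivative (Suc m) (lld_distr (pderiv Q))"
  obtain \<phi> where \<phi>: "test_function \<phi>" "iter_deriv m \<phi> 0 \<noteq> 0" by (rule test_function_with_nonzero_jet) (rule that)
  have "coeff (pderiv Q) m * ((-1) ^ m * iter_deriv m \<phi> 0) = 0"
    by (rule LIMSEQ_unique[OF lld_distr_shrink_limit[OF Q \<phi>(1)] nth_derivative_shrink_limit[OF T \<phi>(1)]])
  moreover have "coeff (pderiv Q) m \<noteq> 0"
  proof -
    have "degree (pderiv Q) = m" "pderiv Q \<noteq> 0" using Q(2) degree_pderiv[of Q] by (auto simp: pderiv_eq_0_iff)
    thus ?thesis using leading_coeff_neq_0 by blast
  qed
  ultimately show False using \<phi>(2) by simp
qed

text \<open>
  With exponent 0 the sum counts the divisor with multiplicity.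
\<close>

lemma finite_divisor_of_conv_exponent_0:
  assumes "conv_exponent f = 0"
  shows "finite D0"
proof (rule ccontr)
  assume inf: "infinite D0"
  let ?t = "\<lambda>\<rho>. real_of_int \<bar>zorder f \<rho>\<bar> / norm \<rho> ^ 0"
  have s: "?t summable_on D0" by (rule divisor_summable) (simp add: assms)
  obtain k :: nat where k: "infsum ?t D0 < real k" using reals_Archimedean2 by blast
  obtain X where X: "finite X" "card X = k" "X \<subseteq> D0" using infinite_arbitrarily_large[OF inf] by blast
  have "real k = (\<Sum>\<rho>\<in>X. 1)" using X by simp
  also have "\<dots> \<le> sum ?t X"
  proof (rule sum_mono)
    fix \<rho> assume "\<rho> \<in> X"
    hence "zorder f \<rho> \<noteq> 0" using X zorder_eq_0_iff_not_divisor by auto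
    thus "1 \<le> ?t \<rho>" by simp
  qed
  also have "\<dots> \<le> infsum ?t D0" by (rule finite_sum_le_infsum[OF s X(1,3)]) simp
  finally show False using k by simp
qed

text \<open>
  For a finite divisor the first derivative of each \<open>nc_term\<close> is again a function, with a jump of size
  \<open>zorder f \<rho>\<close> at 0.  So the distribution is \<open>N\<close> times the Heaviside function plus a continuous function, where
  \<open>N\<close> is the degree of the divisor, and it can only be a continuous function if there is no jump.
\<close>

lemma divisor_degree_zero_of_function_distr:
  assumes conv: "conv_exponent f = 0" and T: "nth_derivative 0 (lld_distr 0)"
  shows "(\<Sum>\<rho>\<in>insert 0 D0. zorder f \<rho>) = 0"
proof -
  have fin: "finite D0" by (rule finite_divisor_of_conv_exponent_0[OF conv])
  have pg: "prim_genus = 0" using conv by (simp add: prim_genus_def)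
  let ?H = "\<lambda>\<phi>. LINT t|lborel. indicator {0..} t *\<^sub>R \<phi> t"
  define N where "N = of_int (zorder f 0) + (\<Sum>\<rho>\<in>D0. complex_of_int (zorder f \<rho>))"
  have one: "(-1) * (LINT t|lborel. nc_term \<rho> t * vderiv \<phi> t) =
      of_int (zorder f \<rho>) * ?H \<phi> + (LINT t|lborel. (\<rho> * nc_term \<rho> t) * \<phi> t)"
    if \<rho>: "\<rho> \<in> D0" and \<phi>: "test_function \<phi>" for \<rho> \<phi>
  proof -
    define c where "c = \<bar>Re \<rho>\<bar> + 1"
    have c: "c > 0" "Re \<rho> < c" by (auto simp: c_def)
    have "laplace_pairing (\<lambda>s. logderiv_term s \<rho>) c \<phi> = (-1) ^ D * (LINT t|lborel. nc_term \<rho> t * iter_deriv D \<phi> t)"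
      by (rule integrable_logderiv_term(2)[OF \<phi> c]) (use \<rho> in simp)
    hence "(-1) * (LINT t|lborel. nc_term \<rho> t * vderiv \<phi> t) = laplace_pairing (\<lambda>s. logderiv_term s \<rho>) c \<phi>"
      by (simp add: pg)
    also have "\<dots> = laplace_pairing (\<lambda>s. of_int (zorder f \<rho>) * (1 / (s - \<rho>))) c \<phi>"
      by (rule laplace_pairing_cong) (simp add: logderiv_term_def pg)
    also have "\<dots> = of_int (zorder f \<rho>) * (LINT t|lborel. indicator {0..} t *\<^sub>R exp (\<rho> * of_real t) * \<phi> t)"
      by (simp only: laplace_pairing_cmult laplace_pairing_pole[OF \<phi> c])
    also have "\<dots> = (LINT t|lborel. of_int (zorder f \<rho>) * (indicator {0..} t *\<^sub>R \<phi> t) + (\<rho> * nc_term \<rho> t) * \<phi> t)"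
    proof -
      have "of_int (zorder f \<rho>) * (indicator {0..} t *\<^sub>R exp (\<rho> * of_real t) * \<phi> t) =
         of_int (zorder f \<rho>) * (indicator {0..} t *\<^sub>R \<phi> t) + (\<rho> * nc_term \<rho> t) * \<phi> t" for t :: real
        using \<rho> by (cases "t \<ge> 0") (simp_all add: nc_term_def pg max_def algebra_simps)
      thus ?thesis by (simp only: integral_mult_right_zero[symmetric])
    qed
    also have "\<dots> = (LINT t|lborel. of_int (zorder f \<rho>) * (indicator {0..} t *\<^sub>R \<phi> t)) + (LINT t|lborel. (\<rho> * nc_term \<rho> t) * \<phi> t)"
      using integrable_halfline_mult_test_function[of "\<lambda>_. 1", OF _ \<phi>]
      by (intro Bochner_Integration.integral_add integrable_mult_right integrable_mult_test_function continuous_intros continuous_nc_term \<phi>) auto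
    finally show ?thesis by (simp only: integral_mult_right_zero)
  qed
  have T_eq: "lld_distr 0 \<phi> = N * ?H \<phi> + (\<Sum>\<rho>\<in>D0. LINT t|lborel. (\<rho> * nc_term \<rho> t) * \<phi> t)" if \<phi>: "test_function \<phi>" for \<phi>
  proof -
    have "(LINT t|lborel. nc_fun t * vderiv \<phi> t) = (LINT t|lborel. (\<Sum>\<rho>\<in>D0. nc_term \<rho> t * vderiv \<phi> t))"
      using fin by (simp add: nc_fun_def sum_distrib_right)
    also have "\<dots> = (\<Sum>\<rho>\<in>D0. LINT t|lborel. nc_term \<rho> t * vderiv \<phi> t)"
      by (intro Bochner_Integration.integral_sum integrable_mult_test_function continuous_nc_term test_function_vderiv \<phi>)
    finally have "(-1) * (LINT t|lborel. nc_fun t * vderiv \<phi> t) = (\<Sum>\<rho>\<in>D0. (-1) * (LINT t|lborel. nc_term \<rho> t * vderiv \<phi> t))"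
      by (simp only: sum_distrib_left)
    also have "\<dots> = (\<Sum>\<rho>\<in>D0. of_int (zorder f \<rho>) * ?H \<phi> + (LINT t|lborel. (\<rho> * nc_term \<rho> t) * \<phi> t))"
      by (intro sum.cong refl one \<phi>)
    finally show ?thesis
      by (simp add: lld_distr_def pg N_def sum.distrib sum_distrib_right distrib_right)
  qed
  have "nth_derivative 0 (\<lambda>\<phi>. \<Sum>\<rho>\<in>D0. LINT t|lborel. (\<rho> * nc_term \<rho> t) * \<phi> t)"
  proof (rule nth_derivative_sum)
    fix \<rho>
    show "nth_derivative 0 (\<lambda>\<phi>. LINT t|lborel. (\<rho> * nc_term \<rho> t) * \<phi> t)"
      by (rule nth_derivativeI[of "\<lambda>t. \<rho> * nc_term \<rho> t"]) (auto intro!: continuous_intros continuous_nc_term)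
  qed
  from nth_derivative_diff[OF T this] have "nth_derivative 0 (\<lambda>\<phi>. N * ?H \<phi>)"
    by (rule iffD1[OF nth_derivative_cong, rotated]) (simp add: T_eq)
  then obtain h where h: "continuous_on UNIV h" "\<And>\<phi>. test_function \<phi> \<Longrightarrow> N * ?H \<phi> = (-1) ^ 0 * (LINT t|lborel. h t * iter_deriv 0 \<phi> t)"
    by (rule nth_derivativeE) (rule that)
  (* A multiple of the Heaviside function is invariant under scaling, while the continuous function \<open>h\<close> that
     represents it becomes constant under scaling. *)
  have key: "N * ?H \<phi> = h 0 * (LINT t|lborel. \<phi> t)" if \<phi>: "test_function \<phi>" for \<phi>
  proof (rule LIMSEQ_unique)
    show "(\<lambda>j. LINT x|lborel. h (x / real (Suc j)) * \<phi> x) \<longlonglongrightarrow> h 0 * (LINT t|lborel. \<phi> t)"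
      by (rule shrinking_limit[OF h(1) \<phi>])
    have "(LINT x|lborel. h (x / real (Suc j)) * \<phi> x) = N * ?H \<phi>" for j
    proof -
      have t: "test_function (\<lambda>t. \<phi> (real (Suc j) * t))" using test_function_affine[OF \<phi>, of "real (Suc j)" 0] by simp
      have "(LINT x|lborel. h (x / real (Suc j)) * \<phi> x) = of_nat (Suc j) * (LINT t|lborel. h t * \<phi> (real (Suc j) * t))"
        by (rule shrink_pairing[OF \<phi>, symmetric])
      also have "(LINT t|lborel. h t * \<phi> (real (Suc j) * t)) = N * ?H (\<lambda>t. \<phi> (real (Suc j) * t))"
        using h(2)[OF t] by simp
      also have "of_nat (Suc j) * (N * ?H (\<lambda>t. \<phi> (real (Suc j) * t))) = N * (of_nat (Suc j) * (LINT t|lborel. indicator {0..} t * \<phi> (real (Suc j) * t)))"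
        by (simp add: scaleR_conv_of_real of_real_indicator mult.left_commute del: of_nat_Suc)
      also have "of_nat (Suc j) * (LINT t|lborel. indicator {0..} t * \<phi> (real (Suc j) * t)) = (LINT x|lborel. indicator {0..} (x / real (Suc j)) * \<phi> x)"
        by (rule shrink_pairing[OF \<phi>])
      also have "\<dots> = ?H \<phi>"
        by (intro Bochner_Integration.integral_cong refl) (auto simp: indicator_def zero_le_divide_iff)
      finally show ?thesis .
    qed
    thus "(\<lambda>j. LINT x|lborel. h (x / real (Suc j)) * \<phi> x) \<longlonglongrightarrow> N * ?H \<phi>" by (simp only: tendsto_const)
  qed
  (* The bump lives on the positive axis; shifted by 1 it lives on the negative axis, where the Heaviside
     function is 0. *)
  let ?I = "LINT t|lborel. complex_of_real (bump t)"
  have "N * ?I = h 0 * ?I"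
  proof -
    have "?H (\<lambda>t. complex_of_real (bump t)) = ?I"
      by (intro Bochner_Integration.integral_cong refl) (auto simp: indicator_def bump_zero)
    thus ?thesis using key[OF test_function_bump] by simp
  qed
  moreover have "0 = h 0 * ?I"
  proof -
    have t: "test_function (\<lambda>t. complex_of_real (bump (1 * t + 1)))" by (rule test_function_affine[OF test_function_bump]) simp
    have "?H (\<lambda>t. complex_of_real (bump (1 * t + 1))) = (LINT t::real|lborel. 0)"
      by (intro Bochner_Integration.integral_cong refl) (auto simp: indicator_def bump_zero)
    moreover have "(LINT t|lborel. complex_of_real (bump (1 * t + 1))) = ?I"
      using lborel_integral_real_affine[of 1 "\<lambda>t. complex_of_real (bump t)" 1] by (simp add: add.commute)
    ultimately show ?thesis using key[OF t] by simp
  qed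
  ultimately have "N = 0" using integral_bump_nonzero by simp
  hence "complex_of_int (zorder f 0 + (\<Sum>\<rho>\<in>D0. zorder f \<rho>)) = 0" by (simp add: N_def)
  hence "zorder f 0 + (\<Sum>\<rho>\<in>D0. zorder f \<rho>) = 0" by (simp only: of_int_eq_0_iff)
  moreover have notin: "0 \<notin> D0" by simp
  ultimately show ?thesis unfolding sum.insert[OF fin notin] by simp
qed

text \<open>
  The factorization is then a finite product of linear factors; those with positive multiplicity make the
  numerator and those with negative multiplicity the denominator.
\<close>

lemma rational_of_conv_exponent_0:
  assumes conv: "conv_exponent f = 0" and Q: "hadamard_factorization f Q" "degree Q = 0"
  obtains P R :: "complex poly" where "P \<noteq> 0" "R \<noteq> 0" "f = (\<lambda>s. poly P s / poly R s)"
    "int (degree P) - int (degree R) = (\<Sum>\<rho>\<in>insert 0 D0. zorder f \<rho>)"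
proof -
  have fin: "finite (insert 0 D0)" using finite_divisor_of_conv_exponent_0[OF conv] by simp
  define lin where "lin \<rho> = (if \<rho> = 0 then [:0, 1:] else [:1, - 1 / \<rho>:] :: complex poly)" for \<rho>
  have lin: "lin \<rho> \<noteq> 0" "degree (lin \<rho>) = 1" "poly (lin \<rho>) s = root_factor \<rho> s" for \<rho> s
    by (auto simp: lin_def root_factor_def)
  obtain e where e: "Q = [:e:]" using Q(2) by (rule degree_eq_zeroE)
  define P where "P = smult (exp e) (\<Prod>\<rho>\<in>insert 0 D0. lin \<rho> ^ nat (zorder f \<rho>))"
  define R where "R = (\<Prod>\<rho>\<in>insert 0 D0. lin \<rho> ^ nat (- zorder f \<rho>))"
  have deg: "degree (\<Prod>\<rho>\<in>insert 0 D0. lin \<rho> ^ k \<rho>) = (\<Sum>\<rho>\<in>insert 0 D0. k \<rho>)" for k :: "complex \<Rightarrow> nat"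
    by (subst degree_prod_sum_eq) (simp_all only: lin degree_power_eq power_eq_0_iff mult_1_right not_False_eq_True simp_thms)
  have PR: "P \<noteq> 0" "R \<noteq> 0" using lin fin by (auto simp: P_def R_def prod_zero_iff)
  have "f s = poly P s / poly R s" for s
  proof -
    define g where "g X = s powi zorder f 0 * exp (poly Q s) * (\<Prod>\<rho>\<in>X. weierstrass_factor (conv_exponent f - 1) (s / \<rho>) powi zorder f \<rho>)" for X
    have "(g \<longlongrightarrow> f s) (finite_subsets_at_top D0)"
      using Q(1) unfolding hadamard_factorization_def g_def by blast
    moreover have "(g \<longlongrightarrow> g D0) (finite_subsets_at_top D0)"
      using fin by (intro tendsto_eventually) (simp add: eventually_finite_subsets_at_top_finite)
    ultimately have "f s = g D0" by (rule tendsto_unique[OF finite_subsets_at_top_neq_bot])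
    hence "f s = s powi zorder f 0 * exp e * (\<Prod>\<rho>\<in>D0. weierstrass_factor 0 (s / \<rho>) powi zorder f \<rho>)"
      using conv e by (simp add: g_def)
    also have "(\<Prod>\<rho>\<in>D0. weierstrass_factor 0 (s / \<rho>) powi zorder f \<rho>) = (\<Prod>\<rho>\<in>D0. root_factor \<rho> s powi zorder f \<rho>)"
      by (intro prod.cong refl) (auto simp: weierstrass_factor_def root_factor_def)
    also have "s powi zorder f 0 * exp e * (\<Prod>\<rho>\<in>D0. root_factor \<rho> s powi zorder f \<rho>) = exp e * (\<Prod>\<rho>\<in>insert 0 D0. root_factor \<rho> s powi zorder f \<rho>)"
    proof -
      have D: "finite D0" "0 \<notin> D0" using fin by auto
      have r0: "root_factor 0 s = s" by (simp add: root_factor_def)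
      show ?thesis unfolding prod.insert[OF D] r0 by (simp only: mult_ac)
    qed
    also have "(\<Prod>\<rho>\<in>insert 0 D0. root_factor \<rho> s powi zorder f \<rho>) =
        (\<Prod>\<rho>\<in>insert 0 D0. root_factor \<rho> s ^ nat (zorder f \<rho>) / root_factor \<rho> s ^ nat (- zorder f \<rho>))"
      by (intro prod.cong refl) (auto simp: power_int_def power_inverse divide_inverse)
    finally show ?thesis by (simp only: P_def R_def prod_dividef poly_smult poly_prod poly_power lin times_divide_eq_right)
  qed
  moreover have "int (degree P) - int (degree R) = (\<Sum>\<rho>\<in>insert 0 D0. zorder f \<rho>)"
  proof -
    have "int (degree P) - int (degree R) = (\<Sum>\<rho>\<in>insert 0 D0. int (nat (zorder f \<rho>)) - int (nat (- zorder f \<rho>)))"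
      by (simp only: P_def R_def degree_smult_eq exp_not_eq_zero if_False deg of_nat_sum sum_subtractf)
    also have "\<dots> = (\<Sum>\<rho>\<in>insert 0 D0. zorder f \<rho>)" by (intro sum.cong refl) auto
    finally show ?thesis .
  qed
  ultimately show ?thesis using PR by (intro that[of P R]) auto
qed

text \<open>
  The upper bound is \<open>lld_distr_nth_derivative\<close>; the lower bound is \<open>lld_distr_not_lower_order\<close> when \<open>Q\<close> is not
  constant, and the jump of the distribution at 0 when it is.  A vanishing jump means that numerator and
  denominator of the rational function \<open>f\<close> have the same degree.
\<close>

theorem vertical_order_eq:
  assumes Q: "hadamard_factorization f Q" "conv_exponent f \<le> degree Q"
    and q: "logderiv_expansion (pderiv Q)"
    and rat: "\<not> rational_finite_at_infinity f"
  shows "vertical_order f = Suc (degree Q)"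
proof -
  have nc: "nth_derivative n (inverse_laplace (\<lambda>s. deriv f s / f s)) \<longleftrightarrow> nth_derivative n (lld_distr (pderiv Q))" for n
    by (rule nth_derivative_cong) (rule inverse_laplace_logderiv, rule q)
  have "vertical_order f = (LEAST n. nth_derivative n (inverse_laplace (\<lambda>s. deriv f s / f s)))"
    by (simp only: vertical_order_def distr_order_eq_Least)
  also have "\<dots> = (LEAST n. nth_derivative n (lld_distr (pderiv Q)))"
    by (simp only: nc)
  also have "\<dots> = Suc (degree Q)"
  proof (rule Least_equality)
    show "nth_derivative (Suc (degree Q)) (lld_distr (pderiv Q))" by (rule lld_distr_nth_derivative[OF Q(2)])
    fix n assume n: "nth_derivative n (lld_distr (pderiv Q))"
    show "Suc (degree Q) \<le> n"
    proof (rule ccontr)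
      assume "\<not> Suc (degree Q) \<le> n"
      hence T: "nth_derivative (degree Q) (lld_distr (pderiv Q))" by (intro nth_derivative_mono[OF n]) simp
      show False
      proof (cases "degree Q")
        case (Suc m)
        thus False using lld_distr_not_lower_order[OF Q(2) Suc] T by simp
      next
        case 0
        have conv: "conv_exponent f = 0" using Q(2) 0 by simp
        have "pderiv Q = 0" using 0 by (simp add: pderiv_eq_0_iff)
        hence "nth_derivative 0 (lld_distr 0)" using T 0 by simp
        hence z: "(\<Sum>\<rho>\<in>insert 0 D0. zorder f \<rho>) = 0" by (rule divisor_degree_zero_of_function_distr[OF conv])
        obtain P R :: "complex poly" where PR: "P \<noteq> 0" "R \<noteq> 0" "f = (\<lambda>s. poly P s / poly R s)"
          "int (degree P) - int (degree R) = (\<Sum>\<rho>\<in>insert 0 D0. zorder f \<rho>)"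
          by (rule rational_of_conv_exponent_0[OF conv Q(1) 0]) (rule that)
        have "degree P = degree R" using PR(4) z by linarith
        thus False using rat PR(1-3) unfolding rational_finite_at_infinity_def by blast
      qed
    qed
  qed
  finally show ?thesis .
qed

end

section \<open>Dirichlet series\<close>

text \<open>
  The rate is the smallest frequency of the series; the terms are compared with those at \<open>\<sigma>\<close>, where the
  series converges absolutely.
\<close>

lemma dirichlet_series_near_1:
  assumes "dirichlet_series f"
  obtains \<delta> B \<sigma> where "\<delta> > 0" "B \<ge> 0" "\<And>s. \<sigma> < Re s \<Longrightarrow> norm (f s - 1) \<le> B * exp (- (\<delta> * Re s))"
proof -
  obtain I :: "nat set" and a :: "nat \<Rightarrow> complex" and l :: "nat \<Rightarrow> real" and \<sigma> :: real where
    I: "(\<exists>N. I = {1..N}) \<or> (I = {1..} \<and> filterlim l at_top sequentially)"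
    and l: "strict_mono_on I l" "\<forall>n\<in>I. 0 < l n"
    and sm: "(\<lambda>n. norm (a n) * exp (- l n * \<sigma>)) summable_on I"
    and f: "\<forall>s. \<sigma> < Re s \<longrightarrow> f s = 1 + (\<Sum>\<^sub>\<infinity>n\<in>I. a n * exp (- of_real (l n) * s))"
    using assms unfolding dirichlet_series_def by blast
  (* The index set is empty or starts at 1; a constant series allows any positive rate. *)
  define \<delta> where "\<delta> = (if 1 \<in> I then l 1 else 1)"
  have \<delta>: "\<delta> > 0" using l(2) by (auto simp: \<delta>_def)
  have l\<delta>: "\<delta> \<le> l n" if n: "n \<in> I" for n
  proof -
    have "1 \<in> I" "1 \<le> n" using I n by auto
    thus ?thesis using strict_mono_onD[OF l(1), of 1 n] n by (cases "n = 1") (auto simp: \<delta>_def)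
  qed
  define B where "B = (\<Sum>\<^sub>\<infinity>n\<in>I. norm (a n) * exp (- l n * \<sigma>))"
  have B0: "B \<ge> 0" unfolding B_def by (intro infsum_nonneg) auto
  have "norm (f s - 1) \<le> (B * exp (\<delta> * \<sigma>)) * exp (- (\<delta> * Re s))" if s: "\<sigma> < Re s" for s
  proof -
    have t: "norm (a n * exp (- of_real (l n) * s)) \<le> norm (a n) * exp (- l n * \<sigma>) * exp (- \<delta> * (Re s - \<sigma>))" if n: "n \<in> I" for n
    proof -
      have "\<delta> * (Re s - \<sigma>) \<le> l n * (Re s - \<sigma>)" using l\<delta>[OF n] s by (intro mult_right_mono) auto
      hence "- (l n * Re s) \<le> - l n * \<sigma> + - \<delta> * (Re s - \<sigma>)" by (simp add: algebra_simps)
      hence "exp (- (l n * Re s)) \<le> exp (- l n * \<sigma>) * exp (- \<delta> * (Re s - \<sigma>))" by (simp only: exp_add[symmetric] exp_le_cancel_iff)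
      thus ?thesis unfolding norm_mult mult.assoc by (intro mult_left_mono) auto
    qed
    have sum2: "(\<lambda>n. norm (a n) * exp (- l n * \<sigma>) * exp (- \<delta> * (Re s - \<sigma>))) summable_on I"
      by (rule summable_on_cmult_left[OF sm])
    have "norm (f s - 1) = norm (\<Sum>\<^sub>\<infinity>n\<in>I. a n * exp (- of_real (l n) * s))" using f s by simp
    also have "\<dots> \<le> (\<Sum>\<^sub>\<infinity>n\<in>I. norm (a n) * exp (- l n * \<sigma>) * exp (- \<delta> * (Re s - \<sigma>)))"
    proof (rule norm_infsum_le[OF _ has_sum_infsum[OF sum2] t])
      have "(\<lambda>n. norm (a n * exp (- of_real (l n) * s))) summable_on I"
        by (rule Infinite_Sum.abs_summable_on_comparison_test'[OF sum2 t])
      thus "((\<lambda>n. a n * exp (- of_real (l n) * s)) has_sum (\<Sum>\<^sub>\<infinity>n\<in>I. a n * exp (- of_real (l n) * s))) I"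
        by (rule has_sum_infsum[OF abs_summable_summable])
    qed
    also have "\<dots> = B * exp (- \<delta> * (Re s - \<sigma>))" unfolding B_def by (rule infsum_cmult_left) (use sm in simp)
    also have "\<dots> = (B * exp (\<delta> * \<sigma>)) * exp (- (\<delta> * Re s))"
      by (simp only: mult.assoc exp_add[symmetric]) (simp add: algebra_simps)
    finally show ?thesis .
  qed
  thus ?thesis by (intro that[of \<delta> "B * exp (\<delta> * \<sigma>)" \<sigma>]) (use \<delta> B0 in auto)
qed

lemma exp_decay_eventually_small:
  fixes \<delta> B e :: real
  assumes "\<delta> > 0" "e > 0"
  shows "eventually (\<lambda>x. B * exp (- (\<delta> * x)) < e) at_top"
proof -
  have "((\<lambda>x. exp (- (\<delta> * x))) \<longlongrightarrow> 0) at_top"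
    using assms(1)
    by (intro filterlim_compose[OF exp_at_bot] filterlim_uminus_at_bot_at_top[THEN filterlim_compose]
        filterlim_tendsto_pos_mult_at_top[OF tendsto_const _ filterlim_ident])
  from tendsto_mult[OF tendsto_const[of B] this] have "((\<lambda>x. B * exp (- (\<delta> * x))) \<longlongrightarrow> 0) at_top" by simp
  thus ?thesis using assms(2) by (rule order_tendstoD(2))
qed

lemma poly_mult_exp_decay:
  assumes "\<delta> > 0"
  shows "((\<lambda>x. (1 + x) ^ k * exp (- (\<delta> * x))) \<longlongrightarrow> (0::real)) at_top"
proof -
  have lim: "filterlim (\<lambda>x::real. \<delta> * (1 + x)) at_top at_top"
    by (intro filterlim_tendsto_pos_mult_at_top[OF tendsto_const assms] filterlim_tendsto_add_at_top[OF tendsto_const filterlim_ident])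
  have "((\<lambda>x. (exp \<delta> / \<delta> ^ k) * ((\<delta> * (1 + x)) ^ k / exp (\<delta> * (1 + x)))) \<longlongrightarrow> (exp \<delta> / \<delta> ^ k) * 0) at_top"
    by (intro tendsto_mult tendsto_const filterlim_compose[OF tendsto_power_div_exp_0 lim])
  moreover have "(exp \<delta> / \<delta> ^ k) * ((\<delta> * (1 + x)) ^ k / exp (\<delta> * (1 + x))) = (1 + x) ^ k * exp (- (\<delta> * x))" for x
  proof -
    have "exp (\<delta> * (1 + x)) = exp \<delta> * exp (\<delta> * x)" by (simp add: distrib_left exp_add)
    moreover have "(exp \<delta> / \<delta> ^ k) * ((\<delta> ^ k * y) / (exp \<delta> * z)) = y / z" for y z using assms by simp
    ultimately show ?thesis by (simp only: power_mult_distrib exp_minus divide_inverse[symmetric])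
  qed
  ultimately show ?thesis by simp
qed

text \<open>
  A nonconstant polynomial tends to infinity in absolute value.
\<close>

lemma poly_tendsto_0_imp_0:
  fixes p :: "complex poly"
  assumes "((\<lambda>x::real. poly p (of_real x)) \<longlongrightarrow> 0) at_top"
  shows "p = 0"
proof -
  obtain a r where p: "p = pCons a r" by (rule pCons_cases)
  have "r = 0"
  proof (rule ccontr)
    assume "r \<noteq> 0"
    then obtain x0 where x0: "\<And>z. x0 \<le> norm z \<Longrightarrow> 1 \<le> norm (poly (pCons a r) z)" using poly_infinity[of r 1 a] by blast
    have "eventually (\<lambda>x::real. norm (poly p (of_real x)) < 1) at_top"
      using order_tendstoD(2)[OF tendsto_norm_zero[OF assms], of 1] by simp
    hence "eventually (\<lambda>x::real. False) at_top"
      using eventually_ge_at_top[of "max x0 0"]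
    proof eventually_elim
      case (elim x)
      have "1 \<le> norm (poly (pCons a r) (of_real x))" by (rule x0) (use elim in simp)
      thus False using elim p by simp
    qed
    thus False by simp
  qed
  moreover have "a = 0"
  proof -
    have lim: "((\<lambda>x::real. a) \<longlongrightarrow> 0) at_top" using assms p \<open>r = 0\<close> by simp
    show ?thesis by (rule tendsto_unique[OF trivial_limit_at_top_linorder tendsto_const lim])
  qed
  ultimately show ?thesis using p by simp
qed

lemma hadamard_type_iff: "hadamard_type f \<longleftrightarrow> weierstrass_genus f \<le> hadamard_genus f"
  by (auto simp: hadamard_type_def genus_def)

text \<open>
  The transform of a test function supported in \<open>\<bar>t\<bar> \<le> \<eta>\<close> grows at most like \<open>exp (\<eta> c)\<close> on the line
  \<open>Re s = c\<close>, which the decay of \<open>F\<close> outweighs for \<open>\<eta> < \<delta>\<close>.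
\<close>

lemma laplace_pairing_tendsto_0:
  assumes F: "\<delta> > 0" "B \<ge> 0" "\<And>s. \<sigma> < Re s \<Longrightarrow> norm (F s) \<le> B * exp (- (\<delta> * Re s))"
    and \<phi>: "test_function \<phi>" and \<eta>: "\<eta> < \<delta>" "\<And>t. \<bar>t\<bar> > \<eta> \<Longrightarrow> \<phi> t = 0"
  shows "((\<lambda>c. laplace_pairing F c \<phi>) \<longlongrightarrow> 0) at_top"
proof (rule Lim_null_comparison)
  define K where "K = (LINT t|lborel. norm (iter_deriv 2 \<phi> t))"
  define J where "J = (LINT u|lborel. 1 / (1 + u\<^sup>2) :: real)"
  define A where "A = 1 / (2 * pi) * (B * (K * J))"
  have \<psi>: "test_function (iter_deriv 2 \<phi>)" by (rule test_function_iter_deriv[OF \<phi>])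
  have \<psi>0: "iter_deriv 2 \<phi> t = 0" if "\<bar>t\<bar> > \<eta>" for t
  proof -
    have "vderiv \<phi> t = 0" if "\<bar>t\<bar> > \<eta>" for t using vderiv_zero_outside[of \<eta> \<phi>, OF \<eta>(2) that] .
    from vderiv_zero_outside[of \<eta> "vderiv \<phi>", OF this \<open>\<bar>t\<bar> > \<eta>\<close>] show ?thesis by (simp add: numeral_2_eq_2)
  qed
  have int1: "integrable lborel (\<lambda>u::real. 1 / (1 + u\<^sup>2))" using integrable_inverse_sum_squares[of 1] by simp
  have int\<psi>: "integrable lborel (iter_deriv 2 \<phi>)"
    using integrable_mult_test_function[of "\<lambda>_. 1", OF _ \<psi>] by simp
  have K0: "K \<ge> 0" unfolding K_def by (intro Bochner_Integration.integral_nonneg) auto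
  show "eventually (\<lambda>c. norm (laplace_pairing F c \<phi>) \<le> A * exp (- ((\<delta> - \<eta>) * c))) at_top"
    using eventually_gt_at_top[of "max 1 \<sigma>"]
  proof eventually_elim
    case (elim c)
    hence c: "c > 1" "c > \<sigma>" by auto
    have ft: "norm (exp_transform \<phi> (Complex c u)) \<le> exp (\<eta> * c) * K * (1 / (1 + u\<^sup>2))" for u
    proof -
      have "norm (exp_transform (iter_deriv 2 \<phi>) (Complex c u)) \<le> (LINT t|lborel. exp (c * t) * norm (iter_deriv 2 \<phi> t))"
        using norm_exp_transform_le[OF \<psi>, of "Complex c u"] by simp
      also have "\<dots> \<le> (LINT t|lborel. exp (\<eta> * c) * norm (iter_deriv 2 \<phi> t))"
      proof (rule integral_mono)
        have "integrable lborel (\<lambda>t. norm (exp (of_real (c * t)) * iter_deriv 2 \<phi> t))"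
          by (intro integrable_norm integrable_exp_mult_test_function \<psi>)
        thus "integrable lborel (\<lambda>t. exp (c * t) * norm (iter_deriv 2 \<phi> t))" by (simp add: norm_mult)
        show "integrable lborel (\<lambda>t. exp (\<eta> * c) * norm (iter_deriv 2 \<phi> t))"
          by (intro integrable_mult_right integrable_norm int\<psi>)
        show "exp (c * t) * norm (iter_deriv 2 \<phi> t) \<le> exp (\<eta> * c) * norm (iter_deriv 2 \<phi> t)" for t
        proof (cases "\<bar>t\<bar> > \<eta>")
          case False
          hence "c * t \<le> \<eta> * c" using c by (simp add: mult.commute[of \<eta>])
          thus ?thesis by (intro mult_right_mono) auto
        qed (simp add: \<psi>0)
      qed
      also have "\<dots> = exp (\<eta> * c) * K" by (simp add: K_def)
      finally have "norm (Complex c u) ^ 2 * norm (exp_transform \<phi> (Complex c u)) \<le> exp (\<eta> * c) * K"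
        by (simp only: exp_transform_iter_deriv[OF \<phi>] norm_mult norm_power norm_minus_cancel)
      moreover have "(1 + u\<^sup>2) * norm (exp_transform \<phi> (Complex c u)) \<le> norm (Complex c u) ^ 2 * norm (exp_transform \<phi> (Complex c u))"
        unfolding norm_Complex_sq using c by (intro mult_right_mono add_mono) (auto intro: one_le_power)
      ultimately have "(1 + u\<^sup>2) * norm (exp_transform \<phi> (Complex c u)) \<le> exp (\<eta> * c) * K" by linarith
      moreover have "1 + u\<^sup>2 > 0" by (simp add: add_pos_nonneg)
      ultimately show ?thesis by (simp add: pos_le_divide_eq mult.commute)
    qed
    have bd: "norm (F (Complex c u) * exp_transform \<phi> (Complex c u)) \<le> B * exp (- (\<delta> * c)) * (exp (\<eta> * c) * K * (1 / (1 + u\<^sup>2)))" for u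
      unfolding norm_mult using F(3)[of "Complex c u"] c by (intro mult_mono ft) (auto intro!: mult_nonneg_nonneg F(2))
    have "norm (LINT u|lborel. F (Complex c u) * exp_transform \<phi> (Complex c u)) \<le>
        (LINT u|lborel. B * exp (- (\<delta> * c)) * (exp (\<eta> * c) * K * (1 / (1 + u\<^sup>2))))"
    proof (cases "integrable lborel (\<lambda>u. F (Complex c u) * exp_transform \<phi> (Complex c u))")
      case True
      show ?thesis
        by (rule Bochner_Integration.integral_norm_bound_integral[OF True]) (intro integrable_mult_right int1, rule bd)
    next
      case False
      have "0 \<le> (LINT u|lborel. B * exp (- (\<delta> * c)) * (exp (\<eta> * c) * K * (1 / (1 + u\<^sup>2))))"
        using F(2) K0 by (intro Bochner_Integration.integral_nonneg mult_nonneg_nonneg) auto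
      thus ?thesis by (simp add: not_integrable_integral_eq[OF False])
    qed
    also have "\<dots> = B * exp (- (\<delta> * c)) * (exp (\<eta> * c) * K * J)"
      by (simp only: integral_mult_right_zero J_def)
    also have "\<dots> = B * (K * J) * (exp (- (\<delta> * c)) * exp (\<eta> * c))" by (simp only: mult_ac)
    also have "exp (- (\<delta> * c)) * exp (\<eta> * c) = exp (- ((\<delta> - \<eta>) * c))" by (simp add: algebra_simps flip: exp_add)
    finally have "norm (laplace_pairing F c \<phi>) \<le> 1 / (2 * pi) * (B * (K * J) * exp (- ((\<delta> - \<eta>) * c)))"
      unfolding laplace_pairing_def norm_mult by (intro mult_mono) (auto simp: norm_divide)
    thus ?case by (simp only: A_def mult.assoc)
  qed
  have "((\<lambda>c. exp (- ((\<delta> - \<eta>) * c))) \<longlongrightarrow> 0) at_top"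
    using poly_mult_exp_decay[of "\<delta> - \<eta>" 0] \<eta>(1) by simp
  from tendsto_mult[OF tendsto_const this, of A] show "((\<lambda>c. A * exp (- ((\<delta> - \<eta>) * c))) \<longlongrightarrow> 0) at_top" by simp
qed

context lld_fun
begin

text \<open>
  Cauchy's estimate on discs of radius 1/2 bounds \<open>f'\<close> by \<open>f - 1\<close>; far to the right \<open>\<bar>f\<bar> \<ge> 1/2\<close>.
\<close>

lemma logderiv_exp_decay:
  assumes "\<delta> > 0" "B \<ge> 0" and near: "\<And>s. \<sigma> < Re s \<Longrightarrow> norm (f s - 1) \<le> B * exp (- (\<delta> * Re s))"
  obtains B' \<sigma>' where "B' \<ge> 0" "\<And>s. \<sigma>' < Re s \<Longrightarrow> norm (deriv f s / f s) \<le> B' * exp (- (\<delta> * Re s))"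
proof -
  obtain x0 where x0: "\<And>x. x \<ge> x0 \<Longrightarrow> B * exp (- (\<delta> * x)) < 1 / 2"
    using exp_decay_eventually_small[OF assms(1), of "1 / 2" B] by (auto simp: eventually_at_top_linorder)
  define \<sigma>' where "\<sigma>' = max \<sigma> x0 + 1"
  have half: "norm (f s - 1) < 1 / 2" if "Re s > \<sigma>' - 1" for s
  proof -
    have "norm (f s - 1) \<le> B * exp (- (\<delta> * Re s))" by (rule near) (use that in \<open>simp add: \<sigma>'_def\<close>)
    also have "\<dots> < 1 / 2" by (rule x0) (use that in \<open>simp add: \<sigma>'_def\<close>)
    finally show ?thesis .
  qed
  have nz: "norm (f s) \<ge> 1 / 2" if "Re s > \<sigma>' - 1" for s
    using half[OF that] norm_triangle_ineq2[of 1 "1 - f s"] by (simp add: norm_minus_commute)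
  have an: "f analytic_on {s. \<sigma>' - 1 < Re s}"
    using nz by (subst analytic_on_analytic_at) (force intro!: analytic_off_divisor simp: divisor_supp_eq)
  hence hol: "f holomorphic_on {s. \<sigma>' - 1 < Re s}" by (rule analytic_imp_holomorphic)
  have "norm (deriv f s / f s) \<le> (4 * B * exp \<delta>) * exp (- (\<delta> * Re s))" if s: "\<sigma>' < Re s" for s
  proof -
    let ?M = "B * exp (- (\<delta> * (Re s - 1)))"
    have sub: "cball s (1/2) \<subseteq> {s. \<sigma>' - 1 < Re s}"
    proof
      fix z assume "z \<in> cball s (1/2)"
      hence "norm (s - z) \<le> 1/2" by (simp add: dist_norm)
      hence "Re (s - z) \<le> 1/2" using complex_Re_le_cmod[of "s - z"] by linarith
      hence "Re z \<ge> Re s - 1/2" by simp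
      thus "z \<in> {s. \<sigma>' - 1 < Re s}" using s by simp
    qed
    have "norm ((deriv ^^ 1) (\<lambda>z. f z - 1) s) \<le> fact 1 * ?M / (1/2) ^ 1"
    proof (rule Cauchy_inequality)
      have h: "(\<lambda>z. f z - 1) holomorphic_on cball s (1/2)"
        by (intro holomorphic_intros holomorphic_on_subset[OF hol sub])
      thus "(\<lambda>z. f z - 1) holomorphic_on ball s (1/2)" by (rule holomorphic_on_subset) auto
      show "continuous_on (cball s (1/2)) (\<lambda>z. f z - 1)" by (rule holomorphic_on_imp_continuous_on[OF h])
      fix z assume z: "norm (s - z) = 1/2"
      have "Re (s - z) \<le> 1/2" using complex_Re_le_cmod[of "s - z"] z by linarith
      hence r: "Re z \<ge> Re s - 1" "Re z \<ge> Re s - 1/2" by simp_all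
      have "norm (f z - 1) \<le> B * exp (- (\<delta> * Re z))" by (rule near) (use r s in \<open>simp add: \<sigma>'_def\<close>)
      also have "\<dots> \<le> ?M" using r assms(1,2) by (intro mult_left_mono) auto
      finally show "norm (f z - 1) \<le> ?M" .
    qed simp
    moreover have "deriv (\<lambda>z. f z - 1) s = deriv f s"
    proof -
      have "f field_differentiable at s"
        using an s by (intro analytic_on_imp_differentiable_at[of f "{s. \<sigma>' - 1 < Re s}"]) auto
      thus ?thesis by (simp add: deriv_diff)
    qed
    ultimately have d: "norm (deriv f s) \<le> 2 * ?M" by simp
    have "norm (deriv f s / f s) \<le> (2 * ?M) / (1 / 2)"
      unfolding norm_divide using d nz[of s] s assms(2) by (intro frac_le) auto
    also have "exp (- (\<delta> * (Re s - 1))) = exp \<delta> * exp (- (\<delta> * Re s))" by (simp add: algebra_simps flip: exp_add)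
    finally have "norm (deriv f s / f s) \<le> (2 * (B * (exp \<delta> * exp (- (\<delta> * Re s))))) / (1 / 2)" .
    also have "\<dots> = (4 * B * exp \<delta>) * exp (- (\<delta> * Re s))" by simp
    finally show ?thesis .
  qed
  thus ?thesis by (intro that[of "4 * B * exp \<delta>" \<sigma>']) (use assms in auto)
qed

text \<open>
  The pairing does not depend on the abscissa \<open>c\<close> and tends to 0 as \<open>c\<close> grows.
\<close>

lemma lld_distr_vanishes_near_0:
  assumes near: "\<delta> > 0" "B \<ge> 0" "\<And>s. \<sigma> < Re s \<Longrightarrow> norm (f s - 1) \<le> B * exp (- (\<delta> * Re s))"
    and q: "logderiv_expansion q"
    and \<phi>: "test_function \<phi>" and \<eta>: "\<eta> < \<delta>" "\<And>t. \<bar>t\<bar> > \<eta> \<Longrightarrow> \<phi> t = 0"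
  shows "lld_distr q \<phi> = 0"
proof -
  obtain B' \<sigma>' where B': "B' \<ge> 0" "\<And>s. \<sigma>' < Re s \<Longrightarrow> norm (deriv f s / f s) \<le> B' * exp (- (\<delta> * Re s))"
    by (rule logderiv_exp_decay[OF near]) (assumption | rule that)+
  obtain \<sigma>0 where \<sigma>0: "\<sigma>0 > 0" "\<And>\<rho>. \<rho> \<in> divisor_supp f \<Longrightarrow> Re \<rho> \<le> \<sigma>0" by (rule right_bound_exists) (rule that)
  have "((\<lambda>c. laplace_pairing (\<lambda>s. deriv f s / f s) c \<phi>) \<longlongrightarrow> 0) at_top"
    by (rule laplace_pairing_tendsto_0[OF near(1) B' \<phi> \<eta>])
  moreover have "eventually (\<lambda>c. laplace_pairing (\<lambda>s. deriv f s / f s) c \<phi> = lld_distr q \<phi>) at_top"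
    using eventually_gt_at_top[of \<sigma>0]
  proof eventually_elim
    case (elim c)
    show ?case by (rule laplace_pairing_logderiv[OF q \<sigma>0(2) _ elim \<phi>]) (use elim \<sigma>0(1) in auto)
  qed
  ultimately have lim: "((\<lambda>c::real. lld_distr q \<phi>) \<longlongrightarrow> 0) at_top" by (rule Lim_transform_eventually)
  show ?thesis by (rule tendsto_unique[OF trivial_limit_at_top_linorder tendsto_const lim])
qed

text \<open>
  If \<open>f\<close> is not of Hadamard type, its convergence exponent is at most \<open>degree Q\<close>.  For nonconstant \<open>Q\<close> the
  distribution then has a nonzero leading Dirac term at 0, although it vanishes near 0.  For constant \<open>Q\<close> the
  function is rational, \<open>f = P / R\<close>, and \<open>P - R = (f - 1) R\<close> tends to 0 along the positive axis, so \<open>P = R\<close>.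
\<close>

lemma hadamard_type_of_exp_near_1:
  assumes near: "\<delta> > 0" "B \<ge> 0" "\<And>s. \<sigma> < Re s \<Longrightarrow> norm (f s - 1) \<le> B * exp (- (\<delta> * Re s))"
    and ne: "f \<noteq> (\<lambda>_. 1)"
  shows "hadamard_type f"
proof (rule ccontr)
  assume "\<not> hadamard_type f"
  obtain Q where Q: "hadamard_factorization f Q"
    and q: "logderiv_expansion (pderiv Q)"
    by (rule hadamard_factorization_exists) (rule that)
  have conv: "conv_exponent f \<le> degree Q"
    using \<open>\<not> hadamard_type f\<close> unfolding hadamard_type_iff weierstrass_genus_eq[OF Q] hadamard_genus_def by linarith
  show False
  proof (cases "degree Q")
    case (Suc m)
    obtain \<phi> where \<phi>: "test_function \<phi>" "iter_deriv m \<phi> 0 \<noteq> 0" by (rule test_function_with_nonzero_jet) (rule that)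
    obtain M where M: "M > 0" "\<And>t. \<bar>t\<bar> > M \<Longrightarrow> \<phi> t = 0" by (rule test_function_support[OF \<phi>(1)]) (rule that)
    (* Once \<open>j\<close> is large the scaled test function is supported inside \<open>\<bar>t\<bar> < \<delta>\<close>, where the distribution vanishes. *)
    let ?L = "\<lambda>j. lld_distr (pderiv Q) (\<lambda>t. \<phi> (real (Suc j) * t)) / of_nat (Suc j) ^ m"
    have "eventually (\<lambda>j. real j \<ge> M / \<delta>) sequentially"
      using filterlim_real_sequentially by (simp add: filterlim_at_top)
    hence "eventually (\<lambda>j. 0 = ?L j) sequentially"
    proof eventually_elim
      case (elim j)
      have j: "real (Suc j) > 0" by simp
      have "M < \<delta> * real (Suc j)" using elim near(1) by (simp add: field_simps)
      hence \<eta>: "M / real (Suc j) < \<delta>" using j by (simp add: pos_divide_less_eq)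
      have "lld_distr (pderiv Q) (\<lambda>t. \<phi> (real (Suc j) * t)) = 0"
      proof (rule lld_distr_vanishes_near_0[OF near q _ \<eta>])
        show "test_function (\<lambda>t. \<phi> (real (Suc j) * t))" using test_function_affine[OF \<phi>(1), of "real (Suc j)" 0] by simp
        fix t assume "M / real (Suc j) < \<bar>t\<bar>"
        hence "M < real (Suc j) * \<bar>t\<bar>" using j by (simp add: pos_divide_less_eq mult.commute)
        thus "\<phi> (real (Suc j) * t) = 0" using j by (intro M(2)) (simp add: abs_mult)
      qed
      thus ?case by simp
    qed
    from Lim_transform_eventually[OF tendsto_const this] have "?L \<longlonglongrightarrow> 0" .
    from LIMSEQ_unique[OF this lld_distr_shrink_limit[OF conv Suc \<phi>(1)]]
    have "coeff (pderiv Q) m = 0" using \<phi>(2) by simp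
    moreover have "degree (pderiv Q) = m" "pderiv Q \<noteq> 0" using Suc degree_pderiv[of Q] by (auto simp: pderiv_eq_0_iff)
    ultimately show False using leading_coeff_neq_0 by blast
  next
    case 0
    have conv0: "conv_exponent f = 0" using conv 0 by simp
    obtain P R :: "complex poly" where PR: "P \<noteq> 0" "R \<noteq> 0" "f = (\<lambda>s. poly P s / poly R s)"
      "int (degree P) - int (degree R) = (\<Sum>\<rho>\<in>insert 0 D0. zorder f \<rho>)"
      by (rule rational_of_conv_exponent_0[OF conv0 Q 0]) (rule that)
    obtain C where C: "C \<ge> 0" "\<And>s. norm (poly R s) \<le> C * (1 + norm s) ^ degree R" by (rule poly_norm_le_power) (rule that)
    have finR: "finite {s. poly R s = 0}" by (rule poly_roots_finite[OF PR(2)])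
    have "((\<lambda>x::real. poly (P - R) (of_real x)) \<longlongrightarrow> 0) at_top"
    proof (rule Lim_null_comparison)
      have "finite {x::real. poly R (of_real x) = 0}"
        by (rule finite_imageD[of of_real, OF finite_subset[OF _ finR]]) (auto simp: inj_on_def)
      then obtain x1 where x1: "\<And>x. poly R (of_real x) = 0 \<Longrightarrow> x \<le> x1"
      proof -
        assume fin: "finite {x::real. poly R (of_real x) = 0}" and *: "\<And>x1. (\<And>x. poly R (of_real x) = 0 \<Longrightarrow> x \<le> x1) \<Longrightarrow> thesis"
        show thesis
          by (rule *[of "Max {x. poly R (of_real x) = 0}"]) (rule Max_ge[OF fin], simp)
      qed
      show "eventually (\<lambda>x. norm (poly (P - R) (of_real x)) \<le> (B * C) * ((1 + x) ^ degree R * exp (- (\<delta> * x)))) at_top"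
        using eventually_gt_at_top[of "max (max \<sigma> x1) 0"]
      proof eventually_elim
        case (elim x)
        let ?s = "complex_of_real x"
        have "poly R ?s \<noteq> 0" using x1[of x] elim by auto
        hence "poly (P - R) ?s = (f ?s - 1) * poly R ?s" by (simp add: PR(3) field_simps)
        hence "norm (poly (P - R) ?s) = norm (f ?s - 1) * norm (poly R ?s)" by (simp add: norm_mult)
        also have "\<dots> \<le> (B * exp (- (\<delta> * Re ?s))) * (C * (1 + norm ?s) ^ degree R)"
          using elim near(2) by (intro mult_mono near(3) C(2)) auto
        finally show ?case using elim by (simp add: mult_ac)
      qed
      from tendsto_mult[OF tendsto_const poly_mult_exp_decay[OF near(1)], of "B * C" "degree R"]
      show "((\<lambda>x. (B * C) * ((1 + x) ^ degree R * exp (- (\<delta> * x)))) \<longlongrightarrow> 0) at_top" by simp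
    qed
    hence "P - R = 0" by (rule poly_tendsto_0_imp_0)
    hence f1: "f s = 1" if "poly R s \<noteq> 0" for s using that by (simp add: PR(3))
    have "eventually (\<lambda>z. z \<notin> {s. poly R s = 0}) (at (0::complex))"
      using islimpt_finite[OF finR] unfolding islimpt_iff_eventually by simp
    hence "eventually (\<lambda>z. f z = 1) (at 0)" by eventually_elim (use f1 in auto)
    hence "frequently (\<lambda>z. f z = 1) (at 0)" by (intro eventually_frequently) auto
    hence "f w = 1" for w by (rule frequently_eq_meromorphic_imp_constant[OF _ nicely]) auto
    thus False using ne by auto
  qed
qed

end

section \<open>Functions of Hadamard type\<close>

lemma lld_fun_of_LLD:
  assumes "LLD f"
  shows "lld_fun f"
  using assms unfolding LLD_def meromorphic_finite_order_def by unfold_locales auto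

text \<open>
  A Dirichlet series is near 1 far to the right, so it has no zeros or poles there.
\<close>

lemma LLD_of_dirichlet_series:
  assumes dir: "dirichlet_series f"
  shows "LLD f"
proof -
  obtain \<delta> B \<sigma> where near: "\<delta> > 0" "B \<ge> 0" "\<And>s. \<sigma> < Re s \<Longrightarrow> norm (f s - 1) \<le> B * exp (- (\<delta> * Re s))"
    by (rule dirichlet_series_near_1[OF dir]) (rule that)
  have fin: "meromorphic_finite_order f" using dir by (simp add: dirichlet_series_def)
  then interpret mero_fun f by unfold_locales (auto simp: meromorphic_finite_order_def)
  obtain x0 where x0: "\<And>x. x \<ge> x0 \<Longrightarrow> B * exp (- (\<delta> * x)) < 1"
    using exp_decay_eventually_small[OF near(1), of 1 B] by (auto simp: eventually_at_top_linorder)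
  have "Re \<rho> \<le> max \<sigma> x0" if "\<rho> \<in> divisor_supp f" for \<rho>
  proof (rule ccontr)
    assume "\<not> Re \<rho> \<le> max \<sigma> x0"
    hence "\<sigma> < Re \<rho>" "x0 \<le> Re \<rho>" by auto
    hence "norm (f \<rho> - 1) < 1" using near(3)[of \<rho>] x0[of "Re \<rho>"] by linarith
    thus False using that by (simp add: divisor_supp_eq)
  qed
  hence "bdd_above (Re ` divisor_supp f)" by (intro bdd_aboveI2)
  thus ?thesis using fin by (simp add: LLD_def)
qed

theorem theorem11:
  shows "(\<forall>f. LLD f \<and> \<not> rational_finite_at_infinity f \<and>
              int (vertical_order f) \<noteq> weierstrass_genus f + 1 \<longrightarrow> hadamard_type f) \<and>
         (\<forall>f. dirichlet_series f \<and> f \<noteq> (\<lambda>_. 1) \<longrightarrow> hadamard_type f)"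
proof (intro conjI allI impI)
  fix f assume f: "LLD f \<and> \<not> rational_finite_at_infinity f \<and> int (vertical_order f) \<noteq> weierstrass_genus f + 1"
  then interpret lld_fun f by (intro lld_fun_of_LLD) blast
  obtain Q where Q: "hadamard_factorization f Q"
    and q: "logderiv_expansion (pderiv Q)"
    by (rule hadamard_factorization_exists) (rule that)
  show "hadamard_type f"
  proof (rule ccontr)
    assume "\<not> hadamard_type f"
    hence conv: "conv_exponent f \<le> degree Q"
      unfolding hadamard_type_iff weierstrass_genus_eq[OF Q] hadamard_genus_def by linarith
    have rat: "\<not> rational_finite_at_infinity f" using f by blast
    have "vertical_order f = Suc (degree Q)"
      by (rule vertical_order_eq[OF Q conv q rat])
    thus False using conjunct2[OF conjunct2[OF f]] unfolding weierstrass_genus_eq[OF Q] by simp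
  qed
next
  fix f assume f: "dirichlet_series f \<and> f \<noteq> (\<lambda>_. 1)"
  then interpret lld_fun f by (intro lld_fun_of_LLD LLD_of_dirichlet_series) blast
  obtain \<delta> B \<sigma> where near: "\<delta> > 0" "B \<ge> 0" "\<And>s. \<sigma> < Re s \<Longrightarrow> norm (f s - 1) \<le> B * exp (- (\<delta> * Re s))"
    by (rule dirichlet_series_near_1[OF conjunct1[OF f]]) (rule that)
  show "hadamard_type f" by (rule hadamard_type_of_exp_near_1[OF near]) (use f in blast)+
qed

end
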